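(* Let $\mathscr{P}$ be a $C^*$-planar algebra and let $x\in\mathscr{P}_{2,+}$ be $\mathfrak{F}$-positive. Let $B=\bigvee_{k=0}^\infty\mathcal{R}(\widehat{x}^{( *k)})\in\mathscr{P}_{2,-}$. For $p\in\mathscr{P}_{1,+}$ let $\mathrm{cl}(p)\in\mathscr{P}_{0,+}$ denote its closure (its top end joined to its bottom end on the right). Consider the statements: (1) $B=1$ and $\dim\mathscr{P}_{0,+}=1$. (2) $B=1$ and $tr_{0,+}(\mathrm{cl}(p_1)\,\mathrm{cl}(p_2))\neq 0$ for any minimal projections $p_1,p_2\in\mathscr{P}_{1,+}$. (3) $B(\overline{p_1}\otimes p_2)\neq 0$ for any minimal projections $p_1,p_2\in\mathscr{P}_{1,+}$. (4) $tr_{2,-}(B(\overline{p_1}\otimes p_2))\neq 0$ for any minimal projections $p_1,p_2\in\mathscr{P}_{1,+}$. (5) $\mathcal{R}(p*B)=I$ for any nonzero projection $p\in\mathscr{P}_{1,+}$. (6) $x$ is irreducible on $\mathscr{P}_{1,+}$; that is, for any projection $p\in\mathscr{P}_{1,+}$, if $p*\widehat{x}\le\lambda p$ for some $\lambda>0$, then $p=0$ or $p=I$. (7) For any nonzero projection $p\in\mathscr{P}_{1,+}$, $p*(e_1+\widehat{x})^{( *(d-1))}$ is strictly positive, where $d=\dim\mathscr{P}_{1,+}$ and $e_1$ is the Jones projection. (8) For any nonzero positive elements $y_1,y_2\in\mathscr{P}_{1,+}$ with $\langle y_1,y_2\rangle=0$, there exists $k_0\in\mathbb{N}$, $k_0<d$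 (with $d=\dim\mathscr{P}_{1,+}$), such that $\langle y_1*\widehat{x}^{( *k_0)},y_2\rangle>0$. (9) For any projection $q\in\mathscr{P}_{1,-}$, if $\widehat{x}*q\le\lambda q$ for some $\lambda>0$, then $q=0$ or $q=I$. Then $(1)\Rightarrow(2)\Rightarrow(3)$, and the statements (3), (4), (5), (6), (7), (8), (9) are all equivalent.
   Context: $C^*$-planar algebra: a (shaded) planar algebra in the sense of Jones is a family $\mathscr{P}=\{\mathscr{P}_{n,\pm}\}_{n\ge 0}$ of complex vector spaces on which shaded planar tangles act multilinearly, compatibly with isotopy and composition of tangles. Elements of $\mathscr{P}_{n,\pm}$ are boxes with $n$ strings attached on top and $n$ on the bottom; the region at the left (marked) side is unshaded for $+$ and shaded for $-$. It is a $C^*$-planar algebra if each $\mathscr{P}_{n,\pm}$ is a finite-dimensional unital $C^*$-algebra (unit $I$ or $1$) for the vertical stacking product ($xy$ is drawn with $y$ above $x$), the involution $*$ is compatible with reflection of tangles in a horizontal line, and there are positive faithful traces $tr_{n,\pm}$ with $tr_{n,\pm}(x)=tr_{0,\pm}$(closure of $x$), the closure joining each top string to the corresponding bottom string. The inner product on $\mathscr{P}_{1,+}$ is $\langle y_1,y_2\rangle=tr_{1,+}(y_2^*y_1)$. Fourier transform: $\mathfrak{F}:\mathscr{P}_{2,\pm}\to\mathscr{P}_{2,\mp}$, $\widehat{x}=\mathfrak{F}(x)$, is the $90^\circ$ rotation: the top-left, top-right, bottom-left, bottom-right boundary points of $\widehat{x}$ are connected respectively to the bottom-left, top-left, bottom-right,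 top-right points of $x$. Convolution: for $2$-boxes $u,v\in\mathscr{P}_{2,-}$, $u*v$ is obtained by placing $u$ to the left of $v$ and joining the top-right point of $u$ to the top-left point of $v$ and the bottom-right point of $u$ to the bottom-left point of $v$. For $y\in\mathscr{P}_{1,+}$ and $u\in\mathscr{P}_{2,-}$, $y*u\in\mathscr{P}_{1,+}$ is obtained by placing $y$ to the left of $u$ and joining the top (bottom) end of $y$ to the top-left (bottom-left) point of $u$; for $q\in\mathscr{P}_{1,-}$, $u*q\in\mathscr{P}_{1,-}$ is obtained by placing $q$ to the right of $u$ and joining its ends to the top-right and bottom-right points of $u$. $u^{( *k)}$ is the $k$-fold convolution power; $u^{( *0)}$ is the convolution identity $\widehat{1}$, i.e. the cap-cup diagram. The Jones projection $e_1\in\mathscr{P}_{2,-}$ is the normalized (positive scalar multiple of the) cap-cup diagram. $\overline{y}$ is the $180^\circ$ rotation of $y$, so $\overline{y}\in\mathscr{P}_{1,-}$ for $y\in\mathscr{P}_{1,+}$. For $a\in\mathscr{P}_{1,-}$, $b\in\mathscr{P}_{1,+}$, $a\otimes b\in\mathscr{P}_{2,-}$ is the horizontal juxtaposition. $\mathcal{R}(a)$ is the range projection of $a$. An element of a $C^*$-algebra is positive if it is of the form $aa^*$, and strictly positive if it is positive and invertible. $x\in\mathscr{P}_{2,+}$ is $\mathfrak{F}$-positive if $\widehat{x}$ is positive in $\mathscr{P}_{2,-}$. *)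

theory Defs
  imports Complex_Main "HOL-Library.Complex_Order"
begin

section \<open>Shaded planar tangles\<close>

text \<open>
  A shaded planar tangle is recorded up to planar isotopy by its incidence data: discs, strings,
  regions, and how they meet. The outer disc is \<^term>\<open>None\<close>; the input discs are \<open>Some D\<close> for
  labels \<open>D\<close> in a finite set. A disc of colour \<open>(n, s)\<close> has \<open>2 * n\<close> boundary points
  \<open>0, \<dots>, 2 * n - 1\<close>, numbered clockwise from the marked (left) interval, so that \<open>0, \<dots>, n - 1\<close> are
  the top points from left to right and \<open>n, \<dots>, 2 * n - 1\<close> the bottom points from right to left.
  Interval \<open>j\<close> is the piece of the boundary circle that precedes point \<open>j\<close>; thus interval \<open>0\<close> is the
  marked one, point \<open>j\<close> lies between intervals \<open>j\<close> and \<open>j + 1\<close> (mod \<open>2 * n\<close>), and a disc with \<open>n = 0\<close>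
  has only interval \<open>0\<close>. The colour component \<open>s\<close> is the shading next to the marked interval:
  \<open>Unshaded\<close> is the sign \<open>+\<close>, \<open>Shaded\<close> the sign \<open>-\<close>.
\<close>

datatype shading = Unshaded | Shaded

fun opp :: "shading \<Rightarrow> shading" where
  "opp Unshaded = Shaded"
| "opp Shaded = Unshaded"

type_synonym colour = "nat \<times> shading"

text \<open>
  \<open>strand T d j\<close> is the string ending at point \<open>j\<close> of disc \<open>d\<close>, \<open>reg T d j\<close> the region at interval \<open>j\<close>
  of disc \<open>d\<close>, and \<open>side T e s\<close> the region on the side of string \<open>e\<close> that has shading \<open>s\<close>. A string at
  which no boundary point lies is a closed loop.
\<close>

record tangle =
  inner :: "nat set"
  colour :: "nat option \<Rightarrow> colour"
  strings :: "nat set"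
  regions :: "nat set"
  strand :: "nat option \<Rightarrow> nat \<Rightarrow> nat"
  reg :: "nat option \<Rightarrow> nat \<Rightarrow> nat"
  side :: "nat \<Rightarrow> shading \<Rightarrow> nat"

definition discs :: "tangle \<Rightarrow> nat option set" where
  "discs T = insert None (Some ` inner T)"

definition npoints :: "tangle \<Rightarrow> nat option \<Rightarrow> nat" where
  "npoints T d = 2 * fst (colour T d)"

definition nintervals :: "tangle \<Rightarrow> nat option \<Rightarrow> nat" where
  "nintervals T d = max 1 (npoints T d)"

definition points :: "tangle \<Rightarrow> (nat option \<times> nat) set" where
  "points T = (SIGMA d:discs T. {..<npoints T d})"

definition intervals :: "tangle \<Rightarrow> (nat option \<times> nat) set" where
  "intervals T = (SIGMA d:discs T. {..<nintervals T d})"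

definition ishade :: "tangle \<Rightarrow> nat option \<Rightarrow> nat \<Rightarrow> shading" where
  "ishade T d j = (if even j then snd (colour T d) else opp (snd (colour T d)))"

text \<open>
  Orient every string so that its unshaded side is on its left. \<open>outgoing\<close> says that the string
  starts (rather than ends) at the given point. At a point of an input disc, a string leaving the
  disc has interval \<open>j\<close> on its left; at a point of the outer disc, a string entering the picture
  has interval \<open>j\<close> on its right.
\<close>

definition outgoing :: "tangle \<Rightarrow> nat option \<times> nat \<Rightarrow> bool" where
  "outgoing T = (\<lambda>(d, j). (ishade T d j = Unshaded) \<longleftrightarrow> d \<noteq> None)"

definition wf_tangle :: "tangle \<Rightarrow> bool" where
  "wf_tangle T \<longleftrightarrow>
     finite (inner T) \<and> finite (strings T) \<and> finite (regions T) \<and>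
     (\<forall>(d, j)\<in>points T. strand T d j \<in> strings T) \<and>
     (\<forall>(d, j)\<in>intervals T. reg T d j \<in> regions T) \<and>
     (\<forall>e\<in>strings T. \<forall>s. side T e s \<in> regions T) \<and>
     (\<exists>sh. (\<forall>(d, j)\<in>intervals T. sh (reg T d j) = ishade T d j) \<and>
           (\<forall>e\<in>strings T. \<forall>s. sh (side T e s) = s)) \<and>
     (\<forall>(d, j)\<in>points T.
        reg T d j = side T (strand T d j) (ishade T d j) \<and>
        reg T d (Suc j mod npoints T d) = side T (strand T d j) (opp (ishade T d j))) \<and>
     (\<forall>e\<in>strings T.
        {p\<in>points T. case_prod (strand T) p = e} = {} \<or>
        (\<exists>p q. {p\<in>points T. case_prod (strand T) p = e} = {p, q} \<and>
               outgoing T p \<and> \<not> outgoing T q))"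

definition adjacent_regions :: "tangle \<Rightarrow> nat \<Rightarrow> nat \<Rightarrow> bool" where
  "adjacent_regions T r r' \<longleftrightarrow>
     (\<exists>d\<in>discs T. {r, r'} \<subseteq> reg T d ` {..<nintervals T d}) \<or>
     (\<exists>e\<in>strings T. {r, r'} \<subseteq> range (side T e))"

definition connected_tangle :: "tangle \<Rightarrow> bool" where
  "connected_tangle T \<longleftrightarrow> (\<forall>r\<in>regions T. \<forall>r'\<in>regions T. equivclp (adjacent_regions T) r r')"

text \<open>
  The boundary curves of the regions run alternately along intervals and along sides of strings.
  They are the connected components of the graph whose vertices are the intervals and the sides
  \<open>(e, s)\<close> of strings, an interval being joined to a side if that side starts or ends at it. Each
  side of a closed loop is a curve of its own, as is the boundary circle of a disc without points.
\<close>

definition curve_pieces :: "tangle \<Rightarrow> ((nat option \<times> nat) + (nat \<times> shading)) set" where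
  "curve_pieces T = intervals T <+> (strings T \<times> UNIV)"

definition follows :: "tangle \<Rightarrow> (nat option \<times> nat) + (nat \<times> shading)
    \<Rightarrow> (nat option \<times> nat) + (nat \<times> shading) \<Rightarrow> bool" where
  "follows T v w \<longleftrightarrow> (\<exists>(d, i)\<in>points T. \<exists>j\<in>{i, Suc i mod npoints T d}.
     v = Inl (d, j) \<and> w = Inr (strand T d i, ishade T d j))"

definition boundary_curves :: "tangle \<Rightarrow> ((nat option \<times> nat) + (nat \<times> shading)) set set" where
  "boundary_curves T =
     curve_pieces T // {(v, w) \<in> curve_pieces T \<times> curve_pieces T. equivclp (follows T) v w}"

text \<open>
  Glue sphere pieces (one for each region, with as many holes as the region has boundary curves)
  to the strings and discs, the exterior of the outer disc counting as a disc. The data come from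
  a planar picture iff the resulting closed oriented surface is a sphere, i.e. is connected and has
  Euler characteristic \<open>2\<close>. Discs contribute \<open>1\<close>, non-closed strings \<open>- 1\<close>, closed ones \<open>0\<close>, and a
  region with \<open>b\<close> boundary curves contributes \<open>2 - b\<close>.
\<close>

definition planar_tangle :: "tangle \<Rightarrow> bool" where
  "planar_tangle T \<longleftrightarrow> wf_tangle T \<and> connected_tangle T \<and>
     card (discs T) + 2 * card (regions T) =
       2 + (\<Sum>d\<in>discs T. fst (colour T d)) + card (boundary_curves T)"

text \<open>Isotopy, where \<open>\<delta>\<close> tells which input disc moves to which.\<close>

definition isotopic :: "(nat \<Rightarrow> nat) \<Rightarrow> tangle \<Rightarrow> tangle \<Rightarrow> bool" where
  "isotopic \<delta> T U \<longleftrightarrow> bij_betw \<delta> (inner T) (inner U) \<and>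
     (\<exists>f g. bij_betw f (strings T) (strings U) \<and> bij_betw g (regions T) (regions U) \<and>
        (\<forall>d\<in>discs T.
           colour U (map_option \<delta> d) = colour T d \<and>
           (\<forall>j<npoints T d. strand U (map_option \<delta> d) j = f (strand T d j)) \<and>
           (\<forall>j<nintervals T d. reg U (map_option \<delta> d) j = g (reg T d j))) \<and>
        (\<forall>e\<in>strings T. \<forall>s. side U (f e) s = g (side T e s)))"

text \<open>
  \<open>glued A B R C f\<close>: via \<open>f\<close>, the set \<open>C\<close> is the quotient of the disjoint union of \<open>A\<close> and \<open>B\<close> by the
  equivalence relation that \<open>R\<close> generates.
\<close>

definition glued :: "nat set \<Rightarrow> nat set \<Rightarrow> (nat \<Rightarrow> nat \<Rightarrow> bool) \<Rightarrow> nat set \<Rightarrow> (nat + nat \<Rightarrow> nat) \<Rightarrow> bool" where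
  "glued A B R C f \<longleftrightarrow> f ` (A <+> B) = C \<and>
     (\<forall>v\<in>A <+> B. \<forall>w\<in>A <+> B.
        f v = f w \<longleftrightarrow> equivclp (\<lambda>v w. \<exists>a b. v = Inl a \<and> w = Inr b \<and> R a b) v w)"

text \<open>
  \<open>composite T D S U\<close>: \<open>U\<close> is the tangle \<open>T \<circ>\<^sub>D S\<close> obtained by inserting \<open>S\<close> into the input disc \<open>D\<close>
  of \<open>T\<close> and erasing the common boundary circle. Strings that meet at its points and regions that
  meet along its intervals are joined; new closed loops arise as string classes without endpoints.
\<close>

definition composite :: "tangle \<Rightarrow> nat \<Rightarrow> tangle \<Rightarrow> tangle \<Rightarrow> bool" where
  "composite T D S U \<longleftrightarrow>
     D \<in> inner T \<and> colour S None = colour T (Some D) \<and>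
     (inner T - {D}) \<inter> inner S = {} \<and> inner U = (inner T - {D}) \<union> inner S \<and>
     (\<exists>f g.
        glued (strings T) (strings S)
          (\<lambda>a b. \<exists>j<npoints S None. a = strand T (Some D) j \<and> b = strand S None j)
          (strings U) f \<and>
        glued (regions T) (regions S)
          (\<lambda>a b. \<exists>j<nintervals S None. a = reg T (Some D) j \<and> b = reg S None j)
          (regions U) g \<and>
        (\<forall>d\<in>discs T - {Some D}. colour U d = colour T d \<and>
           (\<forall>j<npoints T d. strand U d j = f (Inl (strand T d j))) \<and>
           (\<forall>j<nintervals T d. reg U d j = g (Inl (reg T d j)))) \<and>
        (\<forall>d\<in>discs S - {None}. colour U d = colour S d \<and>
           (\<forall>j<npoints S d. strand U d j = f (Inr (strand S d j))) \<and>
           (\<forall>j<nintervals S d. reg U d j = g (Inr (reg S d j)))) \<and>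
        (\<forall>e\<in>strings T. \<forall>s. side U (f (Inl e)) s = g (Inl (side T e s))) \<and>
        (\<forall>e\<in>strings S. \<forall>s. side U (f (Inr e)) s = g (Inr (side S e s))))"

text \<open>Reflection in a horizontal line; the marked intervals stay on the left.\<close>

definition reflect :: "tangle \<Rightarrow> tangle" where
  "reflect T = T\<lparr>
     strand := (\<lambda>d j. strand T d (npoints T d - 1 - j)),
     reg := (\<lambda>d j. reg T d (if j = 0 then 0 else npoints T d - j))\<rparr>"


section \<open>Particular tangles\<close>

definition col_shade :: "shading \<Rightarrow> nat \<Rightarrow> shading" where
  "col_shade s i = (if even i then s else opp s)"

text \<open>The annular tangle with \<open>2 * n\<close> radial strings, acting as the identity on \<open>(n, s)\<close>-boxes.\<close>

definition id_tangle :: "colour \<Rightarrow> tangle" where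
  "id_tangle c = (let n = fst c; s = snd c in
     \<lparr> inner = {0}, colour = (\<lambda>_. c),
       strings = {..<2 * n}, regions = {..<max 1 (2 * n)},
       strand = (\<lambda>_ j. j), reg = (\<lambda>_ j. j),
       side = (\<lambda>e t. if t = col_shade s e then e else Suc e mod (2 * n)) \<rparr>)"

text \<open>\<open>n\<close> vertical strings; \<open>i\<close>-th string between columns \<open>i\<close> and \<open>i + 1\<close>.\<close>

definition unit_tangle :: "colour \<Rightarrow> tangle" where
  "unit_tangle c = (let n = fst c; s = snd c in
     \<lparr> inner = {}, colour = (\<lambda>_. c),
       strings = {..<n}, regions = {..n},
       strand = (\<lambda>_ j. min j (2 * n - 1 - j)), reg = (\<lambda>_ j. min j (2 * n - j)),
       side = (\<lambda>e t. if t = col_shade s e then e else Suc e) \<rparr>)"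

text \<open>
  Input \<open>0\<close> is the lower box, input \<open>1\<close> the upper one. Level \<open>0\<close> is above the upper box, level \<open>1\<close>
  between the boxes, level \<open>2\<close> below the lower box. String \<open>3 * i + a\<close> is the \<open>i\<close>-th string at level
  \<open>a\<close>; the columns strictly between the first and the last string are cut by the boxes into three
  regions, whereas the leftmost and the rightmost columns are not cut.
\<close>

definition mult_region :: "nat \<Rightarrow> nat \<Rightarrow> nat \<Rightarrow> nat" where
  "mult_region n a i = (if i = 0 then 0 else if i = n then 1 else 3 * i + a)"

definition mult_tangle :: "colour \<Rightarrow> tangle" where
  "mult_tangle c = (let n = fst c; s = snd c;
       top = (\<lambda>d. case d of None \<Rightarrow> 0 | Some k \<Rightarrow> if k = 1 then 0 else 1);
       bottom = (\<lambda>d. case d of None \<Rightarrow> 2 | Some k \<Rightarrow> if k = 1 then 1 else 2) in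
     \<lparr> inner = {0, 1}, colour = (\<lambda>_. c),
       strings = {..<3 * n}, regions = {mult_region n a i |a i. a < 3 \<and> i \<le> n},
       strand = (\<lambda>d j. if j < n then 3 * j + top d else 3 * (2 * n - 1 - j) + bottom d),
       reg = (\<lambda>d j. if j \<le> n then mult_region n (top d) j
                    else mult_region n (bottom d) (2 * n - j)),
       side = (\<lambda>e t. mult_region n (e mod 3)
                 (if t = col_shade s (e div 3) then e div 3 else Suc (e div 3))) \<rparr>)"

text \<open>String \<open>i\<close> joins the \<open>i\<close>-th top point to the \<open>i\<close>-th bottom point around the right of the box.\<close>

definition closure_tangle :: "colour \<Rightarrow> tangle" where
  "closure_tangle c = (let n = fst c; s = snd c in
     \<lparr> inner = {0}, colour = (\<lambda>d. case d of None \<Rightarrow> (0, s) | Some _ \<Rightarrow> c),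
       strings = {..<n}, regions = {..n},
       strand = (\<lambda>_ j. min j (2 * n - 1 - j)),
       reg = (\<lambda>d j. case d of None \<Rightarrow> 0 | Some _ \<Rightarrow> min j (2 * n - j)),
       side = (\<lambda>e t. if t = col_shade s e then e else Suc e) \<rparr>)"

text \<open>
  Tangles given by tables. Each disc is a triple of its sign, the list of the strings at its points
  and the list of the regions at its intervals, both clockwise from the marked interval; input disc
  \<open>k\<close> is the \<open>k\<close>-th entry of \<open>ds\<close>. The \<open>e\<close>-th entry of \<open>es\<close> lists the unshaded and the shaded side
  of string \<open>e\<close>.
\<close>

definition diagram :: "shading \<times> nat list \<times> nat list \<Rightarrow> (shading \<times> nat list \<times> nat list) list
    \<Rightarrow> (nat \<times> nat) list \<Rightarrow> tangle" where
  "diagram d0 ds es = (let disc = (\<lambda>d. case d of None \<Rightarrow> d0 | Some k \<Rightarrow> ds ! k) in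
     \<lparr> inner = {..<length ds},
       colour = (\<lambda>d. (length (fst (snd (disc d))) div 2, fst (disc d))),
       strings = {..<length es},
       regions = fst ` set es \<union> snd ` set es,
       strand = (\<lambda>d j. fst (snd (disc d)) ! j),
       reg = (\<lambda>d j. snd (snd (disc d)) ! j),
       side = (\<lambda>e t. case t of Unshaded \<Rightarrow> fst (es ! e) | Shaded \<Rightarrow> snd (es ! e)) \<rparr>)"

definition fourier_tangle :: tangle where
  "fourier_tangle = diagram (Shaded, [0, 1, 2, 3], [0, 1, 2, 3])
     [(Unshaded, [1, 2, 3, 0], [1, 2, 3, 0])]
     [(1, 0), (1, 2), (3, 2), (3, 0)]"

definition conv_tangle :: tangle where
  "conv_tangle = diagram (Shaded, [0, 1, 2, 3], [0, 1, 2, 3])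
     [(Shaded, [0, 4, 5, 3], [0, 1, 4, 3]), (Shaded, [4, 1, 2, 5], [4, 1, 2, 3])]
     [(1, 0), (1, 2), (3, 2), (3, 0), (1, 4), (3, 4)]"

text \<open>\<open>y * u\<close> for a \<open>1\<close>-box \<open>y\<close> and a \<open>2\<close>-box \<open>u\<close>.\<close>

definition lconv_tangle :: tangle where
  "lconv_tangle = diagram (Unshaded, [0, 1], [0, 1])
     [(Unshaded, [2, 3], [0, 2]), (Shaded, [2, 0, 1, 3], [2, 0, 1, 0])]
     [(0, 1), (0, 1), (0, 2), (0, 2)]"

text \<open>\<open>u * q\<close> for a \<open>2\<close>-box \<open>u\<close> and a \<open>1\<close>-box \<open>q\<close>.\<close>

definition rconv_tangle :: tangle where
  "rconv_tangle = diagram (Shaded, [0, 1], [0, 1])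
     [(Shaded, [0, 2, 3, 1], [0, 1, 2, 1]), (Shaded, [2, 3], [2, 1])]
     [(1, 0), (1, 0), (1, 2), (1, 2)]"

definition rotate_tangle :: tangle where
  "rotate_tangle = diagram (Shaded, [0, 1], [0, 1])
     [(Unshaded, [1, 0], [1, 0])]
     [(1, 0), (1, 0)]"

definition juxtapose_tangle :: tangle where
  "juxtapose_tangle = diagram (Shaded, [0, 1, 2, 3], [0, 1, 2, 1])
     [(Shaded, [0, 3], [0, 1]), (Unshaded, [1, 2], [1, 2])]
     [(1, 0), (1, 2), (1, 2), (1, 0)]"


section \<open>Planar algebras\<close>

text \<open>
  The spaces \<open>box \<PP> (n, s)\<close> of a planar algebra are subspaces of one complex vector space. This
  is no restriction: any family of vector spaces embeds into its direct sum.
\<close>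

record 'a planar_alg =
  scal :: "complex \<Rightarrow> 'a \<Rightarrow> 'a"
  box :: "colour \<Rightarrow> 'a set"
  act :: "tangle \<Rightarrow> (nat \<Rightarrow> 'a) \<Rightarrow> 'a"

record 'a cstar_planar_alg = "'a planar_alg" +
  star :: "colour \<Rightarrow> 'a \<Rightarrow> 'a"
  tr :: "colour \<Rightarrow> 'a \<Rightarrow> complex"

definition inputs :: "('a, 'b) planar_alg_scheme \<Rightarrow> tangle \<Rightarrow> (nat \<Rightarrow> 'a) set" where
  "inputs \<PP> T = {x. \<forall>d\<in>inner T. x d \<in> box \<PP> (colour T (Some d))}"

locale planar_algebra = vector_space "scal \<PP>"
  for \<PP> :: "('a::ab_group_add, 'b) planar_alg_scheme" +
  assumes subspace_box: "subspace (box \<PP> c)"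
    and act_closed:
      "planar_tangle T \<Longrightarrow> x \<in> inputs \<PP> T \<Longrightarrow> act \<PP> T x \<in> box \<PP> (colour T None)"
    and act_add:
      "planar_tangle T \<Longrightarrow> x \<in> inputs \<PP> T \<Longrightarrow> d \<in> inner T \<Longrightarrow>
       a \<in> box \<PP> (colour T (Some d)) \<Longrightarrow> b \<in> box \<PP> (colour T (Some d)) \<Longrightarrow>
       act \<PP> T (x(d := a + b)) = act \<PP> T (x(d := a)) + act \<PP> T (x(d := b))"
    and act_scal:
      "planar_tangle T \<Longrightarrow> x \<in> inputs \<PP> T \<Longrightarrow> d \<in> inner T \<Longrightarrow>
       a \<in> box \<PP> (colour T (Some d)) \<Longrightarrow>
       act \<PP> T (x(d := scal \<PP> r a)) = scal \<PP> r (act \<PP> T (x(d := a)))"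
    and act_isotopic:
      "planar_tangle T \<Longrightarrow> planar_tangle U \<Longrightarrow> isotopic \<delta> T U \<Longrightarrow>
       x \<in> inputs \<PP> T \<Longrightarrow> (\<And>d. d \<in> inner T \<Longrightarrow> y (\<delta> d) = x d) \<Longrightarrow>
       act \<PP> U y = act \<PP> T x"
    and act_composite:
      "planar_tangle T \<Longrightarrow> planar_tangle S \<Longrightarrow> composite T D S U \<Longrightarrow> x \<in> inputs \<PP> U \<Longrightarrow>
       act \<PP> U x = act \<PP> T (x(D := act \<PP> S x))"
    and act_id:
      "a \<in> box \<PP> c \<Longrightarrow> act \<PP> (id_tangle c) (\<lambda>_. a) = a"

abbreviation act1 :: "('a, 'b) planar_alg_scheme \<Rightarrow> tangle \<Rightarrow> 'a \<Rightarrow> 'a" where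
  "act1 \<PP> T a \<equiv> act \<PP> T (\<lambda>k. [a] ! k)"

abbreviation act2 :: "('a, 'b) planar_alg_scheme \<Rightarrow> tangle \<Rightarrow> 'a \<Rightarrow> 'a \<Rightarrow> 'a" where
  "act2 \<PP> T a b \<equiv> act \<PP> T (\<lambda>k. [a, b] ! k)"

definition one :: "('a, 'b) planar_alg_scheme \<Rightarrow> colour \<Rightarrow> 'a" where
  "one \<PP> c = act \<PP> (unit_tangle c) (\<lambda>_. undefined)"

definition mult :: "('a, 'b) planar_alg_scheme \<Rightarrow> colour \<Rightarrow> 'a \<Rightarrow> 'a \<Rightarrow> 'a" where
  "mult \<PP> c x y = act2 \<PP> (mult_tangle c) x y"

definition box_closure :: "('a, 'b) planar_alg_scheme \<Rightarrow> colour \<Rightarrow> 'a \<Rightarrow> 'a" where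
  "box_closure \<PP> c x = act1 \<PP> (closure_tangle c) x"

definition fourier :: "('a, 'b) planar_alg_scheme \<Rightarrow> 'a \<Rightarrow> 'a" where
  "fourier \<PP> x = act1 \<PP> fourier_tangle x"

definition conv :: "('a, 'b) planar_alg_scheme \<Rightarrow> 'a \<Rightarrow> 'a \<Rightarrow> 'a" where
  "conv \<PP> u v = act2 \<PP> conv_tangle u v"

definition lconv :: "('a, 'b) planar_alg_scheme \<Rightarrow> 'a \<Rightarrow> 'a \<Rightarrow> 'a" where
  "lconv \<PP> y u = act2 \<PP> lconv_tangle y u"

definition rconv :: "('a, 'b) planar_alg_scheme \<Rightarrow> 'a \<Rightarrow> 'a \<Rightarrow> 'a" where
  "rconv \<PP> u q = act2 \<PP> rconv_tangle u q"

definition rotate1box :: "('a, 'b) planar_alg_scheme \<Rightarrow> 'a \<Rightarrow> 'a" where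
  "rotate1box \<PP> y = act1 \<PP> rotate_tangle y"

definition juxtapose :: "('a, 'b) planar_alg_scheme \<Rightarrow> 'a \<Rightarrow> 'a \<Rightarrow> 'a" where
  "juxtapose \<PP> a b = act2 \<PP> juxtapose_tangle a b"

text \<open>The convolution identity. It need not be a multiple of a projection when closed loops are not scalars.\<close>

definition cap_cup :: "('a, 'b) planar_alg_scheme \<Rightarrow> 'a" where
  "cap_cup \<PP> = fourier \<PP> (one \<PP> (2, Unshaded))"

primrec conv_power :: "('a, 'b) planar_alg_scheme \<Rightarrow> 'a \<Rightarrow> nat \<Rightarrow> 'a" where
  "conv_power \<PP> u 0 = cap_cup \<PP>"
| "conv_power \<PP> u (Suc k) = conv \<PP> (conv_power \<PP> u k) u"


section \<open>\<open>C\<^sup>*\<close>-structure\<close>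

text \<open>Completeness of the norm is automatic in finite dimension.\<close>

locale fin_dim_cstar_algebra = vector_space scl
  for scl :: "complex \<Rightarrow> 'a::ab_group_add \<Rightarrow> 'a" +
  fixes A :: "'a set" and mul :: "'a \<Rightarrow> 'a \<Rightarrow> 'a" and st :: "'a \<Rightarrow> 'a" and u :: 'a
  assumes subspace_carrier: "subspace A"
    and fin_dim: "\<exists>F. finite F \<and> span F = A"
    and mul_closed: "a \<in> A \<Longrightarrow> b \<in> A \<Longrightarrow> mul a b \<in> A"
    and mul_add_left: "a \<in> A \<Longrightarrow> b \<in> A \<Longrightarrow> c \<in> A \<Longrightarrow> mul (a + b) c = mul a c + mul b c"
    and mul_add_right: "a \<in> A \<Longrightarrow> b \<in> A \<Longrightarrow> c \<in> A \<Longrightarrow> mul a (b + c) = mul a b + mul a c"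
    and mul_scl_left: "a \<in> A \<Longrightarrow> b \<in> A \<Longrightarrow> mul (scl r a) b = scl r (mul a b)"
    and mul_scl_right: "a \<in> A \<Longrightarrow> b \<in> A \<Longrightarrow> mul a (scl r b) = scl r (mul a b)"
    and mul_assoc: "a \<in> A \<Longrightarrow> b \<in> A \<Longrightarrow> c \<in> A \<Longrightarrow> mul (mul a b) c = mul a (mul b c)"
    and unit_closed: "u \<in> A"
    and unit_left: "a \<in> A \<Longrightarrow> mul u a = a"
    and unit_right: "a \<in> A \<Longrightarrow> mul a u = a"
    and st_closed: "a \<in> A \<Longrightarrow> st a \<in> A"
    and st_add: "a \<in> A \<Longrightarrow> b \<in> A \<Longrightarrow> st (a + b) = st a + st b"
    and st_scl: "a \<in> A \<Longrightarrow> st (scl r a) = scl (cnj r) (st a)"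
    and st_mul: "a \<in> A \<Longrightarrow> b \<in> A \<Longrightarrow> st (mul a b) = mul (st b) (st a)"
    and st_st: "a \<in> A \<Longrightarrow> st (st a) = a"
    and cstar_norm: "\<exists>nrm::'a \<Rightarrow> real.
       (\<forall>a\<in>A. 0 \<le> nrm a \<and> (nrm a = 0 \<longleftrightarrow> a = 0)) \<and>
       (\<forall>a\<in>A. \<forall>r. nrm (scl r a) = cmod r * nrm a) \<and>
       (\<forall>a\<in>A. \<forall>b\<in>A. nrm (a + b) \<le> nrm a + nrm b \<and> nrm (mul a b) \<le> nrm a * nrm b) \<and>
       (\<forall>a\<in>A. nrm (mul (st a) a) = (nrm a)\<^sup>2)"

definition positive :: "('a, 'b) cstar_planar_alg_scheme \<Rightarrow> colour \<Rightarrow> 'a \<Rightarrow> bool" where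
  "positive \<PP> c x \<longleftrightarrow> (\<exists>a\<in>box \<PP> c. x = mult \<PP> c a (star \<PP> c a))"

definition strictly_positive :: "('a, 'b) cstar_planar_alg_scheme \<Rightarrow> colour \<Rightarrow> 'a \<Rightarrow> bool" where
  "strictly_positive \<PP> c x \<longleftrightarrow> positive \<PP> c x \<and>
     (\<exists>z\<in>box \<PP> c. mult \<PP> c x z = one \<PP> c \<and> mult \<PP> c z x = one \<PP> c)"

definition leq :: "('a::ab_group_add, 'b) cstar_planar_alg_scheme \<Rightarrow> colour \<Rightarrow> 'a \<Rightarrow> 'a \<Rightarrow> bool" where
  "leq \<PP> c x y \<longleftrightarrow> positive \<PP> c (y - x)"

definition projection :: "('a, 'b) cstar_planar_alg_scheme \<Rightarrow> colour \<Rightarrow> 'a \<Rightarrow> bool" where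
  "projection \<PP> c p \<longleftrightarrow> p \<in> box \<PP> c \<and> mult \<PP> c p p = p \<and> star \<PP> c p = p"

definition minimal_projection ::
    "('a::ab_group_add, 'b) cstar_planar_alg_scheme \<Rightarrow> colour \<Rightarrow> 'a \<Rightarrow> bool" where
  "minimal_projection \<PP> c p \<longleftrightarrow> projection \<PP> c p \<and> p \<noteq> 0 \<and>
     (\<forall>q. projection \<PP> c q \<longrightarrow> leq \<PP> c q p \<longrightarrow> q = 0 \<or> q = p)"

text \<open>The range projection of \<open>a\<close> is the least projection \<open>e\<close> with \<open>e a = a\<close>.\<close>

definition range_projection ::
    "('a::ab_group_add, 'b) cstar_planar_alg_scheme \<Rightarrow> colour \<Rightarrow> 'a \<Rightarrow> 'a" where
  "range_projection \<PP> c a = (THE e. projection \<PP> c e \<and> mult \<PP> c e a = a \<and>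
     (\<forall>f. projection \<PP> c f \<longrightarrow> mult \<PP> c f a = a \<longrightarrow> leq \<PP> c e f))"

definition projection_sup ::
    "('a::ab_group_add, 'b) cstar_planar_alg_scheme \<Rightarrow> colour \<Rightarrow> 'a set \<Rightarrow> 'a" where
  "projection_sup \<PP> c Q = (THE e. projection \<PP> c e \<and> (\<forall>q\<in>Q. leq \<PP> c q e) \<and>
     (\<forall>f. projection \<PP> c f \<longrightarrow> (\<forall>q\<in>Q. leq \<PP> c q f) \<longrightarrow> leq \<PP> c e f))"

text \<open>Positivity of a complex number refers to the order of \<^theory>\<open>HOL-Library.Complex_Order\<close>.\<close>

locale cstar_planar_algebra = planar_algebra \<PP>
  for \<PP> :: "('a::ab_group_add, 'b) cstar_planar_alg_scheme" +
  assumes cstar_box: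
      "fin_dim_cstar_algebra (scal \<PP>) (box \<PP> c) (mult \<PP> c) (star \<PP> c) (one \<PP> c)"
    and star_act:
      "planar_tangle T \<Longrightarrow> x \<in> inputs \<PP> T \<Longrightarrow>
       star \<PP> (colour T None) (act \<PP> T x) =
         act \<PP> (reflect T) (\<lambda>d. star \<PP> (colour T (Some d)) (x d))"
    and tr_add: "a \<in> box \<PP> c \<Longrightarrow> b \<in> box \<PP> c \<Longrightarrow> tr \<PP> c (a + b) = tr \<PP> c a + tr \<PP> c b"
    and tr_scal: "a \<in> box \<PP> c \<Longrightarrow> tr \<PP> c (scal \<PP> r a) = r * tr \<PP> c a"
    and tr_comm: "a \<in> box \<PP> c \<Longrightarrow> b \<in> box \<PP> c \<Longrightarrow>
      tr \<PP> c (mult \<PP> c a b) = tr \<PP> c (mult \<PP> c b a)"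
    and tr_positive: "positive \<PP> c a \<Longrightarrow> 0 \<le> tr \<PP> c a"
    and tr_faithful: "positive \<PP> c a \<Longrightarrow> tr \<PP> c a = 0 \<Longrightarrow> a = 0"
    and tr_closure: "a \<in> box \<PP> (n, s) \<Longrightarrow> tr \<PP> (n, s) a = tr \<PP> (0, s) (box_closure \<PP> (n, s) a)"

definition F_positive :: "('a, 'b) cstar_planar_alg_scheme \<Rightarrow> 'a \<Rightarrow> bool" where
  "F_positive \<PP> x \<longleftrightarrow> positive \<PP> (2, Shaded) (fourier \<PP> x)"

definition inner1 :: "('a, 'b) cstar_planar_alg_scheme \<Rightarrow> 'a \<Rightarrow> 'a \<Rightarrow> complex" where
  "inner1 \<PP> y z = tr \<PP> (1, Unshaded) (mult \<PP> (1, Unshaded) (star \<PP> (1, Unshaded) z) y)"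

definition irreducible_on_1boxes :: "('a::ab_group_add, 'b) cstar_planar_alg_scheme \<Rightarrow> 'a \<Rightarrow> bool" where
  "irreducible_on_1boxes \<PP> x \<longleftrightarrow>
     (\<forall>p. projection \<PP> (1, Unshaded) p \<longrightarrow>
        (\<exists>l::real. 0 < l \<and>
           leq \<PP> (1, Unshaded) (lconv \<PP> p (fourier \<PP> x)) (scal \<PP> (of_real l) p)) \<longrightarrow>
        p = 0 \<or> p = one \<PP> (1, Unshaded))"

end

theory Submission
  imports Defs "HOL-Computational_Algebra.Fundamental_Theorem_Algebra"
begin

hide_const (open) Multiset.mult
hide_fact (open) Multiset.mult_def

text \<open>
  Put \<open>\<Phi> y = y * \<F>(x)\<close>, a positive linear map on the \<open>1\<close>-boxes, so that convolving \<open>y\<close> with the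
  \<open>k\<close>-th convolution power of \<open>\<F>(x)\<close> gives \<open>\<Phi>\<^sup>k y\<close>. Closing all strings of \<open>(p * w) q\<close> gives a
  closed diagram that also computes, for \<open>w = c c\<^sup>*\<close>, a faithful positive form of \<open>c\<^sup>* (bar p \<otimes> q)\<close>.
  Hence \<open>\<langle>p * w, q\<rangle> = 0\<close> iff \<open>w (bar p \<otimes> q) = 0\<close>. With the Schur product theorem for convolution this
  makes every condition from (3) to (9) a statement about which numbers \<open>\<langle>\<Phi>\<^sup>k p, q\<rangle>\<close> vanish, that is,
  about irreducibility of \<open>\<Phi>\<close>, and the equivalences become those of Perron-Frobenius theory on a
  finite-dimensional \<open>C\<^sup>*\<close>-algebra.

  Identities between tangles are proved by reflection: a tangle is tabulated as finite data, the
  composite of two tables is computed with union-find, and planarity and isotopy of the results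
  are decided by evaluation.
\<close>

section \<open>Finite tables of tangles\<close>

text \<open>No axiom compares the traces of shaded and unshaded 0-boxes, and closed loops need not
  be scalars, so neither sphericality nor a trace property of the left-right closure is at hand. The
  left-right closure of a 2-box lies in an unshaded region, its ordinary closure in a shaded one,
  and the two numbers are unrelated. What they share is when they vanish: for positive v each is
  zero exactly if v annihilates the juxtaposition of \<open>bar p\<close> and q. Left and right
  convolution are compared through this product, and vanishing of a product also passes to range
  projections and their supremum.

  Perron-Frobenius is done without eigenvectors. Adding a positive multiple of the identity to
  \<Phi>, which is what convolution with the Jones projection contributes, makes the range
  projections of the iterates of p increase. They can stop only at an invariant projection, and a
  strict chain of nonzero projections is linearly independent; this is the origin of the exponent d
  - 1 and of the bound k < d.\<close>

type_synonym disc = "shading \<times> nat list \<times> nat list"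

datatype table =
  Table (outer_disc: disc) (inner_discs: "(nat \<times> disc) list")
    (string_sides: "(nat \<times> nat) list") (region_list: "nat list")

definition disc_of :: "table \<Rightarrow> nat option \<Rightarrow> disc" where
  "disc_of t d = (case d of None \<Rightarrow> outer_disc t | Some k \<Rightarrow> the (map_of (inner_discs t) k))"

definition tangle_of :: "table \<Rightarrow> tangle" where
  "tangle_of t =
     \<lparr> inner = set (map fst (inner_discs t)),
       colour = (\<lambda>d. (length (fst (snd (disc_of t d))) div 2, fst (disc_of t d))),
       strings = {..<length (string_sides t)}, regions = set (region_list t),
       strand = (\<lambda>d j. fst (snd (disc_of t d)) ! j),
       reg = (\<lambda>d j. snd (snd (disc_of t d)) ! j),
       side = (\<lambda>e s. case s of Unshaded \<Rightarrow> fst (string_sides t ! e) | Shaded \<Rightarrow> snd (string_sides t ! e)) \<rparr>"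

definition tab_disc :: "tangle \<Rightarrow> nat option \<Rightarrow> disc" where
  "tab_disc T d = (snd (colour T d), map (strand T d) [0..<npoints T d], map (reg T d) [0..<nintervals T d])"

definition tabulate :: "tangle \<Rightarrow> table" where
  "tabulate T = Table (tab_disc T None)
     (map (\<lambda>k. (k, tab_disc T (Some k))) (sorted_list_of_set (inner T)))
     (map (\<lambda>e. (side T e Unshaded, side T e Shaded)) [0..<card (strings T)])
     (sorted_list_of_set (regions T))"

text \<open>\<open>sorted_list_of_set\<close> is empty on an infinite set, so the first two
  equations express finiteness in a form that can be evaluated. The last one lets a string be
  identified with its position in the list of sides.\<close>

definition tab_ok :: "tangle \<Rightarrow> bool" where
  "tab_ok T \<longleftrightarrow> set (sorted_list_of_set (inner T)) = inner T \<and>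
     set (sorted_list_of_set (regions T)) = regions T \<and> strings T = {..<card (strings T)}"

text \<open>Quick-find: every element carries its label directly and a merge relabels a whole class.
  The tables are tiny, and there are no parent chains whose termination would have to be
  argued.\<close>

fun uf_step :: "'a \<times> 'a \<Rightarrow> ('a \<times> 'a) list \<Rightarrow> ('a \<times> 'a) list" where
  "uf_step (v, w) L = (let a = the (map_of L v); b = the (map_of L w) in
     map (\<lambda>(x, l). (x, if l = b then a else l)) L)"

definition union_find :: "'a list \<Rightarrow> ('a \<times> 'a) list \<Rightarrow> ('a \<times> 'a) list" where
  "union_find xs es = fold uf_step es (map (\<lambda>x. (x, x)) xs)"

definition disc_list :: "table \<Rightarrow> nat option list" where
  "disc_list t = None # map (Some \<circ> fst) (inner_discs t)"

definition point_list :: "table \<Rightarrow> (nat option \<times> nat) list" where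
  "point_list t = concat (map (\<lambda>d. map (Pair d) [0..<npoints (tangle_of t) d]) (disc_list t))"

definition interval_list :: "table \<Rightarrow> (nat option \<times> nat) list" where
  "interval_list t = concat (map (\<lambda>d. map (Pair d) [0..<nintervals (tangle_of t) d]) (disc_list t))"

definition string_list :: "table \<Rightarrow> nat list" where
  "string_list t = [0..<length (string_sides t)]"

text \<open>All shading constraints on regions, as pairs. A shading exists iff this relation is
  functional, which turns the existential quantifier in \<open>wf_tangle\<close> into a
  test.\<close>

definition shade_list :: "table \<Rightarrow> (nat \<times> shading) list" where
  "shade_list t = (let T = tangle_of t in
     map (\<lambda>(d, j). (reg T d j, ishade T d j)) (interval_list t) @
     map (\<lambda>e. (side T e Unshaded, Unshaded)) (string_list t) @
     map (\<lambda>e. (side T e Shaded, Shaded)) (string_list t))"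

definition functional_list :: "('a \<times> 'b) list \<Rightarrow> bool" where
  "functional_list L \<longleftrightarrow> list_all (\<lambda>(a, b). map_of L a = Some b) L"

text \<open>This evaluates symbolically much faster than \<open>Suc j mod n\<close>.\<close>

definition cyclic_Suc :: "nat \<Rightarrow> nat \<Rightarrow> nat" where
  "cyclic_Suc n j = (if Suc j = n then 0 else Suc j)"

lemma cyclic_Suc_eq: "j < n \<Longrightarrow> cyclic_Suc n j = Suc j mod n"
  by (auto simp: cyclic_Suc_def)

definition wf_check :: "table \<Rightarrow> bool" where
  "wf_check t \<longleftrightarrow> (let T = tangle_of t in
     distinct (map fst (inner_discs t)) \<and> distinct (region_list t) \<and>
     list_all (\<lambda>d. even (length (fst (snd (disc_of t d)))) \<and>
       length (snd (snd (disc_of t d))) = max 1 (length (fst (snd (disc_of t d))))) (disc_list t) \<and>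
     list_all (\<lambda>(d, j). strand T d j < length (string_sides t)) (point_list t) \<and>
     list_all (\<lambda>(r, s). r \<in> set (region_list t)) (shade_list t) \<and>
     functional_list (shade_list t) \<and>
     list_all (\<lambda>(d, j). reg T d j = side T (strand T d j) (ishade T d j) \<and>
        reg T d (cyclic_Suc (npoints T d) j) = side T (strand T d j) (opp (ishade T d j))) (point_list t) \<and>
     list_all (\<lambda>e. case filter (\<lambda>(d, j). strand T d j = e) (point_list t) of
        [] \<Rightarrow> True | [p, q] \<Rightarrow> outgoing T p \<noteq> outgoing T q | _ \<Rightarrow> False) (string_list t))"

text \<open>A star at the region of interval 0 generates the same equivalence as the complete graph
  on the regions around a disc, and keeps the edge list short.\<close>

definition connected_check :: "table \<Rightarrow> bool" where
  "connected_check t \<longleftrightarrow> (let T = tangle_of t;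
     L = union_find (region_list t)
       (concat (map (\<lambda>d. map (\<lambda>j. (reg T d 0, reg T d j)) [0..<nintervals T d]) (disc_list t)) @
        map (\<lambda>e. (side T e Unshaded, side T e Shaded)) (string_list t))
     in list_all (\<lambda>p. snd p = snd (hd L)) L)"

definition piece_list :: "table \<Rightarrow> ((nat option \<times> nat) + (nat \<times> shading)) list" where
  "piece_list t = map Inl (interval_list t) @
     map (\<lambda>e. Inr (e, Unshaded)) (string_list t) @ map (\<lambda>e. Inr (e, Shaded)) (string_list t)"

definition follow_list ::
    "table \<Rightarrow> (((nat option \<times> nat) + (nat \<times> shading)) \<times> ((nat option \<times> nat) + (nat \<times> shading))) list" where
  "follow_list t = (let T = tangle_of t in
     concat (map (\<lambda>(d, i). map (\<lambda>j. (Inl (d, j), Inr (strand T d i, ishade T d j)))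
       [i, cyclic_Suc (npoints T d) i]) (point_list t)))"

definition curve_count :: "table \<Rightarrow> nat" where
  "curve_count t = length (remdups (map snd (union_find (piece_list t) (follow_list t))))"

definition planar_check :: "table \<Rightarrow> bool" where
  "planar_check t \<longleftrightarrow> wf_check t \<and> connected_check t \<and>
     length (disc_list t) + 2 * length (region_list t) =
       2 + sum_list (map (\<lambda>d. fst (colour (tangle_of t) d)) (disc_list t)) + curve_count t"

definition disc_map :: "(nat \<Rightarrow> nat) \<Rightarrow> (nat \<Rightarrow> nat) \<Rightarrow> disc \<Rightarrow> disc" where
  "disc_map f g = map_prod id (map_prod (map f) (map g))"

definition index_of :: "'a list \<Rightarrow> 'a \<Rightarrow> nat" where
  "index_of xs x = length (takeWhile (\<lambda>y. y \<noteq> x) xs)"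

definition glue_edges :: "nat list \<Rightarrow> nat list \<Rightarrow> ((nat + nat) \<times> (nat + nat)) list" where
  "glue_edges as bs = zip (map Inl as) (map Inr bs)"

definition glue_elems :: "nat list \<Rightarrow> nat list \<Rightarrow> (nat + nat) list" where
  "glue_elems as bs = map Inl as @ map Inr bs"

fun sum_side :: "table \<Rightarrow> table \<Rightarrow> nat + nat \<Rightarrow> (nat + nat) \<times> (nat + nat)" where
  "sum_side t s (Inl e) = map_prod Inl Inl (string_sides t ! e)"
| "sum_side t s (Inr e) = map_prod Inr Inr (string_sides s ! e)"

definition string_glue :: "table \<Rightarrow> nat \<Rightarrow> table \<Rightarrow> ((nat + nat) \<times> (nat + nat)) list" where
  "string_glue t D s = union_find (glue_elems (string_list t) (string_list s))
     (glue_edges (fst (snd (disc_of t (Some D)))) (fst (snd (outer_disc s))))"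

definition region_glue :: "table \<Rightarrow> nat \<Rightarrow> table \<Rightarrow> ((nat + nat) \<times> (nat + nat)) list" where
  "region_glue t D s = union_find (glue_elems (region_list t) (region_list s))
     (glue_edges (snd (snd (disc_of t (Some D)))) (snd (snd (outer_disc s))))"

text \<open>Class labels are elements of a disjoint sum; the glued table needs consecutive numbers
  instead, because a string is addressed by its position.\<close>

definition tabulate_map :: "((nat + nat) \<times> (nat + nat)) list \<Rightarrow> ((nat + nat) \<times> nat) list" where
  "tabulate_map L = map (\<lambda>(v, l). (v, index_of (remdups (map snd L)) l)) L"

definition lookup :: "('a \<times> 'b) list \<Rightarrow> 'a \<Rightarrow> 'b" where
  "lookup L x = the (map_of L x)"

text \<open>\<open>reps\<close> holds one string per class, in the order in which \<open>F\<close>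
  numbers the classes, so that the sides computed from the n-th representative land at position n.
  Regions have no position and are just listed.\<close>

fun plug_with :: "table \<Rightarrow> nat \<Rightarrow> table \<Rightarrow> (nat + nat) list \<Rightarrow> ((nat + nat) \<times> nat) list
    \<Rightarrow> ((nat + nat) \<times> nat) list \<Rightarrow> table" where
  "plug_with t D s reps F G = Table
     (disc_map (lookup F \<circ> Inl) (lookup G \<circ> Inl) (outer_disc t))
     (map (map_prod id (disc_map (lookup F \<circ> Inl) (lookup G \<circ> Inl))) (filter (\<lambda>(k, d). k \<noteq> D) (inner_discs t)) @
      map (map_prod id (disc_map (lookup F \<circ> Inr) (lookup G \<circ> Inr))) (inner_discs s))
     (map (map_prod (lookup G) (lookup G) \<circ> sum_side t s) reps)
     (remdups (map snd G))"

definition plug :: "table \<Rightarrow> nat \<Rightarrow> table \<Rightarrow> table" where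
  "plug t D s = plug_with t D s (remdups (map snd (string_glue t D s)))
     (tabulate_map (string_glue t D s)) (tabulate_map (region_glue t D s))"

text \<open>Left string closed to the left, right string to the right; the outer region is the one above the box.\<close>

definition lr_closure_tangle :: tangle where
  "lr_closure_tangle = diagram (Unshaded, [], [0]) [(Shaded, [0, 1, 1, 0], [1, 0, 2, 0])] [(0, 1), (0, 2)]"

definition inv_fourier_tangle :: tangle where
  "inv_fourier_tangle = diagram (Unshaded, [1, 2, 3, 0], [1, 2, 3, 0])
     [(Shaded, [0, 1, 2, 3], [0, 1, 2, 3])] [(1, 0), (1, 2), (3, 2), (3, 0)]"

definition inv_rotate_tangle :: tangle where
  "inv_rotate_tangle = diagram (Unshaded, [0, 1], [0, 1]) [(Shaded, [1, 0], [1, 0])] [(0, 1), (0, 1)]"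

text \<open>
  Half of the closure of \<open>(a a\<^sup>* * b b\<^sup>*) c c\<^sup>*\<close>: the third input sits on top of the convolution of the
  first two, and the six free ends are read clockwise.
\<close>

definition schur_tangle :: tangle where
  "schur_tangle = diagram (Shaded, [0, 1, 2, 3, 4, 5], [0, 1, 2, 3, 4, 5])
     [(Shaded, [6, 8, 4, 5], [0, 6, 4, 5]), (Shaded, [8, 7, 2, 3], [4, 6, 2, 3]),
      (Shaded, [0, 1, 7, 6], [0, 1, 2, 6])]
     [(1, 0), (1, 2), (3, 2), (3, 4), (5, 4), (5, 0), (6, 0), (6, 2), (6, 4)]"

text \<open>Half of the closure of \<open>cap_cup\<close> times a product of c with its adjoint: the
  upper arc of the cap-cup diagram closes the bottom of c, the lower arc closes the top of the
  adjoint.\<close>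

definition cap_tangle :: tangle where
  "cap_tangle = diagram (Shaded, [0, 1], [0, 1]) [(Shaded, [0, 1, 2, 2], [0, 1, 0, 2])]
     [(1, 0), (1, 0), (2, 0)]"

text \<open>The set comprehension in the definition of \<^const>\<open>mult_tangle\<close> is not executable.\<close>

lemma mult_tangle_code [code]:
  "mult_tangle c = (let n = fst c; s = snd c;
       top = (\<lambda>d. case d of None \<Rightarrow> 0 | Some k \<Rightarrow> if k = 1 then 0 else 1);
       bottom = (\<lambda>d. case d of None \<Rightarrow> 2 | Some k \<Rightarrow> if k = 1 then 1 else 2) in
     \<lparr> inner = {0, 1}, colour = (\<lambda>_. c),
       strings = {..<3 * n}, regions = set (concat (map (\<lambda>a. map (mult_region n a) [0..<Suc n]) [0,1,2])),
       strand = (\<lambda>d j. if j < n then 3 * j + top d else 3 * (2 * n - 1 - j) + bottom d),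
       reg = (\<lambda>d j. if j \<le> n then mult_region n (top d) j
                    else mult_region n (bottom d) (2 * n - j)),
       side = (\<lambda>e t. mult_region n (e mod 3)
                 (if t = col_shade s (e div 3) then e div 3 else Suc (e div 3))) \<rparr>)"
proof -
  have "{mult_region n a i |a i. a < 3 \<and> i \<le> n} = set (concat (map (\<lambda>a. map (mult_region n a) [0..<Suc n]) [0,1,2]))" for n
  proof -
    have "{a::nat. a < 3} = {0, 1, 2}" by auto
    moreover have "{mult_region n a i |a i. a < 3 \<and> i \<le> n} = (\<Union>a\<in>{a. a < 3}. mult_region n a ` {..n})" by auto
    ultimately show ?thesis by (simp only: atMost_upto) auto
  qed
  then show ?thesis unfolding mult_tangle_def by metis
qed


section \<open>Union-find and the equivalence relation generated by its edges\<close>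

lemma equivclp_mono: "equivclp R v w \<Longrightarrow> (\<And>a b. R a b \<Longrightarrow> S a b) \<Longrightarrow> equivclp S v w"
  by (induction rule: equivclp_induct) (auto intro: equivclp_into_equivclp)

lemma map_fst_uf_step [simp]: "map fst (uf_step e L) = map fst L"
  by (cases e) (auto simp: Let_def)

lemma map_fst_fold_uf_step [simp]: "map fst (fold uf_step es L) = map fst L"
  by (induction es arbitrary: L) auto

lemma map_fst_union_find [simp]: "map fst (union_find xs es) = xs"
  by (simp add: union_find_def comp_def)

lemma lookup_map_snd:
  "x \<in> set (map fst L) \<Longrightarrow> lookup (map (\<lambda>(x, l). (x, f l)) L) x = f (lookup L x)"
  by (induction L) (auto simp: lookup_def)

lemma lookup_uf_step:
  "x \<in> set (map fst L) \<Longrightarrow>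
   lookup (uf_step (v, w) L) x = (if lookup L x = lookup L w then lookup L v else lookup L x)"
  unfolding uf_step.simps Let_def
  using lookup_map_snd[of x L "\<lambda>l. if l = lookup L w then lookup L v else l"]
  unfolding lookup_def .

text \<open>A label is itself a member of the class of its element, so equal labels force
  equivalence; conversely a merge never separates labels that already agree. The induction runs from
  the right because \<open>fold\<close> treats the last edge last.\<close>

lemma union_find_correct:
  assumes "set es \<subseteq> set xs \<times> set xs"
  shows "x \<in> set xs \<Longrightarrow> equivclp (\<lambda>v w. (v, w) \<in> set es) x (lookup (union_find xs es) x)"
    and "(v, w) \<in> set es \<Longrightarrow> lookup (union_find xs es) v = lookup (union_find xs es) w"
proof -
  have "(\<forall>x\<in>set xs. equivclp (\<lambda>v w. (v, w) \<in> set es) x (lookup (union_find xs es) x)) \<and>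
    (\<forall>(v, w)\<in>set es. lookup (union_find xs es) v = lookup (union_find xs es) w)"
    using assms
  proof (induction es rule: rev_induct)
    case Nil
    have "x \<in> set xs \<Longrightarrow> map_of (map (\<lambda>x. (x, x)) xs) x = Some x" for x
      by (simp add: map_of_map_restrict)
    then show ?case by (auto simp: union_find_def lookup_def)
  next
    case (snoc e es)
    obtain a b where e: "e = (a, b)" by fastforce
    let ?L = "union_find xs es"
    let ?R = "\<lambda>v w. (v, w) \<in> set (es @ [e])"
    have ab: "a \<in> set xs" "b \<in> set xs" and sub: "set es \<subseteq> set xs \<times> set xs"
      using snoc.prems e by auto
    note IH = snoc.IH[OF sub]
    have L': "x \<in> set xs \<Longrightarrow> lookup (union_find xs (es @ [e])) x =
        (if lookup ?L x = lookup ?L b then lookup ?L a else lookup ?L x)" for x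
      using lookup_uf_step[of x ?L a b] unfolding e map_fst_union_find by (simp add: union_find_def)
    have cl: "x \<in> set xs \<Longrightarrow> equivclp ?R x (lookup ?L x)" for x
      by (rule equivclp_mono[OF bspec[OF conjunct1[OF IH]]]) simp_all
    have "equivclp ?R x (lookup ?L a)" if "x \<in> set xs" "lookup ?L x = lookup ?L b" for x
    proof -
      have "equivclp ?R x (lookup ?L b)" using cl[OF that(1)] that(2) by simp
      then have "equivclp ?R x b" by (rule equivclp_trans) (rule equivclp_sym[OF cl[OF ab(2)]])
      moreover have "equivclp ?R b a" by (rule equivclp_sym, rule r_into_equivclp) (simp add: e)
      ultimately have "equivclp ?R x a" by (rule equivclp_trans)
      then show ?thesis by (rule equivclp_trans) (rule cl[OF ab(1)])
    qed
    then have "\<forall>x\<in>set xs. equivclp ?R x (lookup (union_find xs (es @ [e])) x)"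
      using L' cl by simp
    moreover have "lookup (union_find xs (es @ [e])) v = lookup (union_find xs (es @ [e])) w"
      if "(v, w) \<in> set (es @ [e])" for v w
    proof (cases "(v, w) \<in> set es")
      case True
      then have "lookup ?L v = lookup ?L w" "v \<in> set xs" "w \<in> set xs" using IH sub by auto
      then show ?thesis by (simp only: L')
    next
      case False
      then have "v = a" "w = b" using that e by auto
      then show ?thesis using L' ab by simp
    qed
    ultimately show ?case by blast
  qed
  then show "x \<in> set xs \<Longrightarrow> equivclp (\<lambda>v w. (v, w) \<in> set es) x (lookup (union_find xs es) x)"
    and "(v, w) \<in> set es \<Longrightarrow> lookup (union_find xs es) v = lookup (union_find xs es) w"
    by auto
qed

lemma union_find_iff:
  assumes "set es \<subseteq> set xs \<times> set xs" "v \<in> set xs" "w \<in> set xs"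
  shows "lookup (union_find xs es) v = lookup (union_find xs es) w \<longleftrightarrow>
    equivclp (\<lambda>v w. (v, w) \<in> set es) v w"
proof
  assume "lookup (union_find xs es) v = lookup (union_find xs es) w"
  then have "equivclp (\<lambda>v w. (v, w) \<in> set es) v (lookup (union_find xs es) w)"
    using union_find_correct(1)[OF assms(1,2)] by simp
  then show "equivclp (\<lambda>v w. (v, w) \<in> set es) v w"
    by (rule equivclp_trans) (rule equivclp_sym[OF union_find_correct(1)[OF assms(1,3)]])
next
  assume "equivclp (\<lambda>v w. (v, w) \<in> set es) v w"
  then show "lookup (union_find xs es) v = lookup (union_find xs es) w"
  proof (induction rule: equivclp_induct)
    case (step y z)
    then show ?case using union_find_correct(2)[OF assms(1), of y z] union_find_correct(2)[OF assms(1), of z y]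
      by auto
  qed simp
qed

lemma union_find_constant:
  assumes "set es \<subseteq> set xs \<times> set xs" "\<forall>p\<in>set (union_find xs es). snd p = c"
    "v \<in> set xs" "w \<in> set xs"
  shows "equivclp (\<lambda>v w. (v, w) \<in> set es) v w"
proof -
  have "lookup (union_find xs es) x = c" if "x \<in> set xs" for x
  proof -
    have "x \<in> set (map fst (union_find xs es))" using that by (simp only: map_fst_union_find)
    then obtain l where "map_of (union_find xs es) x = Some l"
      by (metis list.set_map map_of_eq_None_iff option.exhaust)
    then show ?thesis using assms(2) by (auto simp: lookup_def dest!: map_of_SomeD)
  qed
  then show ?thesis using union_find_iff[OF assms(1,3,4)] assms(3,4) by simp
qed

lemma map_snd_eq_lookup: "distinct (map fst L) \<Longrightarrow> map snd L = map (lookup L) (map fst L)"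
  by (auto simp: lookup_def)

section \<open>Soundness of the planarity check\<close>

lemma discs_tangle_of: "discs (tangle_of t) = set (disc_list t)"
  by (auto simp: discs_def tangle_of_def disc_list_def)

lemma points_tangle_of: "points (tangle_of t) = set (point_list t)"
  by (auto simp: points_def discs_tangle_of point_list_def)

lemma intervals_tangle_of: "intervals (tangle_of t) = set (interval_list t)"
  by (auto simp: intervals_def discs_tangle_of interval_list_def)

lemma strings_tangle_of: "strings (tangle_of t) = set (string_list t)"
  by (auto simp: tangle_of_def string_list_def)

lemma regions_tangle_of: "regions (tangle_of t) = set (region_list t)"
  by (simp add: tangle_of_def)

lemma inner_tangle_of: "inner (tangle_of t) = set (map fst (inner_discs t))"
  by (simp add: tangle_of_def)

lemma functional_listD: "functional_list L \<Longrightarrow> (a, b) \<in> set L \<Longrightarrow> lookup L a = b"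
  by (auto simp: functional_list_def lookup_def list_all_iff)

lemma wf_check_sound:
  assumes "wf_check t"
  shows "wf_tangle (tangle_of t)"
proof -
  let ?T = "tangle_of t"
  note w = assms[unfolded wf_check_def Let_def list_all_iff]
  have shd: "(d, j) \<in> set (interval_list t) \<Longrightarrow> (reg ?T d j, ishade ?T d j) \<in> set (shade_list t)"
    "e \<in> set (string_list t) \<Longrightarrow> (side ?T e s, s) \<in> set (shade_list t)" for d j e s
  proof -
    show "(d, j) \<in> set (interval_list t) \<Longrightarrow> (reg ?T d j, ishade ?T d j) \<in> set (shade_list t)"
      unfolding shade_list_def Let_def set_append set_map by (rule UnI1, rule image_eqI) auto
    show "e \<in> set (string_list t) \<Longrightarrow> (side ?T e s, s) \<in> set (shade_list t)"
      unfolding shade_list_def Let_def set_append set_map by (cases s) auto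
  qed
  have fn: "functional_list (shade_list t)" using w by blast
  have rs: "(r, s) \<in> set (shade_list t) \<Longrightarrow> r \<in> set (region_list t)" for r s
    using w by fastforce
  have ends: "{p\<in>points ?T. case_prod (strand ?T) p = e} = {} \<or>
        (\<exists>p q. {p\<in>points ?T. case_prod (strand ?T) p = e} = {p, q} \<and>
               outgoing ?T p \<and> \<not> outgoing ?T q)" if "e \<in> strings ?T" for e
  proof -
    let ?f = "filter (\<lambda>(d, j). strand ?T d j = e) (point_list t)"
    have eq: "{p\<in>points ?T. case_prod (strand ?T) p = e} = set ?f"
      by (auto simp: points_tangle_of)
    have "case ?f of [] \<Rightarrow> True | [p, q] \<Rightarrow> outgoing ?T p \<noteq> outgoing ?T q | _ \<Rightarrow> False"
      using w that unfolding strings_tangle_of by blast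
    then consider "?f = []" | p q where "?f = [p, q]" "outgoing ?T p \<noteq> outgoing ?T q"
      by (auto split: list.splits)
    then show ?thesis
    proof cases
      case 2
      then show ?thesis unfolding eq by (cases "outgoing ?T p") (metis insert_commute list.set)+
    qed (simp add: eq)
  qed
  have "\<exists>sh. (\<forall>(d, j)\<in>intervals ?T. sh (reg ?T d j) = ishade ?T d j) \<and>
           (\<forall>e\<in>strings ?T. \<forall>s. sh (side ?T e s) = s)"
    by (rule exI[of _ "lookup (shade_list t)"])
      (auto simp: intervals_tangle_of strings_tangle_of dest!: shd(1) intro: functional_listD[OF fn] shd(2))
  moreover have "\<forall>(d, j)\<in>points ?T. strand ?T d j \<in> strings ?T"
    using w by (auto simp: points_tangle_of strings_tangle_of string_list_def)
  moreover have "\<forall>(d, j)\<in>intervals ?T. reg ?T d j \<in> regions ?T"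
    using shd(1) rs by (auto simp: intervals_tangle_of regions_tangle_of)
  moreover have "\<forall>e\<in>strings ?T. \<forall>s. side ?T e s \<in> regions ?T"
    using shd(2) rs by (auto simp: strings_tangle_of regions_tangle_of)
  moreover have "\<forall>(d, j)\<in>points ?T.
        reg ?T d j = side ?T (strand ?T d j) (ishade ?T d j) \<and>
        reg ?T d (Suc j mod npoints ?T d) = side ?T (strand ?T d j) (opp (ishade ?T d j))"
  proof clarify
    fix d j assume p: "(d, j) \<in> points ?T"
    then have j: "j < npoints ?T d" by (auto simp: points_def)
    have "\<forall>(d, j)\<in>set (point_list t). reg ?T d j = side ?T (strand ?T d j) (ishade ?T d j) \<and>
        reg ?T d (cyclic_Suc (npoints ?T d) j) = side ?T (strand ?T d j) (opp (ishade ?T d j))"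
      using w by (elim conjE)
    then show "reg ?T d j = side ?T (strand ?T d j) (ishade ?T d j) \<and>
        reg ?T d (Suc j mod npoints ?T d) = side ?T (strand ?T d j) (opp (ishade ?T d j))"
      using p unfolding points_tangle_of cyclic_Suc_eq[OF j, symmetric] by fast
  qed
  moreover have "finite (inner ?T)" "finite (strings ?T)" "finite (regions ?T)"
    by (simp_all add: inner_tangle_of strings_tangle_of regions_tangle_of)
  moreover have "\<forall>e\<in>strings ?T. {p\<in>points ?T. case_prod (strand ?T) p = e} = {} \<or>
        (\<exists>p q. {p\<in>points ?T. case_prod (strand ?T) p = e} = {p, q} \<and>
               outgoing ?T p \<and> \<not> outgoing ?T q)"
    by (rule ballI) (rule ends)
  ultimately show ?thesis unfolding wf_tangle_def by (intro conjI) assumption+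
qed

lemma connected_check_sound:
  assumes "wf_check t" "connected_check t"
  shows "connected_tangle (tangle_of t)"
proof -
  let ?T = "tangle_of t"
  let ?E = "concat (map (\<lambda>d. map (\<lambda>j. (reg ?T d 0, reg ?T d j)) [0..<nintervals ?T d]) (disc_list t)) @
        map (\<lambda>e. (side ?T e Unshaded, side ?T e Shaded)) (string_list t)"
  let ?xs = "region_list t"
  have wf: "wf_tangle ?T" by (rule wf_check_sound[OF assms(1)])
  have dist: "distinct ?xs" using assms(1) by (simp add: wf_check_def Let_def)
  have pos: "0 < nintervals ?T d" for d by (simp add: nintervals_def)
  have reg: "d \<in> set (disc_list t) \<Longrightarrow> j < nintervals ?T d \<Longrightarrow> reg ?T d j \<in> set ?xs" for d j
    using wf by (auto simp: wf_tangle_def intervals_def discs_tangle_of regions_tangle_of)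
  have sd: "e \<in> set (string_list t) \<Longrightarrow> side ?T e s \<in> set ?xs" for e s
    using wf by (auto simp: wf_tangle_def strings_tangle_of regions_tangle_of)
  have sub: "set ?E \<subseteq> set ?xs \<times> set ?xs" using reg sd pos by auto
  have adj: "adjacent_regions ?T a b" if "(a, b) \<in> set ?E" for a b
    using that pos by (fastforce simp: adjacent_regions_def discs_tangle_of strings_tangle_of)
  have const: "\<forall>p\<in>set (union_find ?xs ?E). snd p = snd (hd (union_find ?xs ?E))"
    using assms(2) unfolding connected_check_def Let_def list_all_iff .
  have "equivclp (adjacent_regions ?T) v w" if "v \<in> set ?xs" "w \<in> set ?xs" for v w
    using union_find_constant[OF sub const that] by (rule equivclp_mono) (rule adj)
  then show ?thesis
    unfolding connected_tangle_def regions_tangle_of by blast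
qed

text \<open>Classes are the fibres of the labelling, so counting boundary curves amounts to counting
  union-find labels.\<close>

lemma card_quotient_label:
  assumes "\<And>v w. v \<in> A \<Longrightarrow> w \<in> A \<Longrightarrow> (v, w) \<in> r \<longleftrightarrow> h v = h w" "r \<subseteq> A \<times> A"
  shows "card (A // r) = card (h ` A)"
proof -
  have "A // r = (\<lambda>l. {w\<in>A. h w = l}) ` h ` A"
  proof -
    have "v \<in> A \<Longrightarrow> r `` {v} = {w\<in>A. h w = h v}" for v using assms by auto
    then show ?thesis by (auto simp: quotient_def image_image)
  qed
  moreover have "inj_on (\<lambda>l. {w\<in>A. h w = l}) (h ` A)" by (rule inj_onI) blast
  ultimately show ?thesis by (simp add: card_image)
qed

lemma distinct_pair_concat:
  "distinct ds \<Longrightarrow> distinct (concat (map (\<lambda>d. map (Pair d) [0..<n d]) ds))"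
  by (induction ds) (auto simp: distinct_map inj_on_def)

lemma distinct_disc_list: "wf_check t \<Longrightarrow> distinct (disc_list t)"
  by (auto simp: wf_check_def Let_def disc_list_def distinct_map inj_on_def dest: inj_onD)

lemma curve_count_sound:
  assumes "wf_check t"
  shows "card (boundary_curves (tangle_of t)) = curve_count t"
proof -
  let ?T = "tangle_of t" and ?P = "piece_list t" and ?E = "follow_list t"
  have wf: "wf_tangle ?T" by (rule wf_check_sound[OF assms(1)])
  have P: "curve_pieces ?T = set ?P"
  proof -
    have U: "(UNIV :: shading set) = {Unshaded, Shaded}" using shading.exhaust by blast
    show ?thesis unfolding curve_pieces_def piece_list_def intervals_tangle_of strings_tangle_of U
      by auto
  qed
  have E: "follows ?T v w \<longleftrightarrow> (v, w) \<in> set ?E" for v w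
  proof -
    have cyc: "(d, i) \<in> set (point_list t) \<Longrightarrow> cyclic_Suc (npoints ?T d) i = Suc i mod npoints ?T d" for d i
      by (rule cyclic_Suc_eq) (auto simp: points_tangle_of[symmetric] points_def)
    have "(v, w) \<in> set ?E \<longleftrightarrow> (\<exists>(d, i)\<in>set (point_list t). \<exists>j\<in>{i, cyclic_Suc (npoints ?T d) i}.
        v = Inl (d, j) \<and> w = Inr (strand ?T d i, ishade ?T d j))"
      by (fastforce simp: follow_list_def Let_def)
    also have "\<dots> \<longleftrightarrow> follows ?T v w"
      unfolding follows_def points_tangle_of by (rule bex_cong[OF refl]) (clarsimp simp only: cyc)
    finally show ?thesis by blast
  qed
  have sub: "set ?E \<subseteq> set ?P \<times> set ?P"
  proof -
    have pc: "Inl (d, j) \<in> set ?P \<and> Inr (strand ?T d i, ishade ?T d j) \<in> set ?P"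
      if "(d, i) \<in> points ?T" "j \<in> {i, Suc i mod npoints ?T d}" for d i j
    proof -
      have "i < npoints ?T d" using that(1) by (auto simp: points_def)
      then have "j < nintervals ?T d" using that(2) by (auto simp: nintervals_def less_max_iff_disj)
      then have "(d, j) \<in> intervals ?T" using that(1) by (auto simp: points_def intervals_def)
      moreover have "strand ?T d i \<in> strings ?T" using wf that(1) by (auto simp: wf_tangle_def)
      ultimately show ?thesis unfolding P[symmetric] by (auto simp: curve_pieces_def)
    qed
    show ?thesis
    proof clarify
      fix v w assume "(v, w) \<in> set ?E"
      then have "follows ?T v w" by (simp only: E)
      then obtain d i j where "(d, i) \<in> points ?T" "j \<in> {i, Suc i mod npoints ?T d}"
        "v = Inl (d, j)" "w = Inr (strand ?T d i, ishade ?T d j)"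
        unfolding follows_def by blast
      then show "v \<in> set ?P \<and> w \<in> set ?P" using pc by blast
    qed
  qed
  have dist: "distinct ?P"
    using distinct_pair_concat[OF distinct_disc_list[OF assms], of "nintervals ?T"]
    by (auto simp: piece_list_def interval_list_def string_list_def distinct_map inj_on_def)
  let ?L = "union_find ?P ?E"
  have F: "follows ?T = (\<lambda>v w. (v, w) \<in> set ?E)" using E by blast
  have "card (boundary_curves ?T) = card (lookup ?L ` set ?P)"
    unfolding boundary_curves_def P
    by (rule card_quotient_label) (auto simp: union_find_iff[OF sub] F)
  also have "lookup ?L ` set ?P = set (map snd ?L)"
    using map_snd_eq_lookup[of ?L] dist by simp
  finally show ?thesis by (simp add: curve_count_def length_remdups_card_conv)
qed

lemma planar_check_sound:
  assumes "planar_check t"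
  shows "planar_tangle (tangle_of t)"
proof -
  have wf: "wf_check t" and c: "connected_check t"
    using assms unfolding planar_check_def by blast+
  have d: "distinct (disc_list t)" by (rule distinct_disc_list[OF wf])
  have "distinct (region_list t)" using wf by (simp add: wf_check_def Let_def)
  then have "card (regions (tangle_of t)) = length (region_list t)"
    by (simp add: regions_tangle_of distinct_card)
  moreover have "card (discs (tangle_of t)) = length (disc_list t)"
    using d by (simp add: discs_tangle_of distinct_card)
  moreover have "(\<Sum>d\<in>discs (tangle_of t). fst (colour (tangle_of t) d)) =
      sum_list (map (\<lambda>d. fst (colour (tangle_of t) d)) (disc_list t))"
    using d by (simp add: discs_tangle_of sum_list_distinct_conv_sum_set)
  ultimately show ?thesis
    using assms wf_check_sound[OF wf] connected_check_sound[OF wf c] curve_count_sound[OF wf]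
    by (simp add: planar_check_def planar_tangle_def)
qed

section \<open>Composition of tables\<close>

text \<open>The fields of a tangle are total functions with junk values away from its discs, points
  and strings. Record equality would compare the junk; this relation compares the meaningful
  entries.\<close>

definition same_tangle :: "tangle \<Rightarrow> tangle \<Rightarrow> bool" where
  "same_tangle T U \<longleftrightarrow> inner T = inner U \<and> strings T = strings U \<and> regions T = regions U \<and>
     (\<forall>d\<in>discs T. colour T d = colour U d \<and>
        (\<forall>j<npoints T d. strand T d j = strand U d j) \<and>
        (\<forall>j<nintervals T d. reg T d j = reg U d j)) \<and>
     (\<forall>e\<in>strings T. \<forall>s. side T e s = side U e s)"

lemma Suc_mod_npoints: "i < npoints T d \<Longrightarrow> Suc i mod npoints T d < nintervals T d"
  by (auto simp: nintervals_def less_max_iff_disj)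

lemma wf_tangleD:
  assumes "wf_tangle T"
  shows "finite (inner T)" "finite (strings T)" "finite (regions T)"
    "(d, j) \<in> points T \<Longrightarrow> strand T d j \<in> strings T"
    "(d, j) \<in> intervals T \<Longrightarrow> reg T d j \<in> regions T"
    "e \<in> strings T \<Longrightarrow> side T e s \<in> regions T"
    "(d, j) \<in> points T \<Longrightarrow> reg T d j = side T (strand T d j) (ishade T d j)"
    "(d, j) \<in> points T \<Longrightarrow>
      reg T d (Suc j mod npoints T d) = side T (strand T d j) (opp (ishade T d j))"
    "e \<in> strings T \<Longrightarrow> {p\<in>points T. case_prod (strand T) p = e} = {} \<or>
        (\<exists>p q. {p\<in>points T. case_prod (strand T) p = e} = {p, q} \<and>
               outgoing T p \<and> \<not> outgoing T q)"
  using assms[unfolded wf_tangle_def] by (elim conjE, fast)+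

lemma wf_tangle_shadingE:
  assumes "wf_tangle T"
  obtains sh where "\<forall>(d, j)\<in>intervals T. sh (reg T d j) = ishade T d j"
    "\<forall>e\<in>strings T. \<forall>s. sh (side T e s) = s"
  using assms[unfolded wf_tangle_def] by (elim conjE exE) (rule that)

text \<open>Planarity reads the fields at existing discs, points, intervals and strings only. The
  point to watch is the cyclic successor of a point, which must again be the index of an existing
  interval.\<close>

lemma planar_same_tangle:
  assumes same: "same_tangle T U" and U: "planar_tangle U"
  shows "planar_tangle T"
proof -
  have wfU: "wf_tangle U" and cU: "connected_tangle U" and eU: "card (discs U) + 2 * card (regions U) =
       2 + (\<Sum>d\<in>discs U. fst (colour U d)) + card (boundary_curves U)"
    using U unfolding planar_tangle_def by blast+
  have S: "inner T = inner U" "strings T = strings U" "regions T = regions U"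
    using same unfolding same_tangle_def by blast+
  have D: "discs T = discs U" by (simp add: discs_def S)
  have col: "colour T d = colour U d" if "d \<in> discs U" for d
    using same that unfolding same_tangle_def D by blast
  have np: "npoints T d = npoints U d" "nintervals T d = nintervals U d" if "d \<in> discs U" for d
    using col[OF that] by (simp_all add: npoints_def nintervals_def)
  have ish: "ishade T d j = ishade U d j" if "d \<in> discs U" for d j
    using col[OF that] by (simp add: ishade_def)
  have P: "points T = points U" "intervals T = intervals U"
    using np by (auto simp: points_def intervals_def D)
  have str: "strand T d j = strand U d j" if "(d, j) \<in> points U" for d j
    using same that np unfolding same_tangle_def D points_def by auto
  have rg: "reg T d j = reg U d j" if "(d, j) \<in> intervals U" for d j
    using same that np unfolding same_tangle_def D intervals_def by auto
  have sd: "side T e s = side U e s" if "e \<in> strings U" for e s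
    using same that unfolding same_tangle_def S by blast
  have pd: "d \<in> discs U" if "(d, j) \<in> points U" for d j using that by (auto simp: points_def)
  have idd: "d \<in> discs U" if "(d, j) \<in> intervals U" for d j using that by (auto simp: intervals_def)
  have pint: "(d, j) \<in> intervals U" "(d, Suc j mod npoints U d) \<in> intervals U"
    if "(d, j) \<in> points U" for d j
    using that Suc_mod_npoints[of j U d]
    by (auto simp: points_def intervals_def nintervals_def less_max_iff_disj)
  note fin = wf_tangleD(1-3)[OF wfU] and strU = wf_tangleD(4)[OF wfU] and regU = wf_tangleD(5)[OF wfU]
    and sideU = wf_tangleD(6)[OF wfU] and adjU = wf_tangleD(7,8)[OF wfU] and endU = wf_tangleD(9)[OF wfU]
  obtain sh where sh: "\<forall>(d, j)\<in>intervals U. sh (reg U d j) = ishade U d j"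
    "\<forall>e\<in>strings U. \<forall>s. sh (side U e s) = s"
    using wfU by (rule wf_tangle_shadingE)
  have out: "outgoing T p = outgoing U p" if "p \<in> points U" for p
    using that ish pd by (auto simp: outgoing_def split: prod.splits)
  have set: "{p\<in>points U. case_prod (strand T) p = e} = {p\<in>points U. case_prod (strand U) p = e}" for e
    using str by auto
  have fol: "follows T = follows U"
  proof (intro ext iffI)
    fix v w assume "follows T v w"
    then show "follows U v w" unfolding follows_def P
      using np str ish pd by (fastforce simp del: mod_Suc_eq)
  next
    fix v w assume "follows U v w"
    then obtain d i j where h: "(d, i) \<in> points U" "j \<in> {i, Suc i mod npoints U d}"
      "v = Inl (d, j)" "w = Inr (strand U d i, ishade U d j)"
      unfolding follows_def by blast
    show "follows T v w" unfolding follows_def P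
      by (rule bexI[OF _ h(1)], unfold prod.case, rule bexI[of _ j])
        (use h np[OF pd[OF h(1)]] str[OF h(1)] ish[OF pd[OF h(1)]] in auto)
  qed
  have bc: "boundary_curves T = boundary_curves U"
    by (simp add: boundary_curves_def curve_pieces_def P S fol)
  have adj: "adjacent_regions T = adjacent_regions U"
  proof -
    have "reg T d ` {..<nintervals T d} = reg U d ` {..<nintervals U d}" if "d \<in> discs U" for d
      using that rg np by (intro image_cong) (auto simp: intervals_def)
    moreover have "range (side T e) = range (side U e)" if "e \<in> strings U" for e
      using sd[OF that] by auto
    ultimately show ?thesis by (auto simp: adjacent_regions_def D S fun_eq_iff)
  qed
  have "wf_tangle T"
    unfolding wf_tangle_def S P set
  proof (intro conjI)
    show "finite (inner U)" "finite (strings U)" "finite (regions U)"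
      by (fact fin)+
    show "\<forall>(d, j)\<in>points U. strand T d j \<in> strings U" using strU str by auto
    show "\<forall>(d, j)\<in>intervals U. reg T d j \<in> regions U" using regU rg by auto
    show "\<forall>e\<in>strings U. \<forall>s. side T e s \<in> regions U" using sideU sd by auto
    show "\<exists>sh. (\<forall>(d, j)\<in>intervals U. sh (reg T d j) = ishade T d j) \<and> (\<forall>e\<in>strings U. \<forall>s. sh (side T e s) = s)"
      using sh rg sd ish idd by (intro exI[of _ sh]) auto
    show "\<forall>(d, j)\<in>points U. reg T d j = side T (strand T d j) (ishade T d j) \<and>
        reg T d (Suc j mod npoints T d) = side T (strand T d j) (opp (ishade T d j))"
    proof clarify
      fix d j assume h: "(d, j) \<in> points U"
      show "reg T d j = side T (strand T d j) (ishade T d j) \<and>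
        reg T d (Suc j mod npoints T d) = side T (strand T d j) (opp (ishade T d j))"
        using adjU[OF h] by (simp only: simp_thms str[OF h] rg[OF pint(1)[OF h]] np[OF pd[OF h]] rg[OF pint(2)[OF h]] sd[OF strU[OF h]] ish[OF pd[OF h]])
    qed
    show "\<forall>e\<in>strings U. {p \<in> points U. (case p of (x, y) \<Rightarrow> strand U x y) = e} = {} \<or>
       (\<exists>p q. {p \<in> points U. (case p of (x, y) \<Rightarrow> strand U x y) = e} = {p, q} \<and> outgoing T p \<and> \<not> outgoing T q)"
    proof
      fix e assume "e \<in> strings U"
      then consider "{p \<in> points U. (case p of (x, y) \<Rightarrow> strand U x y) = e} = {}"
        | p q where "{p \<in> points U. (case p of (x, y) \<Rightarrow> strand U x y) = e} = {p, q}" "outgoing U p" "\<not> outgoing U q"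
        using endU by blast
      then show "{p \<in> points U. (case p of (x, y) \<Rightarrow> strand U x y) = e} = {} \<or>
       (\<exists>p q. {p \<in> points U. (case p of (x, y) \<Rightarrow> strand U x y) = e} = {p, q} \<and> outgoing T p \<and> \<not> outgoing T q)"
      proof cases
        case (2 p q)
        then have "p \<in> points U" "q \<in> points U" by blast+
        then show ?thesis using 2 out by blast
      qed simp
    qed
  qed
  moreover have "connected_tangle T" using cU by (simp add: connected_tangle_def S adj)
  moreover have "(\<Sum>d\<in>discs U. fst (colour T d)) = (\<Sum>d\<in>discs U. fst (colour U d))"
    by (rule sum.cong) (simp_all add: col)
  ultimately show ?thesis using eU by (simp add: planar_tangle_def D S bc)
qed

lemma isotopic_same_tangle: "same_tangle T U \<Longrightarrow> isotopic (\<lambda>d. d) T U"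
  unfolding isotopic_def same_tangle_def
  by (intro conjI exI[of _ "\<lambda>x. x"]) (auto simp: option.map_ident bij_betw_def)

lemma same_tangle_tabulate:
  assumes "tab_ok T"
  shows "same_tangle T (tangle_of (tabulate T))"
proof -
  let ?U = "tangle_of (tabulate T)"
  have fin: "finite (inner T)" "finite (regions T)" "strings T = {..<card (strings T)}"
    using assms unfolding tab_ok_def by (metis List.finite_set)+
  have disc: "disc_of (tabulate T) d = tab_disc T d" if "d \<in> discs T" for d
  proof (cases d)
    case (Some k)
    then have "k \<in> inner T" using that by (auto simp: discs_def)
    then show ?thesis using fin(1) Some
      by (simp add: disc_of_def tabulate_def map_of_map_restrict)
  qed (simp add: disc_of_def tabulate_def)
  have 1: "colour T d = colour ?U d \<and> (\<forall>j<npoints T d. strand T d j = strand ?U d j) \<and>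
        (\<forall>j<nintervals T d. reg T d j = reg ?U d j)" if "d \<in> discs T" for d
    using disc[OF that] by (auto simp: tangle_of_def tab_disc_def npoints_def)
  have 2: "\<forall>s. side T e s = side ?U e s" if "e \<in> strings T" for e
  proof -
    have "e \<in> {..<card (strings T)}" using that by (subst fin(3)[symmetric])
    then show ?thesis by (auto simp: tangle_of_def tabulate_def split: shading.splits)
  qed
  show ?thesis unfolding same_tangle_def
  proof (intro conjI ballI)
    have "strings ?U = {..<card (strings T)}" by (simp add: tangle_of_def tabulate_def)
    then show "strings T = strings ?U" using fin(3) by (rule trans[OF _ sym, rotated])
    show "inner T = inner ?U" "regions T = regions ?U"
      using fin(1,2) by (simp_all add: tangle_of_def tabulate_def comp_def)
  qed (use 1 2 in blast)+
qed

section \<open>Gluing of tables and its numbering of classes\<close>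

lemma index_of_less: "x \<in> set xs \<Longrightarrow> index_of xs x < length xs"
  by (induction xs) (auto simp: index_of_def)

lemma nth_index_of: "x \<in> set xs \<Longrightarrow> xs ! index_of xs x = x"
  by (induction xs) (auto simp: index_of_def)

lemma index_of_nth: "distinct xs \<Longrightarrow> i < length xs \<Longrightarrow> index_of xs (xs ! i) = i"
  using nth_index_of[of "xs ! i" xs] index_of_less[of "xs ! i" xs] by (simp add: nth_eq_iff_index_eq)

context
  fixes xs :: "(nat + nat) list" and E
  assumes E: "set E \<subseteq> set xs \<times> set xs" and dist: "distinct xs"
begin

lemma look: "x \<in> set xs \<Longrightarrow> lookup (tabulate_map (union_find xs E)) x =
    index_of (remdups (map snd (union_find xs E))) (lookup (union_find xs E) x)"
  unfolding tabulate_map_def by (rule lookup_map_snd) simp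

lemma snds: "set (map snd (union_find xs E)) = lookup (union_find xs E) ` set xs"
  using map_snd_eq_lookup[of "union_find xs E"] dist by simp

lemma glue_image:
  "lookup (tabulate_map (union_find xs E)) ` set xs = {..<length (remdups (map snd (union_find xs E)))}"
    (is "?f ` _ = {..<length ?l}")
proof
  show "?f ` set xs \<subseteq> {..<length ?l}"
    using snds by (auto simp: look intro!: index_of_less)
  show "{..<length ?l} \<subseteq> ?f ` set xs"
  proof
    fix i assume i: "i \<in> {..<length ?l}"
    then have "?l ! i \<in> set (map snd (union_find xs E))" by (metis lessThan_iff nth_mem set_remdups)
    then obtain x where x: "x \<in> set xs" "?l ! i = lookup (union_find xs E) x" using snds by auto
    then have "?f x = i" using i index_of_nth[of ?l i] by (simp add: look)
    then show "i \<in> ?f ` set xs" using x(1) by blast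
  qed
qed

lemma glue_iff:
  assumes "v \<in> set xs" "w \<in> set xs"
  shows "lookup (tabulate_map (union_find xs E)) v = lookup (tabulate_map (union_find xs E)) w \<longleftrightarrow>
    equivclp (\<lambda>v w. (v, w) \<in> set E) v w"
proof -
  have "lookup (union_find xs E) v \<in> set (remdups (map snd (union_find xs E)))"
    "lookup (union_find xs E) w \<in> set (remdups (map snd (union_find xs E)))"
    using snds assms by auto
  then have "lookup (tabulate_map (union_find xs E)) v = lookup (tabulate_map (union_find xs E)) w \<longleftrightarrow>
     lookup (union_find xs E) v = lookup (union_find xs E) w"
    unfolding look[OF assms(1)] look[OF assms(2)] by (metis nth_index_of)
  then show ?thesis using union_find_iff[OF E assms] by simp
qed

lemma glue_map_snd: "set (map snd (tabulate_map (union_find xs E))) = lookup (tabulate_map (union_find xs E)) ` set xs"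
  using map_snd_eq_lookup[of "tabulate_map (union_find xs E)"] dist
  by (simp add: tabulate_map_def comp_def case_prod_unfold)

end

text \<open>Compatibility of the two tables. The last clause is well-definedness: the sides of a
  glued string are computed from one representative, and every other member of the class has to give
  the same regions.\<close>

definition plug_check :: "table \<Rightarrow> nat \<Rightarrow> table \<Rightarrow> bool" where
  "plug_check t D s \<longleftrightarrow> D \<in> set (map fst (inner_discs t)) \<and>
     fst (outer_disc s) = fst (disc_of t (Some D)) \<and>
     length (fst (snd (outer_disc s))) = length (fst (snd (disc_of t (Some D)))) \<and>
     list_all (\<lambda>(k, _). list_all (\<lambda>(k', _). k \<noteq> k' \<or> k = D) (inner_discs t)) (inner_discs s) \<and>
     list_all (\<lambda>v. map_prod (lookup (tabulate_map (region_glue t D s))) (lookup (tabulate_map (region_glue t D s)))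
         (sum_side t s v) =
       string_sides (plug t D s) ! lookup (tabulate_map (string_glue t D s)) v)
       (glue_elems (string_list t) (string_list s))"

lemma disc_lengths:
  assumes "wf_check t" "d \<in> set (disc_list t)"
  shows "length (fst (snd (disc_of t d))) = npoints (tangle_of t) d"
    "length (snd (snd (disc_of t d))) = nintervals (tangle_of t) d"
proof -
  have "even (length (fst (snd (disc_of t d)))) \<and>
       length (snd (snd (disc_of t d))) = max 1 (length (fst (snd (disc_of t d))))"
    using assms unfolding wf_check_def Let_def list_all_iff by blast
  then show "length (fst (snd (disc_of t d))) = npoints (tangle_of t) d"
    "length (snd (snd (disc_of t d))) = nintervals (tangle_of t) d"
    by (auto simp: npoints_def nintervals_def tangle_of_def)
qed

lemma wf_check_ranges:
  assumes "wf_check t" "d \<in> set (disc_list t)"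
  shows "set (fst (snd (disc_of t d))) \<subseteq> set (string_list t)"
    "set (snd (snd (disc_of t d))) \<subseteq> set (region_list t)"
proof -
  have wf: "wf_tangle (tangle_of t)" by (rule wf_check_sound[OF assms(1)])
  have "fst (snd (disc_of t d)) ! j \<in> set (string_list t)" if "j < length (fst (snd (disc_of t d)))" for j
  proof -
    have "(d, j) \<in> points (tangle_of t)"
      using that assms by (auto simp: points_def discs_tangle_of disc_lengths)
    then have "strand (tangle_of t) d j \<in> strings (tangle_of t)"
      using wf by (simp add: wf_tangleD)
    then show ?thesis by (simp add: tangle_of_def string_list_def)
  qed
  then show "set (fst (snd (disc_of t d))) \<subseteq> set (string_list t)" by (auto simp: in_set_conv_nth)
  have "snd (snd (disc_of t d)) ! j \<in> set (region_list t)" if "j < length (snd (snd (disc_of t d)))" for j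
  proof -
    have "(d, j) \<in> intervals (tangle_of t)"
      using that assms by (auto simp: intervals_def discs_tangle_of disc_lengths)
    then have "reg (tangle_of t) d j \<in> regions (tangle_of t)"
      using wf by (simp add: wf_tangleD)
    then show ?thesis by (simp add: tangle_of_def)
  qed
  then show "set (snd (snd (disc_of t d))) \<subseteq> set (region_list t)" by (auto simp: in_set_conv_nth)
qed


lemma glue_edges_subset:
  assumes "set as \<subseteq> set A" "set bs \<subseteq> set B"
  shows "set (glue_edges as bs) \<subseteq> set (glue_elems A B) \<times> set (glue_elems A B)"
proof clarify
  fix v w assume "(v, w) \<in> set (glue_edges as bs)"
  then have "v \<in> set (map Inl as)" "w \<in> set (map Inr bs)"
    unfolding glue_edges_def by (rule set_zip_leftD, rule set_zip_rightD)
  then show "v \<in> set (glue_elems A B) \<and> w \<in> set (glue_elems A B)"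
    using assms by (auto simp: glue_elems_def)
qed

lemma glued_union_find:
  assumes as: "set as \<subseteq> set A" and bs: "set bs \<subseteq> set B" and "distinct A" "distinct B"
    and len: "length as = n" "length bs = n"
    and R: "\<And>a b. R a b \<longleftrightarrow> (\<exists>j<n. a = as ! j \<and> b = bs ! j)"
    and C: "C = lookup (tabulate_map (union_find (glue_elems A B) (glue_edges as bs))) ` set (glue_elems A B)"
  shows "glued (set A) (set B) R C (lookup (tabulate_map (union_find (glue_elems A B) (glue_edges as bs))))"
proof -
  let ?xs = "glue_elems A B" and ?E = "glue_edges as bs"
  have xs: "set A <+> set B = set ?xs" by (auto simp: glue_elems_def)
  have sub: "set ?E \<subseteq> set ?xs \<times> set ?xs"
    by (rule glue_edges_subset[OF as bs])
  have dist: "distinct ?xs"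
    using assms(3,4) by (auto simp: glue_elems_def distinct_map inj_on_def)
  have "(v, w) \<in> set ?E \<longleftrightarrow> (\<exists>a b. v = Inl a \<and> w = Inr b \<and> R a b)" for v w
  proof -
    have "(v, w) \<in> set ?E \<longleftrightarrow> (\<exists>j<n. v = Inl (as ! j) \<and> w = Inr (bs ! j))"
      using len apply (auto simp: glue_edges_def set_zip)
      subgoal for j by (rule exI[of _ j]) simp
      done
    then show ?thesis unfolding R by blast
  qed
  then show ?thesis
    unfolding glued_def xs using glue_iff[OF sub dist] by (simp add: C)
qed

lemma disc_of_plug:
  assumes "d \<in> set (disc_list t)" "d \<noteq> Some D"
  shows "disc_of (plug t D s) d = disc_map (lookup (tabulate_map (string_glue t D s)) \<circ> Inl)
    (lookup (tabulate_map (region_glue t D s)) \<circ> Inl) (disc_of t d)"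
proof (cases d)
  case (Some k)
  have h: "map_of (map (map_prod id h) xs) k = map_option h (map_of xs k)" for h :: "disc \<Rightarrow> disc" and xs
    by (induction xs) auto
  have "k \<noteq> D" "k \<in> set (map fst (inner_discs t))" using assms Some by (auto simp: disc_list_def)
  moreover have "map_of (filter (\<lambda>(k, d). k \<noteq> D) xs) k = map_of xs k" if "k \<noteq> D" for xs :: "(nat \<times> disc) list"
    using that by (induction xs) auto
  moreover obtain z where "map_of (inner_discs t) k = Some z"
    using \<open>k \<in> set (map fst (inner_discs t))\<close> by (metis list.set_map map_of_eq_None_iff option.exhaust)
  ultimately show ?thesis using Some
    by (simp add: disc_of_def plug_def h map_add_def)
qed (simp add: disc_of_def plug_def)

lemma disc_of_plug':
  assumes "k \<in> set (map fst (inner_discs s))" "k \<notin> set (map fst (inner_discs t)) \<or> k = D"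
  shows "disc_of (plug t D s) (Some k) = disc_map (lookup (tabulate_map (string_glue t D s)) \<circ> Inr)
    (lookup (tabulate_map (region_glue t D s)) \<circ> Inr) (disc_of s (Some k))"
proof -
  have h: "map_of (map (map_prod id h) xs) k = map_option h (map_of xs k)" for h :: "disc \<Rightarrow> disc" and xs
    by (induction xs) auto
  have "map_of (filter (\<lambda>(k, d). k \<noteq> D) (inner_discs t)) k = None"
    using assms(2) by (force simp: map_of_eq_None_iff)
  moreover obtain z where "map_of (inner_discs s) k = Some z"
    using assms(1) by (metis list.set_map map_of_eq_None_iff option.exhaust)
  ultimately show ?thesis
    by (simp add: disc_of_def plug_def h map_add_def)
qed

lemma same_disc_tangle_of:
  assumes "disc_of u d' = disc_map f g (disc_of t d)" "wf_check t" "d \<in> set (disc_list t)"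
  shows "colour (tangle_of u) d' = colour (tangle_of t) d"
    "j < npoints (tangle_of t) d \<Longrightarrow> strand (tangle_of u) d' j = f (strand (tangle_of t) d j)"
    "j < nintervals (tangle_of t) d \<Longrightarrow> reg (tangle_of u) d' j = g (reg (tangle_of t) d j)"
  using assms(1) disc_lengths[OF assms(2,3)] by (auto simp: tangle_of_def disc_map_def)

text \<open>The quotient maps demanded by \<open>composite\<close> are the lookup functions of the
  renumbered union-find tables of strings and of regions.\<close>

lemma composite_plug:
  assumes t: "wf_check t" and s: "wf_check s" and chk: "plug_check t D s"
  shows "composite (tangle_of t) D (tangle_of s) (tangle_of (plug t D s))"
proof -
  let ?T = "tangle_of t" and ?S = "tangle_of s" and ?U = "tangle_of (plug t D s)"
  let ?f = "lookup (tabulate_map (string_glue t D s))"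
  let ?g = "lookup (tabulate_map (region_glue t D s))"
  let ?td = "disc_of t (Some D)" and ?sd = "outer_disc s"
  have D: "D \<in> set (map fst (inner_discs t))" and sgn: "fst ?sd = fst ?td"
    and len: "length (fst (snd ?sd)) = length (fst (snd ?td))"
    and dis: "\<And>k. k \<in> set (map fst (inner_discs s)) \<Longrightarrow> k \<notin> set (map fst (inner_discs t)) \<or> k = D"
    and sides: "\<And>v. v \<in> set (glue_elems (string_list t) (string_list s)) \<Longrightarrow>
      map_prod ?g ?g (sum_side t s v) = string_sides (plug t D s) ! ?f v"
    using chk unfolding plug_check_def list_all_iff by fastforce+
  have Dt: "Some D \<in> set (disc_list t)" using D by (auto simp: disc_list_def)
  have Ns: "None \<in> set (disc_list s)" by (simp add: disc_list_def)
  have sd: "?sd = disc_of s None" by (simp add: disc_of_def)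
  have col: "colour ?S None = colour ?T (Some D)" using sgn len by (simp add: tangle_of_def sd)
  have np: "npoints ?T (Some D) = npoints ?S None" "nintervals ?T (Some D) = nintervals ?S None"
    by (simp_all add: npoints_def nintervals_def col)
  have dist: "distinct (string_list t)" "distinct (string_list s)" "distinct (region_list t)" "distinct (region_list s)"
    using t s by (simp_all add: string_list_def wf_check_def Let_def)
  have subs: "set (fst (snd ?td)) \<subseteq> set (string_list t)" "set (fst (snd ?sd)) \<subseteq> set (string_list s)"
    using wf_check_ranges(1)[OF t Dt] wf_check_ranges(1)[OF s Ns] by (simp_all add: sd)
  have subr: "set (snd (snd ?td)) \<subseteq> set (region_list t)" "set (snd (snd ?sd)) \<subseteq> set (region_list s)"
    using wf_check_ranges(2)[OF t Dt] wf_check_ranges(2)[OF s Ns] by (simp_all add: sd)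
  have Es: "set (glue_edges (fst (snd ?td)) (fst (snd ?sd))) \<subseteq>
      set (glue_elems (string_list t) (string_list s)) \<times> set (glue_elems (string_list t) (string_list s))"
    by (rule glue_edges_subset[OF subs])
  have ds: "distinct (glue_elems (string_list t) (string_list s))"
    "distinct (glue_elems (region_list t) (region_list s))"
    using dist by (auto simp: glue_elems_def distinct_map inj_on_def)
  have strU: "strings ?U = ?f ` set (glue_elems (string_list t) (string_list s))"
    unfolding string_glue_def
    by (subst glue_image[OF Es ds(1)]) (simp add: tangle_of_def plug_def string_glue_def)
  have regU: "regions ?U = ?g ` set (glue_elems (region_list t) (region_list s))"
    using glue_map_snd[OF glue_edges_subset[OF subr] ds(2)]
    by (simp add: tangle_of_def plug_def region_glue_def)
  have G1: "glued (strings ?T) (strings ?S)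
      (\<lambda>a b. \<exists>j<npoints ?S None. a = strand ?T (Some D) j \<and> b = strand ?S None j) (strings ?U) ?f"
    unfolding strings_tangle_of[of t] strings_tangle_of[of s] string_glue_def
    by (rule glued_union_find[OF subs dist(1,2), where n = "npoints ?S None"])
      (use disc_lengths[OF t Dt] disc_lengths[OF s Ns] np in
        \<open>simp_all add: sd strU[unfolded string_glue_def] tangle_of_def[of t] tangle_of_def[of s]\<close>)
  have G2: "glued (regions ?T) (regions ?S)
      (\<lambda>a b. \<exists>j<nintervals ?S None. a = reg ?T (Some D) j \<and> b = reg ?S None j) (regions ?U) ?g"
    unfolding regions_tangle_of[of t] regions_tangle_of[of s] region_glue_def
    by (rule glued_union_find[OF subr dist(3,4), where n = "nintervals ?S None"])
      (use disc_lengths[OF t Dt] disc_lengths[OF s Ns] np in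
        \<open>simp_all add: sd regU[unfolded region_glue_def] tangle_of_def[of t] tangle_of_def[of s]\<close>)
  have side: "side ?U (?f v) x = ?g ((if x = Unshaded then fst else snd) (sum_side t s v))"
    if "v \<in> set (glue_elems (string_list t) (string_list s))" for v x
    using sides[OF that, symmetric] by (cases x) (simp_all add: tangle_of_def)
  have sideT: "side ?U (?f (Inl e)) x = ?g (Inl (side ?T e x))" if "e \<in> strings ?T" for e x
    using side[of "Inl e" x] that by (cases x) (auto simp: tangle_of_def[of t] glue_elems_def string_list_def)
  have sideS: "side ?U (?f (Inr e)) x = ?g (Inr (side ?S e x))" if "e \<in> strings ?S" for e x
    using side[of "Inr e" x] that by (cases x) (auto simp: tangle_of_def[of s] glue_elems_def string_list_def)
  have discT: "colour ?U d = colour ?T d \<and> (\<forall>j<npoints ?T d. strand ?U d j = ?f (Inl (strand ?T d j))) \<and>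
      (\<forall>j<nintervals ?T d. reg ?U d j = ?g (Inl (reg ?T d j)))" if "d \<in> discs ?T - {Some D}" for d
  proof -
    have d: "d \<in> set (disc_list t)" "d \<noteq> Some D" using that by (auto simp: discs_tangle_of)
    show ?thesis using same_disc_tangle_of[OF disc_of_plug[OF d] t d(1)] by simp
  qed
  have discS: "colour ?U d = colour ?S d \<and> (\<forall>j<npoints ?S d. strand ?U d j = ?f (Inr (strand ?S d j))) \<and>
      (\<forall>j<nintervals ?S d. reg ?U d j = ?g (Inr (reg ?S d j)))" if "d \<in> discs ?S - {None}" for d
  proof -
    have "d \<in> set (disc_list s)" "d \<noteq> None" using that by (auto simp: discs_tangle_of)
    then obtain k where d: "d \<in> set (disc_list s)" "d = Some k" by auto
    then have d3: "k \<in> set (map fst (inner_discs s))" by (auto simp: disc_list_def)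
    show ?thesis using same_disc_tangle_of[OF disc_of_plug'[OF d3 dis[OF d3]] s] d(1,2) by simp
  qed
  have "(inner ?T - {D}) \<inter> inner ?S = {}" using dis by (auto simp: inner_tangle_of)
  moreover have "inner ?U = (inner ?T - {D}) \<union> inner ?S"
    by (force simp: inner_tangle_of plug_def)
  ultimately show ?thesis
    unfolding composite_def using D col G1 G2 discT discS sideT sideS
    by (intro conjI exI[of _ ?f] exI[of _ ?g] ballI allI) (auto simp: inner_tangle_of)
qed

section \<open>Expressions in tangles\<close>

text \<open>A variable records its colour because flattening replaces it by the identity tangle of
  that colour.\<close>

datatype expr = Var nat colour | Node tangle "expr list"

primrec sem :: "(tangle \<Rightarrow> (nat \<Rightarrow> 'a) \<Rightarrow> 'a) \<Rightarrow> (nat \<Rightarrow> 'a) \<Rightarrow> expr \<Rightarrow> 'a" where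
  "sem A x (Var i c) = x i"
| "sem A x (Node T es) = A T (\<lambda>k. map (sem A x) es ! k)"

primrec well_typed :: "(colour \<Rightarrow> 'a set) \<Rightarrow> (nat \<Rightarrow> 'a) \<Rightarrow> expr \<Rightarrow> bool" where
  "well_typed V x (Var i c) \<longleftrightarrow> x i \<in> V c"
| "well_typed V x (Node T es) \<longleftrightarrow> list_all (well_typed V x) es"

text \<open>The composition axiom speaks of planar tangles, and that a composite is again planar is
  tested on each table rather than proved in general.\<close>

definition checked :: "table \<Rightarrow> table option" where
  "checked t = (if planar_check t then Some t else None)"

fun plug_option :: "nat \<Rightarrow> table option \<Rightarrow> table option \<Rightarrow> table option" where
  "plug_option k (Some t) (Some s) = (if plug_check t k s then checked (plug t k s) else None)"
| "plug_option k _ _ = None"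

primrec plugs :: "nat \<Rightarrow> table option list \<Rightarrow> table option \<Rightarrow> table option" where
  "plugs k [] r = r"
| "plugs k (s # ss) r = plugs (Suc k) ss (plug_option k r s)"

text \<open>The identity tangle with its input disc renamed to the number of a variable, so that it
  reads the valuation at that variable.\<close>

definition id_table :: "nat \<Rightarrow> table \<Rightarrow> table" where
  "id_table i t = Table (outer_disc t) [(i, outer_disc t)] (string_sides t) (region_list t)"

definition flatten_var :: "nat \<Rightarrow> colour \<Rightarrow> table option" where
  "flatten_var i c = (if planar_check (tabulate (id_tangle c)) \<and> tab_ok (id_tangle c) \<and> 3 \<le> i
     then checked (id_table i (tabulate (id_tangle c))) else None)"

definition flatten_node :: "tangle \<Rightarrow> table option list \<Rightarrow> table option" where
  "flatten_node T ss = (if tab_ok T \<and> inner T = {..<length ss} \<and> length ss \<le> 3 \<and>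
     list_all (\<lambda>(k, s). case s of Some t \<Rightarrow> colour T (Some k) = colour (tangle_of t) None | None \<Rightarrow> False)
       (List.enumerate 0 ss) then plugs 0 ss (checked (tabulate T)) else None)"

text \<open>
  The variables of an expression are numbered from \<open>3\<close> on, and no tangle used below has more than
  three input discs, so the labels of the discs that remain to be filled are never variables.
\<close>

primrec flatten :: "expr \<Rightarrow> table option" where
  "flatten (Var i c) = flatten_var i c"
| "flatten (Node T es) = flatten_node T (map flatten es)"

text \<open>An isotopy that fixes the labelled discs is forced on strings by their endpoints, and on
  regions by the intervals they touch, so the candidate maps can be read off. The bijectivity test
  rejects tables with closed loops or with regions that touch no disc.\<close>

definition string_pairs :: "table \<Rightarrow> table \<Rightarrow> (nat \<times> nat) list" where
  "string_pairs t u =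
     map (\<lambda>(d, j). (strand (tangle_of t) d j, strand (tangle_of u) d j)) (point_list t)"

definition region_pairs :: "table \<Rightarrow> table \<Rightarrow> (nat \<times> nat) list" where
  "region_pairs t u =
     map (\<lambda>(d, j). (reg (tangle_of t) d j, reg (tangle_of u) d j)) (interval_list t)"

definition bijective_list :: "nat list \<Rightarrow> nat list \<Rightarrow> (nat \<times> nat) list \<Rightarrow> bool" where
  "bijective_list as bs F \<longleftrightarrow> functional_list F \<and> functional_list (map prod.swap F) \<and>
     fst ` set F = set as \<and> snd ` set F = set bs"

definition iso_check :: "table \<Rightarrow> table \<Rightarrow> bool" where
  "iso_check t u \<longleftrightarrow> set (disc_list t) = set (disc_list u) \<and>
     list_all (\<lambda>d. fst (disc_of t d) = fst (disc_of u d) \<and>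
       length (fst (snd (disc_of t d))) = length (fst (snd (disc_of u d)))) (disc_list t) \<and>
     bijective_list (string_list t) (string_list u) (string_pairs t u) \<and>
     bijective_list (region_list t) (region_list u) (region_pairs t u) \<and>
     list_all (\<lambda>e. list_all (\<lambda>s. side (tangle_of u) (lookup (string_pairs t u) e) s =
       lookup (region_pairs t u) (side (tangle_of t) e s)) [Unshaded, Shaded]) (string_list t)"

fun iso_option :: "table option \<Rightarrow> table option \<Rightarrow> bool" where
  "iso_option (Some t) (Some u) \<longleftrightarrow> iso_check t u"
| "iso_option _ _ \<longleftrightarrow> False"

definition same_picture :: "expr \<Rightarrow> expr \<Rightarrow> bool" where
  "same_picture e e' \<longleftrightarrow> iso_option (flatten e) (flatten e')"

lemma bijective_listD:
  assumes "bijective_list as bs F"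
  shows "bij_betw (lookup F) (set as) (set bs)"
    and "(a, b) \<in> set F \<Longrightarrow> lookup F a = b"
proof -
  have F: "functional_list F" "functional_list (map prod.swap F)" "fst ` set F = set as" "snd ` set F = set bs"
    using assms by (auto simp: bijective_list_def)
  show *: "(a, b) \<in> set F \<Longrightarrow> lookup F a = b" for a b by (rule functional_listD[OF F(1)])
  have inv: "(a, b) \<in> set F \<Longrightarrow> lookup (map prod.swap F) b = a" for a b
    by (rule functional_listD[OF F(2)]) force
  show "bij_betw (lookup F) (set as) (set bs)"
    unfolding bij_betw_def
  proof (intro conjI inj_onI)
    fix a a' assume a: "a \<in> set as" "a' \<in> set as" "lookup F a = lookup F a'"
    then obtain b b' where "(a, b) \<in> set F" "(a', b') \<in> set F"
      unfolding F(3)[symmetric] by auto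
    then show "a = a'" using a(3) * inv by metis
  next
    show "lookup F ` set as = set bs"
      unfolding F(3,4)[symmetric] using * by (force simp: image_iff)
  qed
qed

lemma isotopic_iso_check:
  assumes "iso_check t u"
  shows "isotopic (\<lambda>d. d) (tangle_of t) (tangle_of u)"
proof -
  let ?T = "tangle_of t" and ?U = "tangle_of u"
  let ?F = "string_pairs t u" and ?G = "region_pairs t u"
  have D: "set (disc_list t) = set (disc_list u)"
    and c: "\<And>d. d \<in> set (disc_list t) \<Longrightarrow> colour ?U d = colour ?T d"
    and F: "bijective_list (string_list t) (string_list u) ?F"
    and G: "bijective_list (region_list t) (region_list u) ?G"
    and S: "\<And>e s. e \<in> set (string_list t) \<Longrightarrow> side ?U (lookup ?F e) s = lookup ?G (side ?T e s)"
  proof -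
    note a = assms[unfolded iso_check_def list_all_iff]
    show "set (disc_list t) = set (disc_list u)"
      "bijective_list (string_list t) (string_list u) ?F"
      "bijective_list (region_list t) (region_list u) ?G" using a by blast+
    show "colour ?U d = colour ?T d" if "d \<in> set (disc_list t)" for d
      using a that by (simp add: tangle_of_def)
    show "side ?U (lookup ?F e) s = lookup ?G (side ?T e s)" if "e \<in> set (string_list t)" for e s
      using a that by (cases s) simp_all
  qed
  have "inner ?T = inner ?U"
  proof -
    have "{k. Some k \<in> set (disc_list t)} = {k. Some k \<in> set (disc_list u)}" using D by simp
    moreover have "inner (tangle_of v) = {k. Some k \<in> set (disc_list v)}" for v
      by (auto simp: inner_tangle_of disc_list_def)
    ultimately show ?thesis by simp
  qed
  moreover have "strand ?U d j = lookup ?F (strand ?T d j)" if "d \<in> set (disc_list t)" "j < npoints ?T d" for d j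
  proof -
    have "(d, j) \<in> set (point_list t)" using that by (simp add: points_tangle_of[symmetric] points_def discs_tangle_of)
    then have "(strand ?T d j, strand ?U d j) \<in> set ?F" by (force simp: string_pairs_def)
    then show ?thesis using bijective_listD(2)[OF F] by simp
  qed
  moreover have "reg ?U d j = lookup ?G (reg ?T d j)" if "d \<in> set (disc_list t)" "j < nintervals ?T d" for d j
  proof -
    have "(d, j) \<in> set (interval_list t)" using that by (simp add: intervals_tangle_of[symmetric] intervals_def discs_tangle_of)
    then have "(reg ?T d j, reg ?U d j) \<in> set ?G" by (force simp: region_pairs_def)
    then show ?thesis using bijective_listD(2)[OF G] by simp
  qed
  ultimately show ?thesis
    unfolding isotopic_def discs_tangle_of
    using bijective_listD(1)[OF F] bijective_listD(1)[OF G] c S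
    by (intro conjI exI[of _ "lookup ?F"] exI[of _ "lookup ?G"])
      (auto simp: strings_tangle_of regions_tangle_of option.map_ident bij_betw_def)
qed

section \<open>Soundness of flattening\<close>

lemma composite_inputs:
  assumes "composite T D S U" "y \<in> inputs \<PP> T" "y \<in> inputs \<PP> S"
  shows "y \<in> inputs \<PP> U"
proof -
  have i: "inner U = (inner T - {D}) \<union> inner S" using assms(1) unfolding composite_def by (elim conjE)
  obtain f g where "\<forall>d\<in>discs T - {Some D}. colour U d = colour T d \<and>
           (\<forall>j<npoints T d. strand U d j = f (Inl (strand T d j))) \<and>
           (\<forall>j<nintervals T d. reg U d j = g (Inl (reg T d j)))"
    "\<forall>d\<in>discs S - {None}. colour U d = colour S d \<and>
           (\<forall>j<npoints S d. strand U d j = f (Inr (strand S d j))) \<and>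
           (\<forall>j<nintervals S d. reg U d j = g (Inr (reg S d j)))"
    using assms(1) unfolding composite_def by (elim conjE exE) (rule that)
  then have "colour U (Some k) = colour T (Some k)" if "k \<in> inner T - {D}" for k
    using that by (auto simp: discs_def)
  moreover have "colour U (Some k) = colour S (Some k)" if "k \<in> inner S" for k
    using \<open>\<forall>d\<in>discs S - {None}. _ d\<close> that by (auto simp: discs_def)
  ultimately show ?thesis using assms(2,3) unfolding inputs_def i by fastforce
qed

lemma isotopic_id_table:
  assumes "inner_discs t = [(0, outer_disc t)]"
  shows "isotopic (\<lambda>_. i) (tangle_of t) (tangle_of (id_table i t))"
proof -
  have d: "disc_of (id_table i t) (map_option (\<lambda>_. i) d) = disc_of t d" if "d \<in> discs (tangle_of t)" for d
    using that assms by (auto simp: discs_def tangle_of_def disc_of_def id_table_def)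
  have "inner (tangle_of t) = {0}" "inner (tangle_of (id_table i t)) = {i}"
    "strings (tangle_of (id_table i t)) = strings (tangle_of t)"
    "regions (tangle_of (id_table i t)) = regions (tangle_of t)"
    by (simp_all add: tangle_of_def id_table_def assms)
  moreover have "side (tangle_of (id_table i t)) e s = side (tangle_of t) e s" for e s
    by (cases s) (simp_all add: tangle_of_def id_table_def)
  moreover have "colour (tangle_of (id_table i t)) (map_option (\<lambda>_. i) d) = colour (tangle_of t) d"
    "strand (tangle_of (id_table i t)) (map_option (\<lambda>_. i) d) = strand (tangle_of t) d"
    "reg (tangle_of (id_table i t)) (map_option (\<lambda>_. i) d) = reg (tangle_of t) d"
    if "d \<in> discs (tangle_of t)" for d
    using d[OF that] by (simp_all add: tangle_of_def)
  ultimately show ?thesis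
    unfolding isotopic_def
    by (intro conjI exI[of _ "\<lambda>x. x"]) (simp_all add: bij_betw_def)
qed

lemma same_tangle_refl: "same_tangle T T"
  by (simp add: same_tangle_def)

context planar_algebra
begin

lemma act_cong:
  assumes "planar_tangle T" "x \<in> inputs \<PP> T" "\<And>d. d \<in> inner T \<Longrightarrow> y d = x d"
  shows "act \<PP> T y = act \<PP> T x"
  by (rule act_isotopic[OF assms(1,1) isotopic_same_tangle[OF same_tangle_refl] assms(2,3)])

lemma act_tabulate:
  assumes "tab_ok T" "planar_check (tabulate T)" "x \<in> inputs \<PP> T"
  shows "planar_tangle T" "x \<in> inputs \<PP> (tangle_of (tabulate T))"
    "act \<PP> (tangle_of (tabulate T)) x = act \<PP> T x"
proof -
  note same = same_tangle_tabulate[OF assms(1)]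
  note U = planar_check_sound[OF assms(2)]
  show T: "planar_tangle T" by (rule planar_same_tangle[OF same U])
  show "x \<in> inputs \<PP> (tangle_of (tabulate T))"
    using assms(3) same by (auto simp: inputs_def same_tangle_def discs_def)
  show "act \<PP> (tangle_of (tabulate T)) x = act \<PP> T x"
    by (rule act_isotopic[OF T U isotopic_same_tangle[OF same] assms(3)]) simp
qed

lemma planar_check_wf: "planar_check t \<Longrightarrow> wf_check t"
  unfolding planar_check_def by (elim conjE)

lemma flatten_var_sound:
  assumes "flatten_var i c = Some t" "x i \<in> box \<PP> c"
  shows "planar_check t \<and> x \<in> inputs \<PP> (tangle_of t) \<and> inner (tangle_of t) = {i} \<and> 3 \<le> i \<and>
    act \<PP> (tangle_of t) x = x i"
proof -
  let ?t = "tabulate (id_tangle c)"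
  have t: "t = id_table i ?t" and pt: "planar_check t" and p0: "planar_check ?t" and ok: "tab_ok (id_tangle c)"
    and i: "3 \<le> i"
    using assms(1) by (auto simp: flatten_var_def checked_def split: if_splits)
  have id: "inner (id_tangle c) = {0}" "colour (id_tangle c) d = c" for d
    by (simp_all add: id_tangle_def Let_def)
  have in0: "(\<lambda>_. x i) \<in> inputs \<PP> (id_tangle c)"
    using assms(2) by (auto simp: inputs_def id)
  have t0: "inner_discs ?t = [(0, outer_disc ?t)]"
    by (simp add: tabulate_def id tab_disc_def npoints_def nintervals_def) (simp add: id_tangle_def Let_def)
  have inn: "inner (tangle_of t) = {i}"
    by (simp add: inner_tangle_of t id_table_def)
  note iso = isotopic_id_table[OF t0, of i, folded t]
  note a = act_tabulate[OF ok p0 in0]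
  have "act \<PP> (tangle_of t) x = act \<PP> (tangle_of ?t) (\<lambda>_. x i)"
    by (rule act_isotopic[OF planar_check_sound[OF p0] planar_check_sound[OF pt] iso a(2)]) simp
  also have "\<dots> = x i" using a(3) act_id[OF assms(2)] by simp
  finally have "act \<PP> (tangle_of t) x = x i" .
  moreover have "x \<in> inputs \<PP> (tangle_of t)"
  proof -
    have "tab_disc (id_tangle c) None = (snd c, [0..<2 * fst c], [0..<max 1 (2 * fst c)])"
      by (simp add: tab_disc_def npoints_def nintervals_def id) (simp add: id_tangle_def Let_def)
    then have "colour (tangle_of t) (Some i) = c"
      by (simp add: t tangle_of_def tabulate_def disc_of_def id_table_def)
    then show ?thesis using assms(2) by (simp add: inputs_def inn)
  qed
  ultimately show ?thesis using pt i inn by simp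
qed

text \<open>One valuation \<open>y\<close> serves all stages: at a disc still to be filled it
  already holds the value of the child. The update in \<open>act_composite\<close> then leaves
  \<open>y\<close> as it is.\<close>

lemma plugs_sound:
  assumes "plugs k ss (Some t) = Some u" "planar_check t" "y \<in> inputs \<PP> (tangle_of t)"
    and "\<And>j. j < length ss \<Longrightarrow> \<exists>s. ss ! j = Some s \<and> planar_check s \<and> y \<in> inputs \<PP> (tangle_of s) \<and>
      inner (tangle_of s) \<subseteq> {3..} \<and> act \<PP> (tangle_of s) y = y (k + j)"
  shows "planar_check u \<and> y \<in> inputs \<PP> (tangle_of u) \<and> act \<PP> (tangle_of u) y = act \<PP> (tangle_of t) y \<and>
    inner (tangle_of u) \<subseteq> (inner (tangle_of t) - {k..<k + length ss}) \<union> {3..}"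
  using assms
proof (induction ss arbitrary: k t)
  case (Cons s0 ss)
  obtain s where s: "s0 = Some s" "planar_check s" "y \<in> inputs \<PP> (tangle_of s)"
      "inner (tangle_of s) \<subseteq> {3..}" "act \<PP> (tangle_of s) y = y k"
    using Cons.prems(4)[of 0] by auto
  define v where "v = plug t k s"
  have none: "plugs j xs None = Some w \<Longrightarrow> False" for j xs w
    by (induction xs arbitrary: j) auto
  have v: "plug_check t k s" "planar_check v" "plugs (Suc k) ss (Some v) = Some u"
    using Cons.prems(1) none unfolding s(1) v_def
    by (auto simp: checked_def split: if_splits)
  have comp: "composite (tangle_of t) k (tangle_of s) (tangle_of v)"
    unfolding v_def by (rule composite_plug[OF planar_check_wf planar_check_wf v(1)]) fact+
  have yv: "y \<in> inputs \<PP> (tangle_of v)" by (rule composite_inputs[OF comp Cons.prems(3) s(3)])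
  have act: "act \<PP> (tangle_of v) y = act \<PP> (tangle_of t) y"
    using act_composite[OF planar_check_sound planar_check_sound comp yv] Cons.prems(2) s(2,5)
    by (simp add: fun_upd_idem)
  have inn: "inner (tangle_of v) = (inner (tangle_of t) - {k}) \<union> inner (tangle_of s)"
    using comp unfolding composite_def by (elim conjE)
  have "\<exists>s. ss ! j = Some s \<and> planar_check s \<and> y \<in> inputs \<PP> (tangle_of s) \<and>
      inner (tangle_of s) \<subseteq> {3..} \<and> act \<PP> (tangle_of s) y = y (Suc k + j)" if "j < length ss" for j
    using Cons.prems(4)[of "Suc j"] that by simp
  from Cons.IH[OF v(3,2) yv this] show ?case
    using act inn s(4) by (auto simp: atLeastLessThan_def)
qed simp

lemma flatten_sound:
  assumes "flatten e = Some t" "well_typed (box \<PP>) x e"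
  shows "planar_check t \<and> x \<in> inputs \<PP> (tangle_of t) \<and> inner (tangle_of t) \<subseteq> {3..} \<and>
    sem (act \<PP>) x e = act \<PP> (tangle_of t) x"
  using assms
proof (induction e arbitrary: t)
  case (Var i c)
  then show ?case using flatten_var_sound[of i c t x] by auto
next
  case (Node T es)
  let ?n = "length es" and ?s = "sem (act \<PP>) x"
  \<comment> \<open>Values of children at the labels to be filled, variables elsewhere. Since
    \<open>?n\<close> is at most 3 and variables start at 3, the two ranges do not clash.\<close>
  define y where "y k = (if k < ?n then ?s (es ! k) else x k)" for k
  have ok: "tab_ok T" and inn: "inner T = {..<?n}" and n: "?n \<le> 3" and pT: "planar_check (tabulate T)"
    and plugs: "plugs 0 (map flatten es) (Some (tabulate T)) = Some t"
    and col: "\<And>k. k < ?n \<Longrightarrow> \<exists>s. flatten (es ! k) = Some s \<and> colour T (Some k) = colour (tangle_of s) None"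
  proof -
    note f = Node.prems(1)[simplified, unfolded flatten_node_def, simplified length_map]
    show "tab_ok T" "inner T = {..<?n}" "?n \<le> 3" using f by (auto split: if_splits)
    have none: "plugs j xs None = Some w \<Longrightarrow> False" for j xs w
      by (induction xs arbitrary: j) auto
    show "planar_check (tabulate T)" "plugs 0 (map flatten es) (Some (tabulate T)) = Some t"
      using f none by (auto simp: checked_def split: if_splits)
    show "\<exists>s. flatten (es ! k) = Some s \<and> colour T (Some k) = colour (tangle_of s) None" if "k < ?n" for k
    proof -
      have "(k, flatten (es ! k)) \<in> set (List.enumerate 0 (map flatten es))"
        using that by (simp add: in_set_enumerate_eq)
      then have "case flatten (es ! k) of Some t \<Rightarrow> colour T (Some k) = colour (tangle_of t) None | None \<Rightarrow> False"
        using f by (auto simp: list_all_iff split: if_splits)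
      then show ?thesis by (auto split: option.splits)
    qed
  qed
  have child: "planar_check s \<and> y \<in> inputs \<PP> (tangle_of s) \<and> inner (tangle_of s) \<subseteq> {3..} \<and>
      act \<PP> (tangle_of s) y = y k" if "k < ?n" "flatten (es ! k) = Some s" for k s
  proof -
    have "es ! k \<in> set es" using that by simp
    moreover have "well_typed (box \<PP>) x (es ! k)" using Node.prems(2) that by (simp add: list_all_iff)
    ultimately have s: "planar_check s" "x \<in> inputs \<PP> (tangle_of s)" "inner (tangle_of s) \<subseteq> {3..}"
      "?s (es ! k) = act \<PP> (tangle_of s) x"
      using Node.IH that(2) by blast+
    have "y d = x d" if "d \<in> inner (tangle_of s)" for d using that s(3) n by (auto simp: y_def)
    then show ?thesis
      using s that(1) act_cong[OF planar_check_sound[OF s(1)] s(2), of y] by (auto simp: inputs_def y_def)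
  qed
  have yT: "y \<in> inputs \<PP> T"
    unfolding inputs_def inn
  proof clarify
    fix k assume "k < ?n"
    with col obtain s where s: "flatten (es ! k) = Some s" "colour T (Some k) = colour (tangle_of s) None" by blast
    then show "y k \<in> box \<PP> (colour T (Some k))"
      using child[OF \<open>k < ?n\<close> s(1)] act_closed[OF planar_check_sound] by metis
  qed
  note a = act_tabulate[OF ok pT yT]
  have "\<exists>s. map flatten es ! j = Some s \<and> planar_check s \<and> y \<in> inputs \<PP> (tangle_of s) \<and>
      inner (tangle_of s) \<subseteq> {3..} \<and> act \<PP> (tangle_of s) y = y (0 + j)" if "j < length (map flatten es)" for j
    using col[of j] child[of j] that by auto
  from plugs_sound[OF plugs pT a(2) this]
  have t: "planar_check t" "y \<in> inputs \<PP> (tangle_of t)" "act \<PP> (tangle_of t) y = act \<PP> T y"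
    and "inner (tangle_of t) \<subseteq> inner (tangle_of (tabulate T)) - {0..<?n} \<union> {3..}"
    using a(3) by auto
  moreover have "inner (tangle_of (tabulate T)) = {..<?n}"
    using inn by (simp add: inner_tangle_of tabulate_def comp_def)
  ultimately have t3: "inner (tangle_of t) \<subseteq> {3..}" by auto
  then have xy: "x d = y d" if "d \<in> inner (tangle_of t)" for d using that n by (auto simp: y_def)
  have "?s (Node T es) = act \<PP> T y"
    unfolding sem.simps by (rule act_cong[OF a(1) yT]) (simp add: inn y_def)
  then show ?case
    using t t3 xy act_cong[OF planar_check_sound[OF t(1)] t(2), of x] by (auto simp: inputs_def)
qed

theorem same_picture_sound:
  assumes "same_picture e e'" "well_typed (box \<PP>) x e" "well_typed (box \<PP>) x e'"
  shows "sem (act \<PP>) x e = sem (act \<PP>) x e'"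
proof -
  obtain t u where t: "flatten e = Some t" and u: "flatten e' = Some u" and iso: "iso_check t u"
    using assms(1) by (cases "flatten e"; cases "flatten e'") (auto simp: same_picture_def)
  note T = flatten_sound[OF t assms(2)] and U = flatten_sound[OF u assms(3)]
  have "act \<PP> (tangle_of u) x = act \<PP> (tangle_of t) x"
    by (rule act_isotopic[OF planar_check_sound planar_check_sound isotopic_iso_check[OF iso]])
      (use T U in auto)
  then show ?thesis using T U by simp
qed

end

section \<open>Evaluating the planarity check\<close>

text \<open>One row per boundary point: the point, which also names the interval before it, the
  interval after it, its string, and the regions and shadings of both intervals. The checks then
  share this data instead of deriving it anew from the fields of \<open>tangle_of\<close>.\<close>

type_synonym row = "(nat option \<times> nat) \<times> (nat option \<times> nat) \<times> nat \<times> nat \<times> nat \<times> shading \<times> shading"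

definition shade_at :: "shading \<Rightarrow> nat \<Rightarrow> shading" where
  "shade_at s j = (if even j then s else opp s)"

fun disc_rows :: "nat option \<Rightarrow> disc \<Rightarrow> row list" where
  "disc_rows d (s, strs, rs) = (let n = 2 * (length strs div 2) in
     map (\<lambda>j. let i = cyclic_Suc n j in
       ((d, j), (d, i), strs ! j, rs ! j, rs ! i, shade_at s j, shade_at s i)) [0..<n])"

fun disc_intervals :: "nat option \<Rightarrow> disc \<Rightarrow> ((nat option \<times> nat) \<times> nat \<times> shading) list" where
  "disc_intervals d (s, strs, rs) =
     map (\<lambda>j. ((d, j), rs ! j, shade_at s j)) [0..<max 1 (2 * (length strs div 2))]"

definition point_rows :: "table \<Rightarrow> row list" where
  "point_rows t = concat (map (\<lambda>d. disc_rows d (disc_of t d)) (disc_list t))"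

definition interval_rows :: "table \<Rightarrow> ((nat option \<times> nat) \<times> nat \<times> shading) list" where
  "interval_rows t = concat (map (\<lambda>d. disc_intervals d (disc_of t d)) (disc_list t))"

lemma point_rows_eq:
  "point_rows t = (let T = tangle_of t in map (\<lambda>(d, j). let i = cyclic_Suc (npoints T d) j in
     ((d, j), (d, i), strand T d j, reg T d j, reg T d i, ishade T d j, ishade T d i)) (point_list t))"
proof -
  have "disc_rows d (disc_of t d) = map ((\<lambda>(d, j). let i = cyclic_Suc (npoints (tangle_of t) d) j in
     ((d, j), (d, i), strand (tangle_of t) d j, reg (tangle_of t) d j, reg (tangle_of t) d i,
      ishade (tangle_of t) d j, ishade (tangle_of t) d i)) \<circ> Pair d) [0..<npoints (tangle_of t) d]" for d
    by (cases "disc_of t d")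
      (simp add: npoints_def ishade_def shade_at_def tangle_of_def Let_def)
  then show ?thesis by (simp add: point_rows_def point_list_def map_concat comp_def Let_def)
qed

lemma interval_rows_eq:
  "interval_rows t = (let T = tangle_of t in
     map (\<lambda>(d, j). ((d, j), reg T d j, ishade T d j)) (interval_list t))"
proof -
  have "disc_intervals d (disc_of t d) = map ((\<lambda>(d, j). ((d, j), reg (tangle_of t) d j,
     ishade (tangle_of t) d j)) \<circ> Pair d) [0..<nintervals (tangle_of t) d]" for d
    by (cases "disc_of t d")
      (simp add: npoints_def nintervals_def ishade_def shade_at_def tangle_of_def)
  then show ?thesis by (simp add: interval_rows_def interval_list_def map_concat comp_def Let_def)
qed

definition side_of :: "(nat \<times> nat) list \<Rightarrow> nat \<Rightarrow> shading \<Rightarrow> nat" where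
  "side_of es e s = (case s of Unshaded \<Rightarrow> fst (es ! e) | Shaded \<Rightarrow> snd (es ! e))"

fun opposite_ends :: "row list \<Rightarrow> bool" where
  "opposite_ends [] \<longleftrightarrow> True"
| "opposite_ends [((d, _), _, _, _, _, s, _), ((d', _), _, _, _, _, s', _)] \<longleftrightarrow>
     ((s = Unshaded) = (d \<noteq> None)) \<noteq> ((s' = Unshaded) = (d' \<noteq> None))"
| "opposite_ends _ \<longleftrightarrow> False"

definition wf_rows :: "row list \<Rightarrow> (nat \<times> shading) list \<Rightarrow> (nat \<times> nat) list \<Rightarrow> nat list \<Rightarrow> nat \<Rightarrow> bool" where
  "wf_rows ps sh es rs m \<longleftrightarrow>
     list_all (\<lambda>(_, _, e, _). e < m) ps \<and>
     list_all (\<lambda>(r, _). r \<in> set rs) sh \<and> functional_list sh \<and>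
     list_all (\<lambda>(_, _, e, r, r', s, _). r = side_of es e s \<and> r' = side_of es e (opp s)) ps \<and>
     list_all (\<lambda>e. opposite_ends (filter (\<lambda>(_, _, e', _). e' = e) ps)) [0..<m]"

lemma shade_list_code [code]:
  "shade_list t = map snd (interval_rows t) @
     map (\<lambda>p. (fst p, Unshaded)) (string_sides t) @ map (\<lambda>p. (snd p, Shaded)) (string_sides t)"
proof -
  have 1: "map (\<lambda>e. (side (tangle_of t) e Unshaded, Unshaded)) [0..<length (string_sides t)] =
      map (\<lambda>p. (fst p, Unshaded)) (string_sides t)"
    by (rule nth_equalityI) (simp_all add: tangle_of_def)
  have 2: "map (\<lambda>e. (side (tangle_of t) e Shaded, Shaded)) [0..<length (string_sides t)] =
      map (\<lambda>p. (snd p, Shaded)) (string_sides t)"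
    by (rule nth_equalityI) (simp_all add: tangle_of_def)
  show ?thesis
    unfolding shade_list_def string_list_def Let_def 1 2
    by (simp add: interval_rows_eq Let_def case_prod_unfold comp_def)
qed

lemma wf_check_code [code]:
  "wf_check t \<longleftrightarrow> distinct (map fst (inner_discs t)) \<and> distinct (region_list t) \<and>
     list_all (\<lambda>d. even (length (fst (snd (disc_of t d)))) \<and>
       length (snd (snd (disc_of t d))) = max 1 (length (fst (snd (disc_of t d))))) (disc_list t) \<and>
     wf_rows (point_rows t) (shade_list t) (string_sides t) (region_list t) (length (string_sides t))"
proof -
  let ?T = "tangle_of t"
  let ?row = "\<lambda>(d, j). let i = cyclic_Suc (npoints ?T d) j in
     ((d, j), (d, i), strand ?T d j, reg ?T d j, reg ?T d i, ishade ?T d j, ishade ?T d i)"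
  have side: "side ?T e s = side_of (string_sides t) e s" for e s
    by (simp add: tangle_of_def side_of_def)
  have rows: "point_rows t = map ?row (point_list t)" by (simp only: point_rows_eq Let_def)
  have ends: "(case xs of [] \<Rightarrow> True | [p, q] \<Rightarrow> outgoing ?T p \<noteq> outgoing ?T q | _ \<Rightarrow> False) \<longleftrightarrow>
      opposite_ends (map ?row xs)" for xs
  proof (cases xs)
    case (Cons p ys)
    show ?thesis
    proof (cases ys)
      case Nil
      then show ?thesis using Cons by (simp add: Let_def case_prod_unfold)
    next
      case (Cons q zs)
      then show ?thesis using \<open>xs = p # ys\<close>
        by (cases zs) (auto simp: outgoing_def Let_def split: prod.splits)
    qed
  qed simp
  have fil: "filter (\<lambda>(_, _, e', _). e' = e) (map ?row xs) = map ?row (filter (\<lambda>(d, j). strand ?T d j = e) xs)" for e xs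
    by (induction xs) (auto simp: Let_def)
  show ?thesis
    unfolding wf_check_def wf_rows_def Let_def[of ?T] ends rows fil string_list_def side
    by (simp add: list_all_iff case_prod_unfold Let_def)
qed

lemma follow_list_code [code]:
  "follow_list t = concat (map (\<lambda>(p, q, e, _, _, s, s'). [(Inl p, Inr (e, s)), (Inl q, Inr (e, s'))]) (point_rows t))"
  by (simp add: follow_list_def point_rows_eq Let_def comp_def case_prod_unfold)

lemma piece_list_code [code]:
  "piece_list t = map (Inl \<circ> fst) (interval_rows t) @
     map (\<lambda>e. Inr (e, Unshaded)) (string_list t) @ map (\<lambda>e. Inr (e, Shaded)) (string_list t)"
  by (simp add: piece_list_def interval_rows_eq Let_def comp_def case_prod_unfold)

section \<open>Pictorial identities\<close>

text \<open>The side conditions that every use of an axiom about \<open>act\<close> asks for,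
  bundled so that each tangle is evaluated once.\<close>

definition good_tangle :: "tangle \<Rightarrow> colour list \<Rightarrow> colour \<Rightarrow> bool" where
  "good_tangle T cs c \<longleftrightarrow> tab_ok T \<and> planar_check (tabulate T) \<and> inner T = {..<length cs} \<and>
     list_all (\<lambda>(k, c'). colour T (Some k) = c') (List.enumerate 0 cs) \<and> colour T None = c"

abbreviation "vN k \<equiv> Var k (1, Unshaded)"
abbreviation "vM k \<equiv> Var k (1, Shaded)"
abbreviation "vQ k \<equiv> Var k (2, Shaded)"

lemma picture_lconv_cap_cup:
  "same_picture (Node lconv_tangle [vN 3, Node fourier_tangle [Node (unit_tangle (2, Unshaded)) []]]) (vN 3)"
  by code_simp

lemma picture_lconv_conv:
  "same_picture (Node lconv_tangle [vN 3, Node conv_tangle [vQ 4, vQ 5]])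
     (Node lconv_tangle [Node lconv_tangle [vN 3, vQ 4], vQ 5])"
  by code_simp

text \<open>On the left of the 2-box, the string through the first 1-box is an arc. Sliding that box
  along the arc until it stands above the 2-box gives it half a turn, whence
  \<open>rotate_tangle\<close>.\<close>

lemma picture_trace_lconv:
  "same_picture
     (Node (closure_tangle (1, Unshaded)) [Node (mult_tangle (1, Unshaded)) [Node lconv_tangle [vN 3, vQ 4], vN 5]])
     (Node lr_closure_tangle [Node (mult_tangle (2, Shaded))
       [vQ 4, Node juxtapose_tangle [Node rotate_tangle [vN 3], vN 5]]])"
  by code_simp

text \<open>Both closures join every end of one box to the mirror end of the other. The quarter
  turns of the two boxes have opposite senses because a reflection reverses rotations.\<close>

lemma picture_lr_closure_mult:
  "same_picture (Node lr_closure_tangle [Node (mult_tangle (2, Shaded)) [vQ 3, vQ 4]])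
     (Node (closure_tangle (2, Unshaded)) [Node (mult_tangle (2, Unshaded))
       [Node (reflect inv_fourier_tangle) [vQ 3], Node inv_fourier_tangle [vQ 4]]])"
  by code_simp

lemma picture_fourier_inv: "same_picture (Node fourier_tangle [Node inv_fourier_tangle [vQ 3]]) (vQ 3)"
  by code_simp

text \<open>A half-turned box closed on the left is the box itself closed on the right, turned as a
  whole. What remains are two disjoint closed diagrams in one unshaded region.\<close>

lemma picture_lr_closure_juxtapose:
  "same_picture (Node lr_closure_tangle [Node juxtapose_tangle [Node rotate_tangle [vN 3], vN 4]])
     (Node (mult_tangle (0, Unshaded)) [Node (closure_tangle (1, Unshaded)) [vN 3],
       Node (closure_tangle (1, Unshaded)) [vN 4]])"
  by code_simp

text \<open>Each 1-box travels along its own closing arc, one on the left and one on the right, from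
  above the 2-box to below it. This is the substitute for traciality of the left-right
  closure.\<close>

lemma picture_slide:
  "same_picture
     (Node lr_closure_tangle [Node (mult_tangle (2, Shaded)) [vQ 3, Node juxtapose_tangle [vM 4, vN 5]]])
     (Node lr_closure_tangle [Node (mult_tangle (2, Shaded)) [Node juxtapose_tangle [vM 4, vN 5], vQ 3]])"
  by code_simp

lemma picture_schur:
  "same_picture
     (Node (closure_tangle (2, Shaded)) [Node (mult_tangle (2, Shaded))
       [Node conv_tangle [Node (mult_tangle (2, Shaded)) [vQ 3, vQ 4], Node (mult_tangle (2, Shaded)) [vQ 5, vQ 6]],
        Node (mult_tangle (2, Shaded)) [vQ 7, vQ 8]]])
     (Node (closure_tangle (3, Shaded)) [Node (mult_tangle (3, Shaded))
       [Node (reflect schur_tangle) [vQ 3, vQ 5, vQ 8], Node schur_tangle [vQ 4, vQ 6, vQ 7]]])"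
  by code_simp

lemma picture_cap:
  "same_picture
     (Node (closure_tangle (2, Shaded)) [Node (mult_tangle (2, Shaded))
       [Node fourier_tangle [Node (unit_tangle (2, Unshaded)) []], Node (mult_tangle (2, Shaded)) [vQ 3, vQ 4]]])
     (Node (closure_tangle (1, Shaded)) [Node (mult_tangle (1, Shaded))
       [Node cap_tangle [vQ 3], Node (reflect cap_tangle) [vQ 4]]])"
  by code_simp

text \<open>Here the 1-box sits on the right and slides along the right arc. Both strings close to
  the right, so the ordinary closure with shaded outer region appears in place of the left-right
  closure.\<close>

lemma picture_trace_rconv:
  "same_picture
     (Node (closure_tangle (1, Shaded)) [Node (mult_tangle (1, Shaded))
       [Node rconv_tangle [vQ 3, Node rotate_tangle [vN 4]], vM 5]])
     (Node (closure_tangle (2, Shaded)) [Node (mult_tangle (2, Shaded)) [vQ 3, Node juxtapose_tangle [vM 5, vN 4]]])"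
  by code_simp

lemma picture_juxtapose_mult:
  "same_picture
     (Node (mult_tangle (2, Shaded)) [Node juxtapose_tangle [vM 3, vN 4], Node juxtapose_tangle [vM 5, vN 6]])
     (Node juxtapose_tangle [Node (mult_tangle (1, Shaded)) [vM 3, vM 5], Node (mult_tangle (1, Unshaded)) [vN 4, vN 6]])"
  by code_simp

lemma picture_juxtapose_star:
  "same_picture (Node (reflect juxtapose_tangle) [vM 3, vN 4]) (Node juxtapose_tangle [vM 3, vN 4])"
  by code_simp

lemma picture_rotate_star: "same_picture (Node (reflect rotate_tangle) [vN 3]) (Node rotate_tangle [vN 3])"
  by code_simp

lemma picture_rotate_mult:
  "same_picture (Node rotate_tangle [Node (mult_tangle (1, Unshaded)) [vN 3, vN 4]])
     (Node (mult_tangle (1, Shaded)) [Node rotate_tangle [vN 4], Node rotate_tangle [vN 3]])"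
  by code_simp

lemma picture_rotate_inv: "same_picture (Node rotate_tangle [Node inv_rotate_tangle [vM 3]]) (vM 3)"
  by code_simp

lemma picture_inv_rotate: "same_picture (Node inv_rotate_tangle [Node rotate_tangle [vN 3]]) (vN 3)"
  by code_simp

section \<open>Planarity and colours of the tangles in use\<close>

lemma good_lconv: "good_tangle lconv_tangle [(1, Unshaded), (2, Shaded)] (1, Unshaded)"
  by code_simp

lemma good_rconv: "good_tangle rconv_tangle [(2, Shaded), (1, Shaded)] (1, Shaded)"
  by code_simp

lemma good_conv: "good_tangle conv_tangle [(2, Shaded), (2, Shaded)] (2, Shaded)"
  by code_simp

lemma good_juxtapose: "good_tangle juxtapose_tangle [(1, Shaded), (1, Unshaded)] (2, Shaded)"
  by code_simp

lemma good_reflect_juxtapose: "good_tangle (reflect juxtapose_tangle) [(1, Shaded), (1, Unshaded)] (2, Shaded)"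
  by code_simp

lemma good_rotate: "good_tangle rotate_tangle [(1, Unshaded)] (1, Shaded)"
  by code_simp

lemma good_reflect_rotate: "good_tangle (reflect rotate_tangle) [(1, Unshaded)] (1, Shaded)"
  by code_simp

lemma good_inv_rotate: "good_tangle inv_rotate_tangle [(1, Shaded)] (1, Unshaded)"
  by code_simp

lemma good_fourier: "good_tangle fourier_tangle [(2, Unshaded)] (2, Shaded)"
  by code_simp

lemma good_inv_fourier: "good_tangle inv_fourier_tangle [(2, Shaded)] (2, Unshaded)"
  by code_simp

lemma good_reflect_inv_fourier: "good_tangle (reflect inv_fourier_tangle) [(2, Shaded)] (2, Unshaded)"
  by code_simp

lemma good_lr_closure: "good_tangle lr_closure_tangle [(2, Shaded)] (0, Unshaded)"
  by code_simp

lemma good_unit: "good_tangle (unit_tangle (2, Unshaded)) [] (2, Unshaded)"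
  by code_simp

lemma good_closure: "good_tangle (closure_tangle (1, Unshaded)) [(1, Unshaded)] (0, Unshaded)"
  by code_simp

lemma good_schur: "good_tangle schur_tangle [(2, Shaded), (2, Shaded), (2, Shaded)] (3, Shaded)"
  by code_simp

lemma good_reflect_schur: "good_tangle (reflect schur_tangle) [(2, Shaded), (2, Shaded), (2, Shaded)] (3, Shaded)"
  by code_simp

lemma good_cap: "good_tangle cap_tangle [(2, Shaded)] (1, Shaded)"
  by code_simp

lemma good_reflect_cap: "good_tangle (reflect cap_tangle) [(2, Shaded)] (1, Shaded)"
  by code_simp

section \<open>Finite-dimensional \<open>C\<^sup>*\<close>-algebras with a faithful trace\<close>

lemma complex_interpolation:
  fixes f :: "complex \<Rightarrow> complex"
  assumes "finite S"
  shows "\<exists>p. \<forall>z\<in>S. poly p z = f z"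
  using assms
proof (induction S rule: finite_induct)
  case (insert x S)
  then obtain p where p: "\<forall>z\<in>S. poly p z = f z" by blast
  \<comment> \<open>Newton interpolation: a multiple of \<open>w\<close> corrects the value at
    \<open>x\<close> and leaves those on \<open>S\<close> alone.\<close>
  define w where "w = (\<Prod>z\<in>S. [:-z, 1:])"
  have wx: "poly w x \<noteq> 0" and wS: "z \<in> S \<Longrightarrow> poly w z = 0" for z
    using insert.hyps by (auto simp: w_def poly_prod)
  show ?case
    using p wx wS by (intro exI[of _ "p + smult ((f x - poly p x) / poly w x) w"]) auto
qed simp

locale traced_cstar_algebra = fin_dim_cstar_algebra scl A mul st u
  for scl :: "complex \<Rightarrow> 'a::ab_group_add \<Rightarrow> 'a" and A mul st u +
  fixes \<tau> :: "'a \<Rightarrow> complex"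
  assumes trace_add: "a \<in> A \<Longrightarrow> b \<in> A \<Longrightarrow> \<tau> (a + b) = \<tau> a + \<tau> b"
    and trace_scl: "a \<in> A \<Longrightarrow> \<tau> (scl r a) = r * \<tau> a"
    and trace_comm: "a \<in> A \<Longrightarrow> b \<in> A \<Longrightarrow> \<tau> (mul a b) = \<tau> (mul b a)"
    and trace_nonneg: "a \<in> A \<Longrightarrow> 0 \<le> \<tau> (mul a (st a))"
    and trace_faithful: "a \<in> A \<Longrightarrow> \<tau> (mul a (st a)) = 0 \<Longrightarrow> mul a (st a) = 0"
begin

notation mul (infixl "\<cdot>" 70)

lemma zero_closed [simp]: "0 \<in> A" and add_closed [simp]: "a \<in> A \<Longrightarrow> b \<in> A \<Longrightarrow> a + b \<in> A"
  and diff_closed [simp]: "a \<in> A \<Longrightarrow> b \<in> A \<Longrightarrow> a - b \<in> A"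
  and minus_closed [simp]: "a \<in> A \<Longrightarrow> - a \<in> A"
  and scl_closed [simp]: "a \<in> A \<Longrightarrow> scl r a \<in> A"
  using subspace_carrier
  by (simp_all add: subspace_0 subspace_add subspace_diff subspace_neg subspace_scale)

declare mul_closed [simp] unit_closed [simp] st_closed [simp] unit_left [simp] unit_right [simp] st_st [simp]

lemma mul_zero_left [simp]: "a \<in> A \<Longrightarrow> 0 \<cdot> a = 0"
  using mul_scl_left[of 0 a 0] by simp

lemma mul_zero_right [simp]: "a \<in> A \<Longrightarrow> a \<cdot> 0 = 0"
  using mul_scl_right[of a 0 0] by simp

lemma mul_diff_left: "a \<in> A \<Longrightarrow> b \<in> A \<Longrightarrow> c \<in> A \<Longrightarrow> (a - b) \<cdot> c = a \<cdot> c - b \<cdot> c"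
  using mul_add_left[of "a - b" b c] by (simp add: algebra_simps)

lemma mul_diff_right: "a \<in> A \<Longrightarrow> b \<in> A \<Longrightarrow> c \<in> A \<Longrightarrow> c \<cdot> (a - b) = c \<cdot> a - c \<cdot> b"
  using mul_add_right[of c "a - b" b] by (simp add: algebra_simps)

lemma st_zero [simp]: "st 0 = 0"
  using st_scl[of 0 0] by simp

lemma st_diff: "a \<in> A \<Longrightarrow> b \<in> A \<Longrightarrow> st (a - b) = st a - st b"
  using st_add[of "a - b" b] by (simp add: algebra_simps)

lemma st_unit [simp]: "st u = u"
proof -
  have "st u = u \<cdot> st u" by simp
  also have "\<dots> = st (st u) \<cdot> st u" by simp
  also have "\<dots> = st (u \<cdot> st u)" by (simp only: st_mul unit_closed st_closed)
  finally show ?thesis by simp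
qed

text \<open>The norm enters the algebra through this consequence of the C*-identity.\<close>

lemma st_mul_self_eq_0: "a \<in> A \<Longrightarrow> st a \<cdot> a = 0 \<Longrightarrow> a = 0"
proof -
  assume a: "a \<in> A" "st a \<cdot> a = 0"
  obtain nrm :: "'a \<Rightarrow> real" where n: "\<forall>a\<in>A. 0 \<le> nrm a \<and> (nrm a = 0 \<longleftrightarrow> a = 0)"
    "\<forall>a\<in>A. nrm (st a \<cdot> a) = (nrm a)\<^sup>2"
    using cstar_norm by (elim exE conjE) (rule that)
  have "(nrm a)\<^sup>2 = nrm (st a \<cdot> a)" using n(2) a(1) by simp
  also have "\<dots> = nrm 0" using a(2) by simp
  also have "\<dots> = 0" using n(1) by simp
  finally show "a = 0" using n(1) a(1) by simp
qed

lemma mul_st_self_eq_0: "a \<in> A \<Longrightarrow> a \<cdot> st a = 0 \<Longrightarrow> a = 0"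
  using st_mul_self_eq_0[of "st a"] by (metis st_closed st_st st_zero)

lemma trace_zero [simp]: "\<tau> 0 = 0"
  using trace_scl[of 0 0] by simp

lemma trace_diff: "a \<in> A \<Longrightarrow> b \<in> A \<Longrightarrow> \<tau> (a - b) = \<tau> a - \<tau> b"
  using trace_add[of "a - b" b] by simp

definition pos :: "'a \<Rightarrow> bool" where
  "pos x \<longleftrightarrow> (\<exists>a\<in>A. x = a \<cdot> st a)"

definition proj :: "'a \<Rightarrow> bool" where
  "proj p \<longleftrightarrow> p \<in> A \<and> p \<cdot> p = p \<and> st p = p"

lemma pos_closed [simp]: "pos x \<Longrightarrow> x \<in> A"
  by (auto simp: pos_def)

lemma pos_self_adjoint: "pos x \<Longrightarrow> st x = x"
  by (auto simp: pos_def st_mul)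

lemma pos_st_mul: "a \<in> A \<Longrightarrow> pos (st a \<cdot> a)"
  unfolding pos_def by (rule bexI[of _ "st a"]) auto

lemma proj_closed [simp]: "proj p \<Longrightarrow> p \<in> A"
  by (simp add: proj_def)

lemma proj_idem [simp]: "proj p \<Longrightarrow> p \<cdot> p = p" and proj_st [simp]: "proj p \<Longrightarrow> st p = p"
  by (simp_all add: proj_def)

lemma proj_pos: "proj p \<Longrightarrow> pos p"
  unfolding pos_def proj_def by (rule bexI[of _ p]) auto

lemma proj_unit: "proj u" and proj_zero: "proj 0"
  by (simp_all add: proj_def)

lemma proj_compl:
  assumes "proj p"
  shows "proj (u - p)"
proof -
  have p: "p \<in> A" "p \<cdot> p = p" "st p = p" using assms by simp_all
  then have "(u - p) \<cdot> (u - p) = u - p" by (simp add: mul_diff_left mul_diff_right)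
  with p show ?thesis unfolding proj_def by (simp add: st_diff)
qed

lemma pos_trace: "pos x \<Longrightarrow> 0 \<le> \<tau> x"
  by (auto simp: pos_def trace_nonneg)

lemma pos_trace_eq_0: "pos x \<Longrightarrow> \<tau> x = 0 \<Longrightarrow> x = 0"
  by (auto simp: pos_def trace_faithful)

lemma pos_trace_real: "pos x \<Longrightarrow> cnj (\<tau> x) = \<tau> x"
  using pos_trace[of x] by (auto simp: less_eq_complex_def complex_eq_iff)

text \<open>Polarization: \<open>4 h = (h + 1)\<^sup>2 - (h - 1)\<^sup>2\<close>.\<close>

lemma trace_self_adjoint_real:
  assumes "h \<in> A" "st h = h"
  shows "cnj (\<tau> h) = \<tau> h"
proof -
  have p: "pos ((h + u) \<cdot> (h + u))" "pos ((h - u) \<cdot> (h - u))"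
    using pos_st_mul[of "h + u"] pos_st_mul[of "h - u"] assms by (simp_all add: st_add st_diff)
  have "(h + u) \<cdot> (h + u) - (h - u) \<cdot> (h - u) = h + h + (h + h)"
    using assms by (simp add: mul_add_left mul_add_right mul_diff_left mul_diff_right algebra_simps)
  then have "\<tau> ((h + u) \<cdot> (h + u)) - \<tau> ((h - u) \<cdot> (h - u)) = 4 * \<tau> h"
    using assms by (simp add: trace_diff[symmetric] trace_add)
  moreover have "cnj (\<tau> ((h + u) \<cdot> (h + u)) - \<tau> ((h - u) \<cdot> (h - u))) =
      \<tau> ((h + u) \<cdot> (h + u)) - \<tau> ((h - u) \<cdot> (h - u))"
    using p by (simp add: pos_trace_real)
  ultimately show ?thesis by simp
qed

text \<open>The self-adjoint combinations a + \<open>st a\<close> and \<i> (a - \<open>st a\<close>)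
  have real traces, and together these two facts say that the traces of a and \<open>st a\<close>
  are conjugate.\<close>

lemma trace_st:
  assumes a: "a \<in> A"
  shows "\<tau> (st a) = cnj (\<tau> a)"
proof -
  define b where "b = a + st a"
  define c where "c = scl \<i> (a - st a)"
  have bc: "b \<in> A" "c \<in> A" "st b = b" "st c = c"
    using a by (auto simp: b_def c_def st_add st_scl st_diff add.commute scale_right_diff_distrib)
  have "\<tau> b = \<tau> a + \<tau> (st a)" "\<tau> c = \<i> * (\<tau> a - \<tau> (st a))"
    using a by (simp_all add: b_def c_def trace_add trace_scl trace_diff)
  with trace_self_adjoint_real[OF bc(1,3)] trace_self_adjoint_real[OF bc(2,4)]
  show ?thesis by (auto simp: complex_eq_iff)
qed

section \<open>Functional calculus\<close>

definition peval :: "'a \<Rightarrow> complex poly \<Rightarrow> 'a" where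
  "peval a p = fold_coeffs (\<lambda>c b. scl c u + a \<cdot> b) p 0"

lemma peval_0 [simp]: "peval a 0 = 0"
  by (simp add: peval_def)

lemma peval_pCons [simp]: "a \<in> A \<Longrightarrow> peval a (pCons c p) = scl c u + a \<cdot> peval a p"
  by (cases "c = 0 \<and> p = 0") (auto simp: peval_def)

lemma peval_closed [simp]: "a \<in> A \<Longrightarrow> peval a p \<in> A"
  by (induction p) auto

lemma peval_add: "a \<in> A \<Longrightarrow> peval a (p + q) = peval a p + peval a q"
  by (induction p q rule: poly_induct2) (simp_all add: scale_left_distrib mul_add_right algebra_simps)

lemma peval_smult: "a \<in> A \<Longrightarrow> peval a (smult c p) = scl c (peval a p)"
  by (induction p) (simp_all add: scale_right_distrib mul_scl_right)

lemma peval_diff: "a \<in> A \<Longrightarrow> peval a (p - q) = peval a p - peval a q"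
  using peval_add[of a "p - q" q] by (simp add: algebra_simps)

lemma peval_mult: "a \<in> A \<Longrightarrow> peval a (p * q) = peval a p \<cdot> peval a q"
  by (induction p) (simp_all add: peval_add peval_smult mul_add_left mul_scl_left mul_assoc)

lemma peval_sum: "a \<in> A \<Longrightarrow> peval a (sum f I) = (\<Sum>i\<in>I. peval a (f i))"
  by (induction I rule: infinite_finite_induct) (simp_all add: peval_add)

lemma peval_1 [simp]: "a \<in> A \<Longrightarrow> peval a 1 = u"
  by (simp add: one_pCons)

lemma st_peval:
  assumes "a \<in> A" "st a = a"
  shows "st (peval a p) = peval a (map_poly cnj p)"
proof (induction p)
  case (pCons c p)
  have "peval a q \<cdot> a = a \<cdot> peval a q" for q
    using peval_mult[of a "[:0, 1:]" q] peval_mult[of a q "[:0, 1:]"] assms(1)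
    by (simp add: mult.commute)
  moreover have "map_poly cnj (pCons c p) = pCons (cnj c) (map_poly cnj p)"
    by (simp add: map_poly_pCons)
  ultimately show ?case using assms pCons by (simp add: st_add st_scl st_mul)
qed simp

text \<open>The powers of a with exponents 0 to \<open>card F\<close> are too many to be
  independent. Coinciding powers are a separate case because dependence is a property of the set of
  powers.\<close>

lemma ex_annihilating_poly:
  assumes a: "a \<in> A"
  shows "\<exists>m. m \<noteq> 0 \<and> peval a m = 0"
proof -
  obtain F where F: "finite F" "span F = A" using fin_dim by blast
  define pw where "pw i = peval a (monom 1 i)" for i
  let ?I = "{..card F}"
  show ?thesis
  proof (cases "inj_on pw ?I")
    case False
    then obtain i j where "i \<noteq> j" "pw i = pw j" by (auto simp: inj_on_def)
    then show ?thesis using a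
      by (intro exI[of _ "monom 1 i - monom 1 j"]) (auto simp: peval_diff pw_def monom_eq_iff')
  next
    case True
    have "pw ` ?I \<subseteq> span F" unfolding F(2) using a by (auto simp: pw_def)
    moreover have "card (pw ` ?I) = Suc (card F)" using True by (simp add: card_image)
    ultimately have "dependent (pw ` ?I)"
      using independent_span_bound[OF F(1), of "pw ` ?I"] by auto
    then obtain f v where v: "v \<in> pw ` ?I" "f v \<noteq> 0" "(\<Sum>v\<in>pw ` ?I. scl (f v) v) = 0"
      by (auto simp: dependent_finite)
    define m where "m = (\<Sum>i\<in>?I. monom (f (pw i)) i)"
    have "peval a (monom c i) = scl c (pw i)" for c i
      using peval_smult[OF a, of c "monom 1 i"] by (simp add: smult_monom pw_def)
    then have "peval a m = (\<Sum>v\<in>pw ` ?I. scl (f v) v)"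
      using a True by (simp add: m_def peval_sum sum.reindex)
    moreover obtain i where "i \<in> ?I" "v = pw i" using v(1) by blast
    then have "coeff m i \<noteq> 0" using v(2) by (simp add: m_def coeff_sum)
    ultimately show ?thesis using v(3) by (intro exI[of _ m]) auto
  qed
qed

text \<open>
  The minimal polynomial \<open>m\<close> of a self-adjoint element has simple real roots: if
  \<open>m = (X - z) q\<close>, then \<open>b = q(a) \<noteq> 0\<close> satisfies \<open>a b = z b\<close>, so \<open>z b\<^sup>* b\<close> is self-adjoint; and if
  \<open>m = (X - z)\<^sup>2 r\<close>, then \<open>c = (a - z) r(a)\<close> satisfies \<open>c\<^sup>* c = 0\<close>.
\<close>

lemma ex_spectrum:
  assumes a: "a \<in> A" "st a = a"
  shows "\<exists>S. finite S \<and> (\<forall>z\<in>S. cnj z = z) \<and> (\<forall>p. peval a p = 0 \<longleftrightarrow> (\<forall>z\<in>S. poly p z = 0))"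
proof -
  obtain m where m: "m \<noteq> 0" "peval a m = 0"
    and min: "\<And>q. q \<noteq> 0 \<Longrightarrow> peval a q = 0 \<Longrightarrow> degree m \<le> degree q"
    using ex_has_least_nat[of "\<lambda>m. m \<noteq> 0 \<and> peval a m = 0" _ degree] ex_annihilating_poly[OF a(1)]
    by blast
  define S where "S = {z. poly m z = 0}"
  have fin: "finite S" unfolding S_def using m(1) by (rule poly_roots_finite)
  have dvd: "m dvd p" if "peval a p = 0" for p
  proof -
    have "peval a (p mod m) = peval a p - peval a (p div m) \<cdot> peval a m"
      using a(1) by (simp add: peval_diff[symmetric] peval_mult[symmetric] minus_div_mult_eq_mod)
    then have "peval a (p mod m) = 0" using that m(2) a(1) by simp
    then have "p mod m = 0"
      using min[of "p mod m"] degree_mod_less[OF m(1), of p] by fastforce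
    then show ?thesis by (simp add: dvd_eq_mod_eq_0)
  qed
  have root: "cnj z = z \<and> (\<exists>q. m = [:-z, 1:] * q \<and> poly q z \<noteq> 0)" if z: "z \<in> S" for z
  proof -
    obtain q where q: "m = [:-z, 1:] * q" using z by (auto simp: S_def poly_eq_0_iff_dvd)
    have q0: "q \<noteq> 0" using m(1) q by auto
    have "degree m = degree [:-z, 1:] + degree q"
      unfolding q by (rule degree_mult_eq) (use q0 in auto)
    then have "degree m = Suc (degree q)" by simp
    then have b0: "peval a q \<noteq> 0" using min[OF q0] by fastforce
    define b where "b = peval a q"
    have b: "b \<in> A" "b \<noteq> 0" using a b0 by (auto simp: b_def)
    have "(a - scl z u) \<cdot> b = 0"
      using m(2) a(1) unfolding q b_def peval_mult[OF a(1)] by simp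
    then have ab: "a \<cdot> b = scl z b"
      using a(1) b(1) by (simp add: mul_diff_left mul_scl_left)
    have "st (st b \<cdot> (a \<cdot> b)) = st b \<cdot> (a \<cdot> b)"
      using a b(1) by (simp add: st_mul mul_assoc)
    then have "scl (cnj z) (st b \<cdot> b) = scl z (st b \<cdot> b)"
      using b(1) by (simp add: ab mul_scl_right st_scl st_mul mul_scl_left)
    moreover have "st b \<cdot> b \<noteq> 0" using st_mul_self_eq_0[OF b(1)] b(2) by blast
    ultimately have cz: "cnj z = z" by (simp add: scale_right_imp_eq)
    have "poly q z \<noteq> 0"
    proof
      assume "poly q z = 0"
      then obtain r where r: "q = [:-z, 1:] * r" by (auto simp: poly_eq_0_iff_dvd)
      have X: "map_poly cnj ([:-z, 1:] * r) = [:-z, 1:] * map_poly cnj r"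
        using cz by (intro poly_eqI) (simp add: coeff_map_poly mult_pCons_left coeff_pCons split: nat.splits)
      have "st b = peval a ([:-z, 1:] * map_poly cnj r)"
        unfolding b_def st_peval[OF a] r X ..
      moreover have "b = peval a ([:-z, 1:] * r)" by (simp only: b_def r)
      ultimately have "st b \<cdot> b = peval a (([:-z, 1:] * map_poly cnj r) * ([:-z, 1:] * r))"
        by (simp only: peval_mult[OF a(1)])
      also have "\<dots> = peval a (map_poly cnj r * m)" by (simp only: q r mult_ac)
      also have "\<dots> = 0" using m(2) a(1) by (simp add: peval_mult)
      finally show False using st_mul_self_eq_0[OF b(1)] b(2) by blast
    qed
    with cz q show ?thesis by blast
  qed
  have "rsquarefree m"
    unfolding rsquarefree_roots
  proof clarify
    fix z assume "poly m z = 0" "poly (pderiv m) z = 0"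
    moreover obtain q where "m = [:-z, 1:] * q" "poly q z \<noteq> 0"
      using root[of z] \<open>poly m z = 0\<close> by (auto simp: S_def)
    ultimately show False by (auto simp: pderiv_pCons pderiv_diff pderiv_smult)
  qed
  then have "m = smult (lead_coeff m) (\<Prod>z\<in>S. [:-z, 1:])"
    unfolding S_def by (rule complex_poly_decompose_rsquarefree[symmetric])
  then have "degree m = degree (smult (lead_coeff m) (\<Prod>z\<in>S. [:-z, 1:]))" by simp
  also have "\<dots> = card S" using m(1) by (simp add: degree_prod_sum_eq)
  finally have deg: "degree m = card S" .
  have "peval a p = 0 \<longleftrightarrow> (\<forall>z\<in>S. poly p z = 0)" for p
  proof
    assume "peval a p = 0"
    then show "\<forall>z\<in>S. poly p z = 0" using dvd[of p] by (auto simp: S_def)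
  next
    assume p: "\<forall>z\<in>S. poly p z = 0"
    have "p mod m = 0"
    \<comment> \<open>A nonzero remainder would vanish at all \<open>card S\<close> points, against
      its degree.\<close>
    proof (rule ccontr)
      assume r: "p mod m \<noteq> 0"
      have "S \<subseteq> {z. poly (p mod m) z = 0}"
        using p by (auto simp: S_def minus_div_mult_eq_mod[symmetric])
      then have "card S \<le> degree (p mod m)"
        using card_poly_roots_bound[OF r] poly_roots_finite[OF r] by (meson card_mono order_trans)
      then show False using degree_mod_less[OF m(1), of p] r deg by auto
    qed
    then obtain q where "p = q * m" by (metis dvdE mod_0_imp_dvd mult.commute)
    then show "peval a p = 0" using m(2) a(1) by (simp add: peval_mult)
  qed
  then show ?thesis using fin root by blast
qed

text \<open>\<open>F f\<close> is f(a), for an arbitrary function f on the finite spectrum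
  \<open>S\<close>. As a predicate on \<open>S\<close> and \<open>F\<close> it hides the
  interpolating polynomials; the clause on \<open>F f = 0\<close> makes \<open>S\<close> exactly the
  spectrum.\<close>

definition calculus :: "'a \<Rightarrow> complex set \<Rightarrow> ((complex \<Rightarrow> complex) \<Rightarrow> 'a) \<Rightarrow> bool" where
  "calculus a S F \<longleftrightarrow> finite S \<and> (\<forall>z\<in>S. cnj z = z) \<and> (\<forall>f. F f \<in> A) \<and>
    (\<forall>f. F f = 0 \<longleftrightarrow> (\<forall>z\<in>S. f z = 0)) \<and>
    (\<forall>f g. (\<forall>z\<in>S. f z = g z) \<longrightarrow> F f = F g) \<and>
    (\<forall>f g. F (\<lambda>z. f z * g z) = F f \<cdot> F g) \<and> (\<forall>f g. F (\<lambda>z. f z - g z) = F f - F g) \<and>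
    (\<forall>f c. F (\<lambda>z. c * f z) = scl c (F f)) \<and> (\<forall>f. st (F f) = F (\<lambda>z. cnj (f z))) \<and>
    F (\<lambda>z. z) = a"

lemma calculusD:
  assumes "calculus a S F"
  shows "finite S" "z \<in> S \<Longrightarrow> cnj z = z" "F f \<in> A" "F f = 0 \<longleftrightarrow> (\<forall>z\<in>S. f z = 0)"
    "(\<And>z. z \<in> S \<Longrightarrow> f z = g z) \<Longrightarrow> F f = F g"
    "F (\<lambda>z. f z * g z) = F f \<cdot> F g" "F (\<lambda>z. f z - g z) = F f - F g"
    "F (\<lambda>z. c * f z) = scl c (F f)" "st (F f) = F (\<lambda>z. cnj (f z))" "F (\<lambda>z. z) = a"
  using assms[unfolded calculus_def] by (elim conjE, simp)+

text \<open>The polynomials annihilating a are those that vanish on \<open>S\<close>, so any two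
  polynomials interpolating f give the same element. The homomorphism rules follow by choosing a
  convenient interpolant.\<close>

lemma ex_calculus:
  assumes a: "a \<in> A" "st a = a"
  shows "\<exists>S F. calculus a S F"
proof -
  obtain S where S: "finite S" "\<forall>z\<in>S. cnj z = z"
    "\<forall>p. peval a p = 0 \<longleftrightarrow> (\<forall>z\<in>S. poly p z = 0)"
    using ex_spectrum[OF a] by (elim exE conjE) (rule that)
  define P where "P f = (SOME p. \<forall>z\<in>S. poly p z = f z)" for f
  define F where "F f = peval a (P f)" for f
  have P: "z \<in> S \<Longrightarrow> poly (P f) z = f z" for f z
    using someI_ex[OF complex_interpolation[OF S(1), of f]] by (auto simp: P_def)
  have F: "F f = peval a p" if "\<And>z. z \<in> S \<Longrightarrow> poly p z = f z" for f p
  proof -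
    have "peval a (P f - p) = 0" using S(3) that P by simp
    then show ?thesis using a(1) by (simp add: F_def peval_diff)
  qed
  have "calculus a S F"
    unfolding calculus_def
  proof (intro conjI allI impI)
    show "F f = F g" if "\<forall>z\<in>S. f z = g z" for f g
      unfolding F_def[of g] by (rule F) (simp add: P that)
    show "F (\<lambda>z. f z * g z) = F f \<cdot> F g" for f g
      unfolding F_def[of f] F_def[of g] peval_mult[OF a(1), symmetric] by (rule F) (simp add: P)
    show "F (\<lambda>z. f z - g z) = F f - F g" for f g
      unfolding F_def[of f] F_def[of g] peval_diff[OF a(1), symmetric] by (rule F) (simp add: P)
    show "F (\<lambda>z. c * f z) = scl c (F f)" for f c
      unfolding F_def[of f] peval_smult[OF a(1), symmetric] by (rule F) (simp add: P)
    show "st (F f) = F (\<lambda>z. cnj (f z))" for f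
      unfolding F_def[of f] st_peval[OF a]
    proof (rule F[symmetric])
      fix z assume z: "z \<in> S"
      then have "poly (map_poly cnj (P f)) z = cnj (poly (P f) z)"
        unfolding poly_cnj using bspec[OF S(2) z] by (simp only:)
      then show "poly (map_poly cnj (P f)) z = cnj (f z)" using P z by simp
    qed
    show "F (\<lambda>z. z) = a"
      using F[of "[:0, 1:]" "\<lambda>z. z"] a(1) by simp
    show "(F f = 0) = (\<forall>z\<in>S. f z = 0)" for f
    proof -
      have "F f = 0 \<longleftrightarrow> (\<forall>z\<in>S. poly (P f) z = 0)" unfolding F_def using S(3) by (rule allE)
      then show ?thesis using P by simp
    qed
    show "F f \<in> A" for f using a(1) by (simp add: F_def)
  qed (use S in simp_all)
  then show ?thesis by blast
qed

context
  fixes a S and F :: "(complex \<Rightarrow> complex) \<Rightarrow> 'a"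
  assumes F: "calculus a S F"
begin

lemma calculus_pos:
  assumes f: "\<And>z. z \<in> S \<Longrightarrow> 0 \<le> f z"
  shows "pos (F f)"
proof -
  let ?g = "\<lambda>z. complex_of_real (sqrt (Re (f z)))"
  have "F f = F (\<lambda>z. ?g z * cnj (?g z))"
  proof (rule calculusD(5)[OF F])
    fix z assume "z \<in> S"
    then have "0 \<le> Re (f z)" "Im (f z) = 0" using f by (auto simp: less_eq_complex_def)
    then show "f z = ?g z * cnj (?g z)" by (simp add: complex_eq_iff)
  qed
  also have "\<dots> = F ?g \<cdot> st (F ?g)" unfolding calculusD(9)[OF F] by (rule calculusD(6)[OF F])
  finally show ?thesis unfolding pos_def using calculusD(3)[OF F] by blast
qed

lemma calculus_proj: "proj (F (\<lambda>z. if z \<in> X then 1 else 0))"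
  unfolding proj_def calculusD(9)[OF F] calculusD(6)[OF F, symmetric]
  by (intro conjI calculusD(3,5)[OF F]) auto

text \<open>The indicator of one spectral point is a nonzero projection q with a q = z q. Traces
  against projections therefore detect every point of the spectrum.\<close>

lemma calculus_eigenprojection:
  assumes z: "z \<in> S"
  shows "\<exists>q t. proj q \<and> 0 < t \<and> \<tau> (a \<cdot> q) = z * t"
proof -
  let ?q = "F (\<lambda>w. if w \<in> {z} then 1 else 0)"
  have q: "proj ?q" by (rule calculus_proj)
  have "?q \<noteq> 0" using z unfolding calculusD(4)[OF F] by auto
  then have "\<tau> ?q \<noteq> 0" using pos_trace_eq_0[OF proj_pos[OF q]] by blast
  then have "0 < \<tau> ?q" using pos_trace[OF proj_pos[OF q]] by (metis order_le_less)
  moreover have "a \<cdot> ?q = scl z ?q"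
  proof -
    have "F (\<lambda>w. w * (if w \<in> {z} then 1 else 0)) = F (\<lambda>w. z * (if w \<in> {z} then 1 else 0))"
      by (rule calculusD(5)[OF F]) auto
    then show ?thesis unfolding calculusD(8)[OF F] unfolding calculusD(6,10)[OF F] .
  qed
  then have "\<tau> (a \<cdot> ?q) = z * \<tau> ?q" using q by (simp only: trace_scl proj_closed)
  ultimately show ?thesis using q by blast
qed

lemma calculus_spectrum_nonneg:
  assumes z: "z \<in> S" and nn: "\<And>q. proj q \<Longrightarrow> 0 \<le> \<tau> (a \<cdot> q)"
  shows "0 \<le> z"
proof -
  obtain p t where t: "proj p" "0 < t" "\<tau> (a \<cdot> p) = z * t"
    using calculus_eigenprojection[OF z] by blast
  have "Im t = 0" "0 < Re t" using t(2) by (auto simp: less_complex_def)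
  moreover have "Im z = 0" using calculusD(2)[OF F z] by (auto simp: complex_eq_iff)
  moreover have "0 \<le> z * t" using nn[OF t(1)] t(3) by simp
  ultimately show ?thesis by (auto simp: less_eq_complex_def zero_le_mult_iff)
qed

end

text \<open>Write a and b as c and d times their adjoints. By cyclicity the trace of a b is that of
  k times its adjoint for k = \<open>st d \<cdot> c\<close>, and k = 0 kills the product.\<close>

lemma pos_trace_mul_nonneg:
  assumes "pos a" "pos b"
  shows "0 \<le> \<tau> (a \<cdot> b)" and "\<tau> (a \<cdot> b) = 0 \<Longrightarrow> a \<cdot> b = 0"
proof -
  obtain c d where cd: "c \<in> A" "d \<in> A" "a = c \<cdot> st c" "b = d \<cdot> st d"
    using assms by (auto simp: pos_def)
  have "a \<cdot> b = (c \<cdot> st c \<cdot> d) \<cdot> st d" using cd by (simp add: mul_assoc)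
  then have "\<tau> (a \<cdot> b) = \<tau> (st d \<cdot> (c \<cdot> st c \<cdot> d))" using cd by (simp add: trace_comm)
  also have "st d \<cdot> (c \<cdot> st c \<cdot> d) = (st d \<cdot> c) \<cdot> st (st d \<cdot> c)"
    using cd by (simp add: mul_assoc st_mul)
  finally have eq: "\<tau> (a \<cdot> b) = \<tau> ((st d \<cdot> c) \<cdot> st (st d \<cdot> c))" .
  then show "0 \<le> \<tau> (a \<cdot> b)" using cd by (simp add: trace_nonneg)
  show "a \<cdot> b = 0" if "\<tau> (a \<cdot> b) = 0"
  proof -
    have dc: "st d \<cdot> c \<in> A" using cd(1,2) by simp
    have "st d \<cdot> c = 0"
      by (rule mul_st_self_eq_0[OF dc], rule trace_faithful[OF dc], rule trans[OF eq[symmetric] that])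
    then have "st (st d \<cdot> c) = 0" by simp
    then have "st c \<cdot> d = 0" using cd by (simp add: st_mul)
    moreover have "a \<cdot> b = c \<cdot> (st c \<cdot> d) \<cdot> st d" using cd by (simp add: mul_assoc)
    ultimately show ?thesis using cd by simp
  qed
qed

text \<open>Real traces against projections leave \<i> (h - \<open>st h\<close>) with spectrum 0, so
  h is self-adjoint; its own eigenprojections then show that the spectrum is nonnegative. This is
  the form in which positivity can be read off from closed diagrams.\<close>

lemma posI:
  assumes h: "h \<in> A" and q: "\<And>q. proj q \<Longrightarrow> 0 \<le> \<tau> (h \<cdot> q)"
  shows "pos h"
proof -
  have "st h = h"
  proof -
    define k where "k = scl \<i> (h - st h)"
    have k: "k \<in> A" "st k = k"
      using h by (auto simp: k_def st_scl st_diff scale_right_diff_distrib)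
    have kq: "\<tau> (k \<cdot> q) = 0" if "proj q" for q
    proof -
      have q: "q \<in> A" "st q = q" using that by simp_all
      have "\<tau> (st h \<cdot> q) = \<tau> (st (q \<cdot> h))" using q h by (simp add: st_mul)
      also have "\<dots> = cnj (\<tau> (q \<cdot> h))" using q h by (simp add: trace_st)
      also have "\<dots> = cnj (\<tau> (h \<cdot> q))" using q h by (simp add: trace_comm)
      also have "\<dots> = \<tau> (h \<cdot> q)"
        using assms(2)[OF that] by (auto simp: less_eq_complex_def complex_eq_iff)
      finally show ?thesis
        using q h by (simp add: k_def mul_scl_left mul_diff_left trace_scl trace_diff)
    qed
    obtain S F where F: "calculus k S F" using ex_calculus[OF k] by blast
    have "z = 0" if "z \<in> S" for z using calculus_eigenprojection[OF F that] kq by force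
    then have "k = 0" using calculusD(4)[OF F, of "\<lambda>z. z"] calculusD(10)[OF F] by simp
    then have "h - st h = 0" by (simp add: k_def)
    then show ?thesis by simp
  qed
  then obtain S F where F: "calculus h S F" using ex_calculus[OF h] by blast
  have "pos (F (\<lambda>z. z))"
    by (rule calculus_pos[OF F]) (rule calculus_spectrum_nonneg[OF F _ q])
  then show ?thesis using calculusD(10)[OF F] by simp
qed

lemma pos_zero [simp]: "pos 0"
  using proj_pos proj_zero by blast

text \<open>The trace test is additive, whereas the factorization that defines \<open>pos\<close> is
  not.\<close>

lemma pos_add: "pos x \<Longrightarrow> pos y \<Longrightarrow> pos (x + y)"
  by (rule posI) (simp_all add: mul_add_left trace_add pos_trace_mul_nonneg(1) proj_pos)

lemma pos_scl: "pos x \<Longrightarrow> 0 \<le> (r::real) \<Longrightarrow> pos (scl (of_real r) x)"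
  using pos_trace_mul_nonneg(1)[of x] proj_pos
  by (intro posI) (auto simp: mul_scl_left trace_scl less_eq_complex_def)

lemma pos_sum: "(\<And>i. i \<in> I \<Longrightarrow> pos (f i)) \<Longrightarrow> pos (sum f I)"
  by (induction I rule: infinite_finite_induct) (simp_all add: pos_add)

definition le :: "'a \<Rightarrow> 'a \<Rightarrow> bool" where
  "le x y \<longleftrightarrow> pos (y - x)"

lemma le_trans: "le x y \<Longrightarrow> le y z \<Longrightarrow> le x z"
  unfolding le_def using pos_add[of "z - y" "y - x"] by simp

lemma le_antisym: "le x y \<Longrightarrow> le y x \<Longrightarrow> x = y"
proof -
  assume h: "le x y" "le y x"
  have "\<tau> (x - y) = - \<tau> (y - x)" using h trace_diff[of 0 "y - x"] by (simp add: le_def)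
  then have "\<tau> (y - x) = 0" using pos_trace[of "y - x"] pos_trace[of "x - y"] h
    by (auto simp: le_def less_eq_complex_def complex_eq_iff)
  then show "x = y" using pos_trace_eq_0[of "y - x"] h by (simp add: le_def)
qed

lemma le_scl: "le x y \<Longrightarrow> 0 \<le> (r::real) \<Longrightarrow> le (scl (of_real r) x) (scl (of_real r) y)"
  using pos_scl by (simp add: le_def scale_right_diff_distrib[symmetric])

lemma le_trace_mono:
  assumes "le x y" "pos z" "x \<in> A" "y \<in> A"
  shows "\<tau> (x \<cdot> z) \<le> \<tau> (y \<cdot> z)"
  using pos_trace_mul_nonneg(1)[of "y - x" z] assms
  by (simp add: le_def mul_diff_left trace_diff)

text \<open>If e \<le> f, the trace of e (u - f) lies between 0 and the trace of f (u - f) = 0, so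
  the product vanishes.\<close>

lemma proj_le_iff:
  assumes "proj e" "proj f"
  shows "le e f \<longleftrightarrow> f \<cdot> e = e"
proof
  assume fe: "f \<cdot> e = e"
  have "st (f \<cdot> e) = st e" by (simp add: fe)
  then have ef: "e \<cdot> f = e" using assms by (simp add: st_mul)
  have "proj (f - e)"
    unfolding proj_def using assms fe ef by (simp add: mul_diff_left mul_diff_right st_diff)
  then show "le e f" unfolding le_def by (rule proj_pos)
next
  assume "le e f"
  let ?g = "u - f"
  have g: "pos ?g" using assms(2) by (intro proj_pos proj_compl)
  have "f \<cdot> ?g = 0" using assms by (auto simp: mul_diff_right)
  then have "\<tau> (e \<cdot> ?g) = 0"
    using le_trace_mono[OF \<open>le e f\<close> g] pos_trace_mul_nonneg(1)[OF proj_pos[OF assms(1)] g] assms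
    by auto
  then have "e \<cdot> ?g = 0" by (rule pos_trace_mul_nonneg(2)[OF proj_pos[OF assms(1)] g])
  then have "e \<cdot> f = e" using assms by (simp add: mul_diff_right)
  then have "st (e \<cdot> f) = st e" by simp
  then show "f \<cdot> e = e" using assms by (simp add: st_mul)
qed

lemma le_unit: "proj e \<Longrightarrow> le e u"
  using proj_le_iff proj_unit by simp

section \<open>Range projections\<close>

definition supp :: "'a \<Rightarrow> 'a" where
  "supp a = (THE e. proj e \<and> e \<cdot> a = a \<and> (\<forall>f. proj f \<longrightarrow> f \<cdot> a = a \<longrightarrow> le e f))"

text \<open>The support e is the indicator of the nonzero spectrum and f inverts a there. Since a is
  bounded above, and below away from 0 on its support, a and e dominate each other up to the
  constant l.\<close>

lemma ex_supp:
  assumes "pos a"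
  shows "\<exists>e f (l::real). proj e \<and> e \<cdot> a = a \<and> f \<in> A \<and> e = a \<cdot> f \<and> e = f \<cdot> a \<and>
    0 < l \<and> le a (scl (of_real l) e) \<and> le e (scl (of_real l) a)"
proof -
  have a: "a \<in> A" "st a = a" using assms by (simp_all add: pos_self_adjoint)
  obtain S F where "calculus a S F" using ex_calculus[OF a] by blast
  note F = calculusD[OF this] calculus_pos[OF this] calculus_proj[OF this]
  have nn: "Im z = 0 \<and> 0 \<le> Re z" if "z \<in> S" for z
    using calculus_spectrum_nonneg[OF \<open>calculus a S F\<close> that pos_trace_mul_nonneg(1)[OF assms proj_pos]]
    by (simp add: less_eq_complex_def)
  let ?chi = "\<lambda>z. if z \<in> - {0} then 1 else 0 :: complex" and ?inv = "\<lambda>z. if z = 0 then 0 else 1 / z :: complex"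
  \<comment> \<open>Bounds z and 1 / z simultaneously on the spectrum. Division by zero yields 0, so
    a spectral point 0 does no harm, and the summand 1 keeps l positive when \<open>S\<close> is
    empty.\<close>
  define l where "l = 1 + (\<Sum>z\<in>S. Re z + 1 / Re z)"
  have bound: "Re z \<le> l \<and> 1 / Re z \<le> l" if "z \<in> S" for z
  proof -
    have "Re z + 1 / Re z \<le> (\<Sum>z\<in>S. Re z + 1 / Re z)"
      using F(1) that nn by (intro member_le_sum) (auto intro: add_nonneg_nonneg)
    moreover have "0 \<le> Re z" "0 \<le> 1 / Re z" using nn[OF that] by auto
    ultimately show ?thesis unfolding l_def by linarith
  qed
  have "0 < l" unfolding l_def using nn by (intro add_pos_nonneg sum_nonneg) (auto intro: add_nonneg_nonneg)
  have "F ?chi \<cdot> a = F (\<lambda>z. ?chi z * z)" using F(6)[of ?chi "\<lambda>z. z"] F(10) by simp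
  also have "\<dots> = F (\<lambda>z. z)" by (rule F(5)) auto
  finally have 1: "F ?chi \<cdot> a = a" using F(10) by simp
  have 2: "F ?chi = a \<cdot> F ?inv"
    using F(6)[of "\<lambda>z. z" ?inv] F(10) F(5)[of ?chi "\<lambda>z. z * ?inv z"] by auto
  have 3: "F ?chi = F ?inv \<cdot> a"
    using F(6)[of ?inv "\<lambda>z. z"] F(10) F(5)[of ?chi "\<lambda>z. ?inv z * z"] by auto
  have "pos (F (\<lambda>z. of_real l * ?chi z - z))"
    using bound nn by (intro F(11)) (auto simp: less_eq_complex_def)
  then have 4: "le a (scl (of_real l) (F ?chi))"
    unfolding le_def F(7) F(8) F(10) .
  have "pos (F (\<lambda>z. of_real l * z - ?chi z))"
  proof (rule F(11))
    fix z assume z: "z \<in> S"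
    have "1 \<le> l * Re z" if "Re z \<noteq> 0"
    proof -
      have "0 < Re z" using nn[OF z] that by simp
      then show ?thesis using bound[OF z] by (simp add: divide_le_eq)
    qed
    then show "0 \<le> of_real l * z - ?chi z"
      using nn[OF z] by (auto simp: less_eq_complex_def complex_eq_iff)
  qed
  then have 5: "le (F ?chi) (scl (of_real l) a)"
    unfolding le_def F(7) F(8) F(10) .
  show ?thesis using F(3) F(12) 1 2 3 4 5 \<open>0 < l\<close> by blast
qed

lemma supp_least:
  assumes e: "proj e" and f: "f \<in> A" "e = a \<cdot> f" and g: "proj g" "g \<cdot> a = a" and a: "a \<in> A"
  shows "le e g"
proof -
  have "g \<cdot> e = (g \<cdot> a) \<cdot> f" using f g(1) a by (simp add: mul_assoc)
  then have "g \<cdot> e = e" using f(2) g(2) by simp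
  then show ?thesis using proj_le_iff[OF e g(1)] by simp
qed

lemma supp_eqI:
  assumes "proj e" "e \<cdot> a = a" "f \<in> A" "e = a \<cdot> f" "a \<in> A"
  shows "supp a = e"
  unfolding supp_def
  using assms supp_least[OF assms(1,3,4) _ _ assms(5)] by (intro the_equality) (auto intro: le_antisym)

lemma supp:
  assumes "pos a"
  shows "proj (supp a)" "supp a \<cdot> a = a" "a \<cdot> supp a = a"
    "\<exists>f\<in>A. supp a = a \<cdot> f \<and> supp a = f \<cdot> a"
    "\<exists>l::real. 0 < l \<and> le a (scl (of_real l) (supp a)) \<and> le (supp a) (scl (of_real l) a)"
    "proj g \<Longrightarrow> g \<cdot> a = a \<Longrightarrow> le (supp a) g"
proof -
  obtain e f l where e: "proj e" "e \<cdot> a = a" "f \<in> A" "e = a \<cdot> f" "e = f \<cdot> a"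
    "0 < (l::real)" "le a (scl (of_real l) e)" "le e (scl (of_real l) a)"
    using ex_supp[OF assms] by blast
  have supp: "supp a = e" using e assms by (intro supp_eqI) auto
  show "proj (supp a)" "supp a \<cdot> a = a" "\<exists>f\<in>A. supp a = a \<cdot> f \<and> supp a = f \<cdot> a"
    "\<exists>l::real. 0 < l \<and> le a (scl (of_real l) (supp a)) \<and> le (supp a) (scl (of_real l) a)"
    using e supp by auto
  have "st (e \<cdot> a) = st a" using e by simp
  then show "a \<cdot> supp a = a" using e(1) assms supp by (simp add: st_mul pos_self_adjoint)
  show "le (supp a) g" if "proj g" "g \<cdot> a = a"
    unfolding supp using e assms that by (intro supp_least[of e f a g]) auto
qed

text \<open>Each of a and \<open>supp a\<close> is a left multiple of the other.\<close>

lemma supp_mul_eq_0: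
  assumes "pos a" "b \<in> A"
  shows "supp a \<cdot> b = 0 \<longleftrightarrow> a \<cdot> b = 0"
proof -
  obtain f where f: "f \<in> A" "supp a = f \<cdot> a" using supp(4)[OF assms(1)] by blast
  have "supp a \<cdot> b = f \<cdot> (a \<cdot> b)" using f assms by (simp add: mul_assoc)
  moreover have "a \<cdot> b = a \<cdot> (supp a \<cdot> b)"
    using supp(1,3)[OF assms(1)] assms by (simp add: mul_assoc[symmetric])
  ultimately show ?thesis using f assms by auto
qed

lemma supp_proj: "proj p \<Longrightarrow> supp p = p"
  by (rule supp_eqI[of p p u]) (auto simp:)

lemma supp_eq_0: "pos a \<Longrightarrow> supp a = 0 \<longleftrightarrow> a = 0"
  using supp(2)[of a] supp_proj[OF proj_zero] by auto

lemma proj_trace_compl: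
  assumes "pos a" "proj q"
  shows "\<tau> (a \<cdot> (u - q)) = 0 \<longleftrightarrow> le (supp a) q"
proof -
  have g: "pos (u - q)" using assms(2) by (intro proj_pos proj_compl)
  have "\<tau> (a \<cdot> (u - q)) = 0 \<longleftrightarrow> a \<cdot> (u - q) = 0"
    using pos_trace_mul_nonneg(2)[OF assms(1) g] by auto
  also have "\<dots> \<longleftrightarrow> supp a \<cdot> (u - q) = 0"
    using assms by (subst supp_mul_eq_0) auto
  also have "\<dots> \<longleftrightarrow> supp a \<cdot> q = supp a"
    using supp(1)[OF assms(1)] assms by (auto simp: mul_diff_right)
  also have "\<dots> \<longleftrightarrow> q \<cdot> supp a = supp a"
  proof -
    have s: "supp a \<in> A" "st (supp a) = supp a" "q \<in> A" "st q = q"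
      using supp(1)[OF assms(1)] assms(2) by auto
    have "st (supp a \<cdot> q) = q \<cdot> supp a" "st (q \<cdot> supp a) = supp a \<cdot> q" using s by (auto simp: st_mul)
    then show ?thesis using s(2) by metis
  qed
  finally show ?thesis using proj_le_iff[OF supp(1)[OF assms(1)] assms(2)] by simp
qed

text \<open>Turns the inequalities with an unspecified constant in \<open>S6\<close> and
  \<open>S9\<close> into the vanishing of one trace. Pairing with u - q gives one direction; a \<le>
  l \<open>supp a\<close> \<le> l q gives the other.\<close>

lemma dominated_by_proj_iff:
  assumes "pos a" "proj q"
  shows "(\<exists>l::real. 0 < l \<and> le a (scl (of_real l) q)) \<longleftrightarrow> \<tau> (a \<cdot> (u - q)) = 0"
proof
  assume "\<exists>l::real. 0 < l \<and> le a (scl (of_real l) q)"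
  then obtain l :: real where l: "le a (scl (of_real l) q)" by blast
  have g: "pos (u - q)" using assms(2) by (intro proj_pos proj_compl)
  have "q \<cdot> (u - q) = 0" using assms by (auto simp: mul_diff_right)
  then show "\<tau> (a \<cdot> (u - q)) = 0"
    using le_trace_mono[OF l g] pos_trace_mul_nonneg(1)[OF assms(1) g] assms
    by (simp add: mul_scl_left)
next
  assume "\<tau> (a \<cdot> (u - q)) = 0"
  then have "le (supp a) q" using proj_trace_compl assms by simp
  moreover obtain l :: real where l: "0 < l" "le a (scl (of_real l) (supp a))"
    using supp(5)[OF assms(1)] by blast
  ultimately have "le a (scl (of_real l) q)"
    using le_trans[OF l(2) le_scl[of "supp a" q l]] by simp
  with l(1) show "\<exists>l::real. 0 < l \<and> le a (scl (of_real l) q)" by blast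
qed

text \<open>For positive a this is the common form of full range projection, as in
  \<open>S5\<close>, and of invertibility, as in \<open>S7\<close>.\<close>

definition faithful_on_projections :: "'a \<Rightarrow> bool" where
  "faithful_on_projections a \<longleftrightarrow> (\<forall>q. proj q \<longrightarrow> q \<noteq> 0 \<longrightarrow> \<tau> (a \<cdot> q) \<noteq> 0)"

lemma supp_eq_unit_iff:
  assumes "pos a"
  shows "supp a = u \<longleftrightarrow> faithful_on_projections a"
proof
  assume s: "supp a = u"
  show "faithful_on_projections a"
    unfolding faithful_on_projections_def
  proof (intro allI impI notI)
    fix q assume q: "proj q" "q \<noteq> 0" "\<tau> (a \<cdot> q) = 0"
    then have "a \<cdot> q = 0" using pos_trace_mul_nonneg(2) assms proj_pos by blast
    then show False using supp_mul_eq_0[OF assms, of q] s q by simp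
  qed
next
  assume f: "faithful_on_projections a"
  have q: "proj (u - supp a)" by (intro proj_compl supp assms)
  have "a \<cdot> (u - supp a) = 0" using supp(1,3)[OF assms] assms by (simp add: mul_diff_right)
  then have "u - supp a = 0" using f q by (auto simp: faithful_on_projections_def)
  then show "supp a = u" by simp
qed

lemma invertible_iff:
  assumes "pos a"
  shows "(\<exists>z\<in>A. a \<cdot> z = u \<and> z \<cdot> a = u) \<longleftrightarrow> faithful_on_projections a"
proof
  assume "\<exists>z\<in>A. a \<cdot> z = u \<and> z \<cdot> a = u"
  then obtain z where z: "z \<in> A" "z \<cdot> a = u" by blast
  show "faithful_on_projections a"
    unfolding faithful_on_projections_def
  proof (intro allI impI notI)
    fix q assume q: "proj q" "q \<noteq> 0" "\<tau> (a \<cdot> q) = 0"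
    then have "a \<cdot> q = 0" using pos_trace_mul_nonneg(2) assms proj_pos by blast
    then have "(z \<cdot> a) \<cdot> q = 0" using z(1) q(1) assms by (simp add: mul_assoc)
    then show False using z(2) q by simp
  qed
next
  assume "faithful_on_projections a"
  then show "\<exists>z\<in>A. a \<cdot> z = u \<and> z \<cdot> a = u"
    using supp(4)[OF assms] supp_eq_unit_iff[OF assms] by force
qed

section \<open>Chains, minimal projections and suprema\<close>

lemma finite_independent: "S \<subseteq> A \<Longrightarrow> independent S \<Longrightarrow> finite S \<and> card S \<le> dim A"
proof -
  assume S: "S \<subseteq> A" "independent S"
  obtain F where F: "finite F" "span F = A" using fin_dim by blast
  obtain B where B: "B \<subseteq> A" "independent B" "A \<subseteq> span B" "card B = dim A"
    using basis_exists by blast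
  have "finite B" using independent_span_bound[OF F(1) B(2)] B(1) F(2) by simp
  then show ?thesis using independent_span_bound[OF _ S(2), of B] S(1) B(3,4) by auto
qed

text \<open>Strictly increasing nonzero projections are independent: left multiplication by
  \<open>r k\<close> fixes the span of \<open>r 0\<close>, ..., \<open>r k\<close> but sends
  \<open>r (Suc k)\<close> to \<open>r k\<close>. The chain has n + 1 members, hence the strict
  inequality.\<close>

lemma proj_chain_bound:
  assumes r: "\<And>i. i \<le> n \<Longrightarrow> proj (r i)" and "r 0 \<noteq> 0"
    and lt: "\<And>i. i < n \<Longrightarrow> le (r i) (r (Suc i)) \<and> r i \<noteq> r (Suc i)"
  shows "n < dim A"
proof -
  have "k \<le> n \<Longrightarrow> independent (r ` {..k}) \<and> card (r ` {..k}) = Suc k \<and> (\<forall>x\<in>span (r ` {..k}). x \<in> A \<and> r k \<cdot> x = x)" for k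
  proof (induction k)
    case 0
    have "x \<in> A \<and> r 0 \<cdot> x = x" if x: "x \<in> span {r 0}" for x
      using x r[of 0] by (auto simp: span_singleton mul_scl_right)
    then show ?case using \<open>r 0 \<noteq> 0\<close> by (simp add: atMost_Suc)
  next
    case (Suc k)
    then have IH: "independent (r ` {..k})" "card (r ` {..k}) = Suc k"
      "\<And>x. x \<in> span (r ` {..k}) \<Longrightarrow> x \<in> A \<and> r k \<cdot> x = x" by auto
    have p: "proj (r k)" "proj (r (Suc k))" using r Suc.prems by auto
    have le: "r (Suc k) \<cdot> r k = r k" "r k \<noteq> r (Suc k)"
      using lt[of k] Suc.prems proj_le_iff[OF p] by auto
    have "st (r (Suc k) \<cdot> r k) = st (r k)" by (simp add: le)
    then have "r k \<cdot> r (Suc k) = r k" using p by (simp add: st_mul)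
    then have ni: "r (Suc k) \<notin> span (r ` {..k})" using IH(3) le(2) by metis
    have eq: "r ` {..Suc k} = insert (r (Suc k)) (r ` {..k})" by (simp add: atMost_Suc)
    have "r (Suc k) \<notin> r ` {..k}" by (rule contra_subsetD[OF span_superset ni])
    then have c: "card (r ` {..Suc k}) = Suc (Suc k)" using IH(2) by (simp add: eq)
    have "x \<in> A \<and> r (Suc k) \<cdot> x = x" if x: "x \<in> span (r ` {..Suc k})" for x
    proof -
      obtain c where c: "x - scl c (r (Suc k)) \<in> span (r ` {..k})"
        using x unfolding eq span_insert by blast
      define y where "y = x - scl c (r (Suc k))"
      have y: "y \<in> A" "r k \<cdot> y = y" using IH(3) c by (auto simp: y_def)
      have "r (Suc k) \<cdot> y = r (Suc k) \<cdot> (r k \<cdot> y)" by (simp add: y)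
      also have "\<dots> = (r (Suc k) \<cdot> r k) \<cdot> y" using p y(1) by (simp only: mul_assoc proj_closed)
      also have "\<dots> = y" by (simp add: le(1) y)
      finally have "r (Suc k) \<cdot> y = y" .
      moreover have "x = y + scl c (r (Suc k))" by (simp add: y_def)
      ultimately show ?thesis using p y(1) by (auto simp: mul_add_right mul_scl_right)
    qed
    then show ?case using c independent_insertI[OF ni IH(1)] by (simp add: eq)
  qed
  then have "independent (r ` {..n})" "card (r ` {..n}) = Suc n" by auto
  moreover have "r ` {..n} \<subseteq> A" using r by auto
  ultimately show ?thesis using finite_independent[of "r ` {..n}"] by simp
qed

definition minimal_proj :: "'a \<Rightarrow> bool" where
  "minimal_proj p \<longleftrightarrow> proj p \<and> p \<noteq> 0 \<and> (\<forall>q. proj q \<longrightarrow> le q p \<longrightarrow> q = 0 \<or> q = p)"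

text \<open>Without a minimal projection below p there is an infinite strictly decreasing sequence;
  its first members, read backwards, contradict \<open>proj_chain_bound\<close>.\<close>

lemma ex_minimal_proj:
  assumes "proj p" "p \<noteq> 0"
  shows "\<exists>q. minimal_proj q \<and> le q p"
proof (rule ccontr)
  assume none: "\<nexists>q. minimal_proj q \<and> le q p"
  have step: "\<exists>r'. (proj r' \<and> r' \<noteq> 0 \<and> le r' p) \<and> le r' r \<and> r' \<noteq> r" if r: "proj r \<and> r \<noteq> 0 \<and> le r p" for r
  proof -
    have "\<not> minimal_proj r" using none r by blast
    then obtain q where "proj q" "le q r" "q \<noteq> 0" "q \<noteq> r" using r unfolding minimal_proj_def by blast
    then show ?thesis using r le_trans by blast
  qed
  have pp: "le p p" by (simp add: le_def)
  have "\<exists>f. \<forall>n. (proj (f n) \<and> f n \<noteq> 0 \<and> le (f n) p) \<and> (le (f (Suc n)) (f n) \<and> f (Suc n) \<noteq> f n)"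
    by (rule dependent_nat_choice[of "\<lambda>_ r. proj r \<and> r \<noteq> 0 \<and> le r p" "\<lambda>_ r r'. le r' r \<and> r' \<noteq> r"])
      (use assms pp in blast, rule step)
  then obtain f where f: "\<And>n. proj (f n)" "\<And>n. f n \<noteq> 0" "\<And>n. le (f (Suc n)) (f n)" "\<And>n. f (Suc n) \<noteq> f n"
    by blast
  have "dim A < dim A"
  proof (rule proj_chain_bound[of "dim A" "\<lambda>i. f (dim A - i)"])
    fix i assume "i < dim A"
    then have "dim A - i = Suc (dim A - Suc i)" by simp
    then show "le (f (dim A - i)) (f (dim A - Suc i)) \<and> f (dim A - i) \<noteq> f (dim A - Suc i)"
      using f(3,4) by simp
  qed (use f in auto)
  then show False by simp
qed

section \<open>Suprema of families of projections\<close>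

definition psup :: "'a set \<Rightarrow> 'a" where
  "psup Q = (THE e. proj e \<and> (\<forall>q\<in>Q. le q e) \<and> (\<forall>f. proj f \<longrightarrow> (\<forall>q\<in>Q. le q f) \<longrightarrow> le e f))"

text \<open>\<open>Q\<close> may be infinite, so the supremum is taken as the support of the sum
  over a maximal independent subset \<open>B\<close>. The rest of \<open>Q\<close> lies in the span
  of \<open>B\<close>, and being annihilated by u - \<open>supp s\<close> is a linear
  condition.\<close>

lemma ex_psup:
  assumes Q: "\<And>q. q \<in> Q \<Longrightarrow> proj q"
  shows "\<exists>e. proj e \<and> (\<forall>q\<in>Q. le q e) \<and> (\<forall>f. proj f \<longrightarrow> (\<forall>q\<in>Q. le q f) \<longrightarrow> le e f)"
proof -
  obtain B where B: "B \<subseteq> Q" "independent B" "Q \<subseteq> span B"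
    by (rule maximal_independent_subset)
  have fin: "finite B" using finite_independent[OF _ B(2)] B(1) Q by fastforce
  define s where "s = \<Sum>B"
  have pB: "pos b" if "b \<in> B" for b using that B(1) Q proj_pos by blast
  have s: "pos s" unfolding s_def by (rule pos_sum) (rule pB)
  let ?g = "u - supp s"
  have g: "proj ?g" by (intro proj_compl supp s)
  have sumg: "(\<Sum>b\<in>C. b) \<in> A \<and> \<tau> ((\<Sum>b\<in>C. b) \<cdot> y) = (\<Sum>b\<in>C. \<tau> (b \<cdot> y)) \<and> y \<cdot> (\<Sum>b\<in>C. b) = (\<Sum>b\<in>C. y \<cdot> b)"
    if "C \<subseteq> A" "y \<in> A" for C y
    using that
    by (induction C rule: infinite_finite_induct) (simp_all add: mul_add_left mul_add_right trace_add)
  have BA: "B \<subseteq> A" using pB by auto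
  have "s \<cdot> ?g = 0" using supp(1,3)[OF s] s by (simp add: mul_diff_right)
  then have "(\<Sum>b\<in>B. \<tau> (b \<cdot> ?g)) = 0" using sumg[OF BA, of ?g] g by (simp add: s_def)
  then have "\<forall>b\<in>B. \<tau> (b \<cdot> ?g) = 0"
    using pB g fin by (subst (asm) sum_nonneg_eq_0_iff) (auto intro: pos_trace_mul_nonneg(1) proj_pos)
  then have bg: "b \<cdot> ?g = 0" if "b \<in> B" for b
    using that pB g pos_trace_mul_nonneg(2) proj_pos by blast
  have sub: "subspace {x\<in>A. x \<cdot> ?g = 0}"
    using g by (auto simp: subspace_def mul_add_left mul_scl_left)
  have "x \<cdot> ?g = 0" if "x \<in> span B" for x
    using span_minimal[OF _ sub, of B] BA bg that by blast
  then have qg: "q \<cdot> ?g = 0" if "q \<in> Q" for q using B(3) that by blast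
  have "le q (supp s)" if q: "q \<in> Q" for q
  proof -
    have "\<tau> (q \<cdot> ?g) = 0" using qg[OF q] by simp
    then show ?thesis
      using proj_trace_compl[OF proj_pos[OF Q[OF q]] supp(1)[OF s]] supp_proj[OF Q[OF q]] by simp
  qed
  moreover have "le (supp s) f" if f: "proj f" "\<forall>q\<in>Q. le q f" for f
  proof -
    have "f \<cdot> b = b" if "b \<in> B" for b using f that B(1) Q proj_le_iff by blast
    then have "f \<cdot> s = s" using sumg[OF BA, of f] f(1) by (simp add: s_def)
    then show ?thesis using supp(6)[OF s f(1)] by blast
  qed
  ultimately show ?thesis using supp(1)[OF s] by blast
qed

lemma psup:
  assumes "\<And>q. q \<in> Q \<Longrightarrow> proj q"
  shows "proj (psup Q)" "q \<in> Q \<Longrightarrow> le q (psup Q)"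
    "proj f \<Longrightarrow> (\<And>q. q \<in> Q \<Longrightarrow> le q f) \<Longrightarrow> le (psup Q) f"
proof -
  have "\<exists>!e. proj e \<and> (\<forall>q\<in>Q. le q e) \<and> (\<forall>f. proj f \<longrightarrow> (\<forall>q\<in>Q. le q f) \<longrightarrow> le e f)"
    using ex_psup[OF assms] by (auto intro: le_antisym)
  from theI'[OF this]
  show "proj (psup Q)" "q \<in> Q \<Longrightarrow> le q (psup Q)"
    "proj f \<Longrightarrow> (\<And>q. q \<in> Q \<Longrightarrow> le q f) \<Longrightarrow> le (psup Q) f"
    unfolding psup_def by blast+
qed

lemma proj_mul_eq_0_comm: "proj p \<Longrightarrow> proj q \<Longrightarrow> p \<cdot> q = 0 \<Longrightarrow> q \<cdot> p = 0"
  by (metis proj_closed proj_st st_mul st_zero)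

text \<open>All members of \<open>Q\<close> are orthogonal to p iff u - p is an upper bound of
  \<open>Q\<close>.\<close>

lemma psup_mul_eq_0:
  assumes Q: "\<And>q. q \<in> Q \<Longrightarrow> proj q" and p: "proj p"
  shows "psup Q \<cdot> p = 0 \<longleftrightarrow> (\<forall>q\<in>Q. q \<cdot> p = 0)"
proof
  have E: "proj (psup Q)" using psup(1) Q by blast
  assume 0: "psup Q \<cdot> p = 0"
  show "\<forall>q\<in>Q. q \<cdot> p = 0"
  proof
    fix q assume q: "q \<in> Q"
    then have "psup Q \<cdot> q = q" using psup(2)[OF Q] proj_le_iff[OF Q E] by blast
    then have "p \<cdot> q = (p \<cdot> psup Q) \<cdot> q" using p E Q[OF q] by (simp add: mul_assoc)
    also have "\<dots> = 0" using proj_mul_eq_0_comm[OF E p 0] Q[OF q] by simp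
    finally show "q \<cdot> p = 0" using proj_mul_eq_0_comm p Q[OF q] by blast
  qed
next
  have E: "proj (psup Q)" using psup(1) Q by blast
  assume 0: "\<forall>q\<in>Q. q \<cdot> p = 0"
  have "le q (u - p)" if "q \<in> Q" for q
  proof -
    have "p \<cdot> q = 0" using 0 that Q p proj_mul_eq_0_comm by blast
    then have "(u - p) \<cdot> q = q" using Q[OF that] p by (simp add: mul_diff_left)
    then show ?thesis using proj_le_iff[OF Q[OF that] proj_compl[OF p]] by simp
  qed
  then have "le (psup Q) (u - p)" by (intro psup(3)[OF Q] proj_compl p)
  then have "(u - p) \<cdot> psup Q = psup Q" using proj_le_iff[OF E proj_compl[OF p]] by simp
  then have "p \<cdot> psup Q = 0" using E p by (simp add: mul_diff_left)
  then show "psup Q \<cdot> p = 0" using proj_mul_eq_0_comm E p by blast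
qed

end


section \<open>Irreducible positive maps\<close>

locale positive_map = traced_cstar_algebra +
  fixes \<Phi> :: "'a \<Rightarrow> 'a"
  assumes map_closed [simp]: "a \<in> A \<Longrightarrow> \<Phi> a \<in> A"
    and map_add: "a \<in> A \<Longrightarrow> b \<in> A \<Longrightarrow> \<Phi> (a + b) = \<Phi> a + \<Phi> b"
    and map_scl: "a \<in> A \<Longrightarrow> \<Phi> (scl r a) = scl r (\<Phi> a)"
    and map_pos: "pos a \<Longrightarrow> pos (\<Phi> a)"
begin

lemma map_diff: "a \<in> A \<Longrightarrow> b \<in> A \<Longrightarrow> \<Phi> (a - b) = \<Phi> a - \<Phi> b"
  using map_add[of "a - b" b] by simp

lemma map_mono: "le a b \<Longrightarrow> a \<in> A \<Longrightarrow> b \<in> A \<Longrightarrow> le (\<Phi> a) (\<Phi> b)"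
  unfolding le_def by (simp add: map_diff[symmetric] map_pos)

lemma funpow_closed [simp]: "a \<in> A \<Longrightarrow> (\<Phi> ^^ n) a \<in> A"
  by (induction n) auto

lemma funpow_add': "a \<in> A \<Longrightarrow> b \<in> A \<Longrightarrow> (\<Phi> ^^ n) (a + b) = (\<Phi> ^^ n) a + (\<Phi> ^^ n) b"
  by (induction n) (auto simp: map_add)

lemma funpow_scl: "a \<in> A \<Longrightarrow> (\<Phi> ^^ n) (scl r a) = scl r ((\<Phi> ^^ n) a)"
  by (induction n) (auto simp: map_scl)

lemma funpow_pos: "pos a \<Longrightarrow> pos ((\<Phi> ^^ n) a)"
  by (induction n) (auto simp: map_pos)

lemma funpow_mono: "le a b \<Longrightarrow> a \<in> A \<Longrightarrow> b \<in> A \<Longrightarrow> le ((\<Phi> ^^ n) a) ((\<Phi> ^^ n) b)"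
  by (induction n) (auto intro: map_mono)

lemma trace_funpow_mono:
  assumes "le x y" "le z w" "pos x" "pos y" "pos z" "pos w"
  shows "\<tau> ((\<Phi> ^^ n) x \<cdot> z) \<le> \<tau> ((\<Phi> ^^ n) y \<cdot> w)"
proof -
  have "\<tau> ((\<Phi> ^^ n) x \<cdot> z) \<le> \<tau> ((\<Phi> ^^ n) y \<cdot> z)"
    using assms by (intro le_trace_mono funpow_mono) auto
  also have "\<dots> = \<tau> (z \<cdot> (\<Phi> ^^ n) y)" using assms by (simp add: trace_comm)
  also have "\<dots> \<le> \<tau> (w \<cdot> (\<Phi> ^^ n) y)"
    using assms by (intro le_trace_mono funpow_pos) auto
  also have "\<dots> = \<tau> ((\<Phi> ^^ n) y \<cdot> w)" using assms by (simp add: trace_comm)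
  finally show ?thesis .
qed

text \<open>By \<open>dominated_by_proj_iff\<close> the trace condition says that \<Phi> p is
  dominated by a multiple of p, so this is irreducibility in the usual sense.\<close>

definition irreducible_map :: bool where
  "irreducible_map \<longleftrightarrow> (\<forall>p. proj p \<longrightarrow> \<tau> (\<Phi> p \<cdot> (u - p)) = 0 \<longrightarrow> p = 0 \<or> p = u)"

text \<open>The analogue of strong connectivity of a graph: every nonzero projection reaches every
  other under some iterate.\<close>

definition connecting_map :: bool where
  "connecting_map \<longleftrightarrow> (\<forall>p q. proj p \<longrightarrow> p \<noteq> 0 \<longrightarrow> proj q \<longrightarrow> q \<noteq> 0 \<longrightarrow>
     (\<exists>k. \<tau> ((\<Phi> ^^ k) p \<cdot> q) \<noteq> 0))"

text \<open>If \<open>\<Phi> p \<le> l p\<close> then \<open>\<Phi>\<^sup>k p \<le> l\<^sup>k p\<close> for all \<open>k\<close>.\<close>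

lemma invariant_projection:
  assumes p: "proj p" and 0: "\<tau> (\<Phi> p \<cdot> (u - p)) = 0"
  shows "\<tau> ((\<Phi> ^^ k) p \<cdot> (u - p)) = 0"
proof -
  have pp: "pos p" "p \<in> A" using p proj_pos by auto
  obtain l :: real where l: "0 < l" "le (\<Phi> p) (scl (of_real l) p)"
    using dominated_by_proj_iff[OF map_pos[OF pp(1)] p] 0 by blast
  have "le ((\<Phi> ^^ k) p) (scl (of_real (l ^ k)) p)"
  proof (induction k)
    case (Suc k)
    have "le ((\<Phi> ^^ Suc k) p) (scl (of_real (l ^ k)) (\<Phi> p))"
      using map_mono[OF Suc] pp(2) by (simp add: map_scl)
    also have "le (scl (of_real (l ^ k)) (\<Phi> p)) (scl (of_real (l ^ k)) (scl (of_real l) p))"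
      using l by (intro le_scl) auto
    finally (le_trans) show ?case by (simp add: mult.commute)
  qed (simp add: le_def)
  then show ?thesis
    using dominated_by_proj_iff[OF funpow_pos[OF pp(1)] p] l(1) zero_less_power by blast
qed

text \<open>The iterates of an invariant projection p never meet u - p.\<close>

lemma connecting_imp_irreducible:
  assumes "connecting_map"
  shows "irreducible_map"
  unfolding irreducible_map_def
proof (intro allI impI)
  fix p assume p: "proj p" "\<tau> (\<Phi> p \<cdot> (u - p)) = 0"
  have "p = 0 \<or> u - p = 0"
    using assms[unfolded connecting_map_def, rule_format, of p "u - p"] invariant_projection[OF p]
      proj_compl[OF p(1)] p(1) by blast
  then show "p = 0 \<or> p = u" by auto
qed

end

text \<open>The shift by a multiple of the identity lets supports grow along the iteration. The
  scalar stays arbitrary because in \<open>S7\<close> it is the normalization of the Jones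
  projection; elsewhere it is taken to be 1.\<close>

locale shifted_positive_map = positive_map +
  fixes \<gamma> :: real
  assumes shift_pos: "0 < \<gamma>"
begin

definition \<Psi> :: "'a \<Rightarrow> 'a" where
  "\<Psi> y = scl (of_real \<gamma>) y + \<Phi> y"

sublocale shift: positive_map scl A mul st u \<tau> \<Psi>
proof
  show "\<Psi> a \<in> A" if "a \<in> A" for a using that by (simp add: \<Psi>_def)
  show "\<Psi> (a + b) = \<Psi> a + \<Psi> b" if "a \<in> A" "b \<in> A" for a b
    using that by (simp add: \<Psi>_def map_add scale_right_distrib algebra_simps)
  show "\<Psi> (scl r a) = scl r (\<Psi> a)" if "a \<in> A" for a r
    using that by (simp add: \<Psi>_def map_scl scale_right_distrib mult.commute)
  show "pos (\<Psi> a)" if "pos a" for a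
    unfolding \<Psi>_def using that shift_pos by (intro pos_add pos_scl map_pos) auto
qed

text \<open>
  The range projections \<open>r k\<close> of \<open>\<Psi>\<^sup>k p\<close> increase strictly until they reach a projection that is
  invariant under \<open>\<Phi>\<close>; a strict chain of nonzero projections has at most \<open>dim A\<close> members.
\<close>

lemma irreducible_imp_faithful:
  assumes irr: "irreducible_map" and p: "proj p" "p \<noteq> 0"
  shows "faithful_on_projections ((\<Psi> ^^ (dim A - 1)) p)"
proof -
  define y where "y k = (\<Psi> ^^ k) p" for k
  define r where "r k = supp (y k)" for k
  have y: "pos (y k)" for k unfolding y_def using shift.funpow_pos proj_pos[OF p(1)] .
  have r: "proj (r k)" for k unfolding r_def by (rule supp(1)[OF y])
  have r0: "r 0 = p" using supp_proj[OF p(1)] by (simp add: r_def y_def)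
  have ySuc: "y (Suc k) = scl (of_real \<gamma>) (y k) + \<Phi> (y k)" for k by (simp add: y_def \<Psi>_def)
  \<comment> \<open>Two nonnegative numbers, one with positive weight, add up to zero.\<close>
  have split: "\<tau> (y k \<cdot> g) = 0 \<and> \<tau> (\<Phi> (y k) \<cdot> g) = 0"
    if g: "pos g" "\<tau> (y (Suc k) \<cdot> g) = 0" for k g
  proof -
    have "\<tau> (y (Suc k) \<cdot> g) = of_real \<gamma> * \<tau> (y k \<cdot> g) + \<tau> (\<Phi> (y k) \<cdot> g)"
      using y[of k] g(1) by (simp add: ySuc mul_add_left mul_scl_left trace_add trace_scl)
    moreover have "0 \<le> \<tau> (y k \<cdot> g)" "0 \<le> \<tau> (\<Phi> (y k) \<cdot> g)"
      using y g(1) map_pos pos_trace_mul_nonneg(1) by blast+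
    ultimately show ?thesis using g(2) shift_pos
      by (auto simp: less_eq_complex_def complex_eq_iff add_nonneg_eq_0_iff)
  qed
  have compl: "\<tau> (y (Suc k) \<cdot> (u - r (Suc k))) = 0" for k
    using proj_trace_compl[OF y r] by (simp add: r_def le_def)
  have gp: "pos (u - r k)" for k by (rule proj_pos[OF proj_compl[OF r]])
  have mono: "le (r k) (r (Suc k))" for k
    using split[OF gp compl] proj_trace_compl[OF y r] by (simp add: r_def)
  have mono': "le (r i) (r (i + j))" for i j
  proof (induction j)
    case (Suc j)
    then show ?case using le_trans[OF _ mono[of "i + j"]] by simp
  qed (simp add: le_def)
  \<comment> \<open>If the support does not grow, \<Phi> of \<open>r k\<close> is dominated by a
    multiple of \<Phi> of \<open>y k\<close>, which lives under \<open>r (Suc k) = r k\<close>. So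
    \<open>r k\<close> is invariant, and irreducibility leaves only u.\<close>
  have stop: "r k = u" if eq: "r k = r (Suc k)" for k
  proof -
    obtain c :: real where c: "0 < c" "le (r k) (scl (of_real c) (y k))"
      using supp(5)[OF y[of k]] by (auto simp: r_def)
    have "le (\<Phi> (r k)) (scl (of_real c) (\<Phi> (y k)))"
      using map_mono[OF c(2)] r y by (simp add: map_scl)
    then have "\<tau> (\<Phi> (r k) \<cdot> (u - r k)) \<le> \<tau> (scl (of_real c) (\<Phi> (y k)) \<cdot> (u - r k))"
      using r y by (intro le_trace_mono gp) auto
    also have "\<dots> = 0" using split[OF gp compl, of k] eq r y by (simp add: mul_scl_left trace_scl)
    finally have "\<tau> (\<Phi> (r k) \<cdot> (u - r k)) = 0"
      using pos_trace_mul_nonneg(1)[OF map_pos[OF proj_pos[OF r]] gp] by (meson order_antisym)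
    then have "r k = 0 \<or> r k = u" using irr r unfolding irreducible_map_def by blast
    moreover have "r k \<noteq> 0"
    proof
      assume "r k = 0"
      moreover have "r k \<cdot> r 0 = r 0" using mono'[of 0 k] proj_le_iff[OF r r, of 0 k] by simp
      ultimately show False using p r0 by simp
    qed
    ultimately show ?thesis by blast
  qed
  \<comment> \<open>Otherwise none of the first \<open>dim A\<close> supports is u, so all
    \<open>dim A\<close> steps up to \<open>r (dim A)\<close> are strict, which is one projection
    too many.\<close>
  have "r (dim A - 1) = u"
  proof (rule ccontr)
    assume ne: "r (dim A - 1) \<noteq> u"
    have "dim A < dim A"
    proof (rule proj_chain_bound)
      fix i assume i: "i < dim A"
      have "r i \<noteq> u"
      proof
        assume "r i = u"
        then have "le u (r (dim A - 1))" using mono'[of i "dim A - 1 - i"] i by simp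
        then show False using ne le_antisym le_unit[OF r] by blast
      qed
      then show "le (r i) (r (Suc i)) \<and> r i \<noteq> r (Suc i)" using mono stop by blast
    qed (use r r0 p in auto)
    then show False by simp
  qed
  then show ?thesis using supp_eq_unit_iff[OF y] by (simp add: r_def y_def)
qed

text \<open>The n-th power of \<Psi> is a combination of the powers \<Phi>^k with k \<le> n. The
  induction splits off the innermost factor, so that the hypothesis is applied both to y and to
  \<Phi> y.\<close>

lemma trace_shift_funpow_eq_0:
  assumes "y \<in> A" "z \<in> A" "\<And>k. k \<le> n \<Longrightarrow> \<tau> ((\<Phi> ^^ k) y \<cdot> z) = 0"
  shows "\<tau> ((\<Psi> ^^ n) y \<cdot> z) = 0"
  using assms(1,3)
proof (induction n arbitrary: y)
  case 0
  then show ?case using 0(2)[of 0] by simp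
next
  case (Suc n)
  have 1: "\<tau> ((\<Psi> ^^ n) y \<cdot> z) = 0" using Suc by simp
  have "\<tau> ((\<Phi> ^^ k) (\<Phi> y) \<cdot> z) = 0" if "k \<le> n" for k
    using Suc.prems(2)[of "Suc k"] that by (simp only: funpow_Suc_right comp_def Suc_le_mono)
  then have 2: "\<tau> ((\<Psi> ^^ n) (\<Phi> y) \<cdot> z) = 0" using Suc by simp
  have "(\<Psi> ^^ Suc n) y = scl (of_real \<gamma>) ((\<Psi> ^^ n) y) + (\<Psi> ^^ n) (\<Phi> y)"
    using Suc.prems(1) by (simp only: funpow_Suc_right comp_def \<Psi>_def shift.funpow_add' shift.funpow_scl map_closed scl_closed)
  then show ?case using 1 2 Suc.prems(1) assms(2)
    by (simp add: mul_add_left mul_scl_left trace_add trace_scl del: funpow.simps)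
qed

text \<open>If all the overlaps vanish, so does that of the iterate of \<Psi>. Up to constants y and
  z dominate their supports, so the supports would have zero overlap as well, against
  faithfulness.\<close>

lemma faithful_imp_positive_overlap:
  assumes faithful: "\<And>p. proj p \<Longrightarrow> p \<noteq> 0 \<Longrightarrow> faithful_on_projections ((\<Psi> ^^ (dim A - 1)) p)"
    and y: "pos y" "y \<noteq> 0" and z: "pos z" "z \<noteq> 0"
  shows "\<exists>k<dim A. 0 < \<tau> ((\<Phi> ^^ k) y \<cdot> z)"
proof (rule ccontr)
  assume none: "\<not> ?thesis"
  have 0: "\<tau> ((\<Phi> ^^ k) y \<cdot> z) = 0" if "k < dim A" for k
  proof -
    have "0 \<le> \<tau> ((\<Phi> ^^ k) y \<cdot> z)" using y z funpow_pos pos_trace_mul_nonneg(1) by blast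
    then show ?thesis using none that by (auto simp: order_le_less)
  qed
  let ?p = "supp y" and ?q = "supp z"
  have p: "proj ?p" "?p \<noteq> 0" and q: "proj ?q" "?q \<noteq> 0" using y z supp(1) supp_eq_0 by auto
  obtain c :: real where c: "0 < c" "le ?p (scl (of_real c) y)" using supp(5)[OF y(1)] by blast
  obtain c' :: real where c': "0 < c'" "le ?q (scl (of_real c') z)" using supp(5)[OF z(1)] by blast
  \<comment> \<open>Makes the truncated difference \<open>dim A - 1\<close> a true one: exponents up
    to it are exactly those below \<open>dim A\<close>.\<close>
  have "0 < dim A" using proj_chain_bound[of 0 "\<lambda>_. ?p"] p by simp
  then have "\<tau> ((\<Psi> ^^ (dim A - 1)) y \<cdot> z) = 0"
    using y z 0 by (intro trace_shift_funpow_eq_0) auto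
  then have "\<tau> ((\<Psi> ^^ (dim A - 1)) (scl (of_real c) y) \<cdot> scl (of_real c') z) = 0"
    using y z by (simp add: shift.funpow_scl mul_scl_left mul_scl_right trace_scl)
  moreover have "\<tau> ((\<Psi> ^^ (dim A - 1)) ?p \<cdot> ?q) \<le> \<tau> ((\<Psi> ^^ (dim A - 1)) (scl (of_real c) y) \<cdot> scl (of_real c') z)"
    using c(1) c'(1) by (intro shift.trace_funpow_mono c(2) c'(2) proj_pos[OF p(1)] proj_pos[OF q(1)]
        pos_scl[OF y(1)] pos_scl[OF z(1)]) auto
  moreover have "0 \<le> \<tau> ((\<Psi> ^^ (dim A - 1)) ?p \<cdot> ?q)"
    by (intro pos_trace_mul_nonneg(1) shift.funpow_pos proj_pos p q)
  ultimately have "\<tau> ((\<Psi> ^^ (dim A - 1)) ?p \<cdot> ?q) = 0" by (metis order_antisym)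
  then show False using faithful[OF p] q by (simp add: faithful_on_projections_def)
qed

end

section \<open>Positivity of convolution\<close>

declare One_nat_def [simp del]

section \<open>Multilinearity and adjoints for checked tangles\<close>

lemma good_tangleD:
  assumes "good_tangle T cs c"
  shows "planar_tangle T" "inner T = {..<length cs}" "k < length cs \<Longrightarrow> colour T (Some k) = cs ! k"
    "colour T None = c"
proof -
  show "planar_tangle T"
    using assms planar_same_tangle[OF same_tangle_tabulate planar_check_sound]
    by (simp add: good_tangle_def)
  show "inner T = {..<length cs}" "colour T None = c" using assms by (simp_all add: good_tangle_def)
  show "colour T (Some k) = cs ! k" if "k < length cs"
  proof -
    have "(k, cs ! k) \<in> set (List.enumerate 0 cs)" using that by (simp add: in_set_enumerate_eq)
    then show ?thesis using assms by (auto simp: good_tangle_def list_all_iff)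
  qed
qed

definition fits :: "('a, 'b) planar_alg_scheme \<Rightarrow> 'a list \<Rightarrow> colour list \<Rightarrow> bool" where
  "fits \<PP> xs cs \<longleftrightarrow> list_all2 (\<lambda>x c. x \<in> box \<PP> c) xs cs"

lemma fits_simps [simp]:
  "fits \<PP> [] [] \<longleftrightarrow> True"
  "fits \<PP> (x # xs) (c # cs) \<longleftrightarrow> x \<in> box \<PP> c \<and> fits \<PP> xs cs"
  by (simp_all add: fits_def)

context planar_algebra
begin

lemma good_inputs:
  assumes "good_tangle T cs c" "fits \<PP> xs cs"
  shows "(\<lambda>k. xs ! k) \<in> inputs \<PP> T"
  using assms(2) good_tangleD(2,3)[OF assms(1)]
  by (auto simp: inputs_def fits_def list_all2_conv_all_nth)

lemma good_closed:
  assumes "good_tangle T cs c" "fits \<PP> xs cs"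
  shows "act \<PP> T (\<lambda>k. xs ! k) \<in> box \<PP> c"
  using act_closed[OF good_tangleD(1)[OF assms(1)] good_inputs[OF assms]] good_tangleD(4)[OF assms(1)]
  by simp

lemma good_update:
  assumes T: "good_tangle T cs c" and xs: "fits \<PP> xs cs" and i: "i < length cs" "a \<in> box \<PP> (cs ! i)"
  shows "act \<PP> T ((\<lambda>k. xs ! k)(i := a)) = act \<PP> T (\<lambda>k. xs[i := a] ! k)"
proof -
  have l: "length xs = length cs" using xs by (auto simp: fits_def list_all2_lengthD)
  have "fits \<PP> (xs[i := a]) cs"
    using xs i by (auto simp: fits_def list_all2_conv_all_nth nth_list_update)
  then show ?thesis
    using l by (intro act_cong[OF good_tangleD(1)[OF T] good_inputs[OF T]])
      (auto simp: good_tangleD(2)[OF T] nth_list_update)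
qed

lemma good_add:
  assumes T: "good_tangle T cs c" and xs: "fits \<PP> xs cs" and i: "i < length cs"
    and a: "a \<in> box \<PP> (cs ! i)" and b: "b \<in> box \<PP> (cs ! i)"
  shows "act \<PP> T (\<lambda>k. xs[i := a + b] ! k) = act \<PP> T (\<lambda>k. xs[i := a] ! k) + act \<PP> T (\<lambda>k. xs[i := b] ! k)"
proof -
  have "a + b \<in> box \<PP> (cs ! i)" using a b subspace_box by (simp add: subspace_add)
  then show ?thesis
    using act_add[OF good_tangleD(1)[OF T] good_inputs[OF T xs], of i a b] i a b
    by (simp add: good_tangleD(2,3)[OF T] good_update[OF T xs])
qed

lemma good_scal:
  assumes T: "good_tangle T cs c" and xs: "fits \<PP> xs cs" and i: "i < length cs"
    and a: "a \<in> box \<PP> (cs ! i)"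
  shows "act \<PP> T (\<lambda>k. xs[i := scal \<PP> r a] ! k) = scal \<PP> r (act \<PP> T (\<lambda>k. xs[i := a] ! k))"
proof -
  have "scal \<PP> r a \<in> box \<PP> (cs ! i)" using a subspace_box by (simp add: subspace_scale)
  then show ?thesis
    using act_scal[OF good_tangleD(1)[OF T] good_inputs[OF T xs], of i a r] i a
    by (simp add: good_tangleD(2,3)[OF T] good_update[OF T xs])
qed

end

context cstar_planar_algebra
begin

lemma good_star:
  assumes T: "good_tangle T cs c" and R: "good_tangle (reflect T) cs c" and xs: "fits \<PP> xs cs"
  shows "star \<PP> c (act \<PP> T (\<lambda>k. xs ! k)) = act \<PP> (reflect T) (\<lambda>k. map2 (star \<PP>) cs xs ! k)"
proof -
  have l: "length xs = length cs" using xs by (auto simp: fits_def list_all2_lengthD)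
  have st: "star \<PP> c' x \<in> box \<PP> c'" if "x \<in> box \<PP> c'" for c' x
    by (rule fin_dim_cstar_algebra.st_closed[OF cstar_box that])
  have "fits \<PP> (map2 (star \<PP>) cs xs) cs"
    using xs l st by (auto simp: fits_def list_all2_conv_all_nth)
  then have "act \<PP> (reflect T) (\<lambda>d. star \<PP> (colour T (Some d)) (xs ! d)) =
      act \<PP> (reflect T) (\<lambda>k. map2 (star \<PP>) cs xs ! k)"
    using l by (intro act_cong[OF good_tangleD(1)[OF R] good_inputs[OF R]])
      (auto simp: good_tangleD(2)[OF R] good_tangleD(3)[OF T])
  then show ?thesis
    using star_act[OF good_tangleD(1)[OF T] good_inputs[OF T xs]] good_tangleD(4)[OF T] by simp
qed

section \<open>The boxes of each colour as a traced C*-algebra\<close>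

sublocale C: traced_cstar_algebra "scal \<PP>" "box \<PP> c" "mult \<PP> c" "star \<PP> c" "one \<PP> c" "tr \<PP> c" for c
proof (intro traced_cstar_algebra.intro cstar_box traced_cstar_algebra_axioms.intro)
  show "tr \<PP> c (mult \<PP> c a b) = tr \<PP> c (mult \<PP> c b a)" if "a \<in> box \<PP> c" "b \<in> box \<PP> c" for a b
    using that by (rule tr_comm)
  have "positive \<PP> c (mult \<PP> c a (star \<PP> c a))" if "a \<in> box \<PP> c" for a
    using that by (auto simp: positive_def)
  then show "0 \<le> tr \<PP> c (mult \<PP> c a (star \<PP> c a))"
    "tr \<PP> c (mult \<PP> c a (star \<PP> c a)) = 0 \<Longrightarrow> mult \<PP> c a (star \<PP> c a) = 0" if "a \<in> box \<PP> c" for a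
    using that tr_positive tr_faithful by blast+
qed (auto simp: tr_add tr_scal)

lemma pos_eq: "C.pos c = positive \<PP> c"
  by (intro ext, unfold C.pos_def positive_def, rule refl)

lemma proj_eq: "C.proj c = projection \<PP> c"
  by (intro ext, unfold C.proj_def projection_def, rule refl)

lemma le_eq: "C.le c = leq \<PP> c"
  by (intro ext, unfold C.le_def leq_def pos_eq, rule refl)

lemma minimal_eq: "C.minimal_proj c = minimal_projection \<PP> c"
  by (intro ext, unfold C.minimal_proj_def minimal_projection_def proj_eq le_eq, rule refl)

lemma supp_eq: "C.supp c = range_projection \<PP> c"
  by (intro ext, unfold C.supp_def range_projection_def proj_eq le_eq, rule refl)

lemma psup_eq: "C.psup c = projection_sup \<PP> c"
  by (intro ext, unfold C.psup_def projection_sup_def proj_eq le_eq, rule refl)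

abbreviation "N \<equiv> box \<PP> (1, Unshaded)"
abbreviation "M \<equiv> box \<PP> (1, Shaded)"
abbreviation "Q \<equiv> box \<PP> (2, Shaded)"
abbreviation "mN \<equiv> mult \<PP> (1, Unshaded)"
abbreviation "mM \<equiv> mult \<PP> (1, Shaded)"
abbreviation "mQ \<equiv> mult \<PP> (2, Shaded)"
abbreviation "sN \<equiv> star \<PP> (1, Unshaded)"
abbreviation "sM \<equiv> star \<PP> (1, Shaded)"
abbreviation "sQ \<equiv> star \<PP> (2, Shaded)"
abbreviation "oneN \<equiv> one \<PP> (1, Unshaded)"
abbreviation "oneM \<equiv> one \<PP> (1, Shaded)"
abbreviation "trN \<equiv> tr \<PP> (1, Unshaded)"
abbreviation "trM \<equiv> tr \<PP> (1, Shaded)"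
abbreviation "trQ \<equiv> tr \<PP> (2, Shaded)"
abbreviation "posN \<equiv> C.pos (1, Unshaded)"
abbreviation "posQ \<equiv> C.pos (2, Shaded)"
abbreviation "projN \<equiv> C.proj (1, Unshaded)"
abbreviation "projM \<equiv> C.proj (1, Shaded)"
abbreviation "projQ \<equiv> C.proj (2, Shaded)"
abbreviation "clN \<equiv> box_closure \<PP> (1, Unshaded)"
abbreviation "bar \<equiv> rotate1box \<PP>"
abbreviation "conv_with v \<equiv> \<lambda>y. lconv \<PP> y v"

section \<open>Operations on boxes and their closures\<close>

definition lr_closure :: "'a \<Rightarrow> 'a" where
  "lr_closure w = act1 \<PP> lr_closure_tangle w"

text \<open>The closure ends in the unshaded 0-boxes, as for \<open>trN\<close>, whereas
  \<open>trQ\<close> is computed in the shaded ones.\<close>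

definition lr_trace :: "'a \<Rightarrow> complex" where
  "lr_trace w = tr \<PP> (0, Unshaded) (lr_closure w)"

definition inv_fourier :: "'a \<Rightarrow> 'a" where
  "inv_fourier w = act1 \<PP> inv_fourier_tangle w"

definition inv_rotate1box :: "'a \<Rightarrow> 'a" where
  "inv_rotate1box q = act1 \<PP> inv_rotate_tangle q"

lemma picture_eq:
  assumes "same_picture e e'" "well_typed (box \<PP>) x e" "well_typed (box \<PP>) x e'"
    "sem (act \<PP>) x e = a" "sem (act \<PP>) x e' = b"
  shows "a = b"
  using same_picture_sound[OF assms(1-3)] assms(4,5) by simp

text \<open>\<open>one\<close> feeds \<open>undefined\<close> to a tangle without inputs, while an
  expression node feeds \<open>[] ! k\<close>; this brings the constant into the shape produced by
  \<open>sem\<close>.\<close>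

lemma cap_cup_sem: "cap_cup \<PP> = act1 \<PP> fourier_tangle (act \<PP> (unit_tangle (2, Unshaded)) (\<lambda>k. [] ! k))"
proof -
  have "one \<PP> (2, Unshaded) = act \<PP> (unit_tangle (2, Unshaded)) (\<lambda>k. [] ! k)"
    unfolding one_def
    by (rule act_cong[OF good_tangleD(1)[OF good_unit] good_inputs[OF good_unit]])
      (simp_all add: good_tangleD(2)[OF good_unit])
  then show ?thesis by (simp only: cap_cup_def fourier_def)
qed

lemma fourier_closed: "x \<in> box \<PP> (2, Unshaded) \<Longrightarrow> fourier \<PP> x \<in> Q"
  unfolding fourier_def by (rule good_closed[OF good_fourier]) simp

lemma cap_cup_closed: "cap_cup \<PP> \<in> Q"
  unfolding cap_cup_def by (rule fourier_closed) (rule C.unit_closed)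

lemma lconv_closed: "y \<in> N \<Longrightarrow> v \<in> Q \<Longrightarrow> lconv \<PP> y v \<in> N"
  unfolding lconv_def by (rule good_closed[OF good_lconv]) simp

lemma rconv_closed: "v \<in> Q \<Longrightarrow> q \<in> M \<Longrightarrow> rconv \<PP> v q \<in> M"
  unfolding rconv_def by (rule good_closed[OF good_rconv]) simp

lemma conv_closed: "v \<in> Q \<Longrightarrow> w \<in> Q \<Longrightarrow> conv \<PP> v w \<in> Q"
  unfolding conv_def by (rule good_closed[OF good_conv]) simp

lemma juxtapose_closed: "m \<in> M \<Longrightarrow> y \<in> N \<Longrightarrow> juxtapose \<PP> m y \<in> Q"
  unfolding juxtapose_def by (rule good_closed[OF good_juxtapose]) simp

lemma bar_closed: "y \<in> N \<Longrightarrow> bar y \<in> M"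
  unfolding rotate1box_def by (rule good_closed[OF good_rotate]) simp

lemma inv_rotate1box_closed: "q \<in> M \<Longrightarrow> inv_rotate1box q \<in> N"
  unfolding inv_rotate1box_def by (rule good_closed[OF good_inv_rotate]) simp

lemma inv_fourier_closed: "w \<in> Q \<Longrightarrow> inv_fourier w \<in> box \<PP> (2, Unshaded)"
  unfolding inv_fourier_def by (rule good_closed[OF good_inv_fourier]) simp

lemma conv_power_closed: "v \<in> Q \<Longrightarrow> conv_power \<PP> v k \<in> Q"
  by (induction k) (auto intro: cap_cup_closed conv_closed)

lemma lconv_add_left: "y \<in> N \<Longrightarrow> z \<in> N \<Longrightarrow> v \<in> Q \<Longrightarrow> lconv \<PP> (y + z) v = lconv \<PP> y v + lconv \<PP> z v"
  using good_add[OF good_lconv, of "[y, v]" 0 y z] by (simp add: lconv_def)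

lemma lconv_scal_left: "y \<in> N \<Longrightarrow> v \<in> Q \<Longrightarrow> lconv \<PP> (scal \<PP> r y) v = scal \<PP> r (lconv \<PP> y v)"
  using good_scal[OF good_lconv, of "[y, v]" 0 y r] by (simp add: lconv_def)

lemma lconv_add_right: "y \<in> N \<Longrightarrow> v \<in> Q \<Longrightarrow> w \<in> Q \<Longrightarrow> lconv \<PP> y (v + w) = lconv \<PP> y v + lconv \<PP> y w"
  using good_add[OF good_lconv, of "[y, v]" "Suc 0" v w] by (simp add: lconv_def)

lemma lconv_scal_right: "y \<in> N \<Longrightarrow> v \<in> Q \<Longrightarrow> lconv \<PP> y (scal \<PP> r v) = scal \<PP> r (lconv \<PP> y v)"
  using good_scal[OF good_lconv, of "[y, v]" "Suc 0" v r] by (simp add: lconv_def)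

lemma bar_add: "y \<in> N \<Longrightarrow> z \<in> N \<Longrightarrow> bar (y + z) = bar y + bar z"
  using good_add[OF good_rotate, of "[y]" 0 y z] by (simp add: rotate1box_def)

lemma lr_closure_zero: "lr_closure 0 = 0"
  using good_scal[OF good_lr_closure, of "[0]" 0 0 0] by (simp add: lr_closure_def)

lemma fourier_zero: "fourier \<PP> 0 = 0"
  using good_scal[OF good_fourier, of "[0]" 0 0 0] by (simp add: fourier_def)

lemma lconv_cap_cup: "y \<in> N \<Longrightarrow> lconv \<PP> y (cap_cup \<PP>) = y"
  by (rule picture_eq[OF picture_lconv_cap_cup, of "(\<lambda>_. 0)(3 := y)"])
    (simp_all add: lconv_def cap_cup_sem)

lemma lconv_conv:
  "y \<in> N \<Longrightarrow> v \<in> Q \<Longrightarrow> w \<in> Q \<Longrightarrow> lconv \<PP> y (conv \<PP> v w) = lconv \<PP> (lconv \<PP> y v) w"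
  by (rule picture_eq[OF picture_lconv_conv, of "(\<lambda>_. 0)(3 := y, 4 := v, 5 := w)"])
    (simp_all add: lconv_def conv_def)

lemma trace_lconv:
  assumes "y \<in> N" "v \<in> Q" "z \<in> N"
  shows "trN (mN (lconv \<PP> y v) z) = lr_trace (mQ v (juxtapose \<PP> (bar y) z))"
proof -
  have "clN (mN (lconv \<PP> y v) z) = lr_closure (mQ v (juxtapose \<PP> (bar y) z))"
    by (rule picture_eq[OF picture_trace_lconv, of "(\<lambda>_. 0)(3 := y, 4 := v, 5 := z)"])
      (use assms in \<open>simp_all add: box_closure_def mult_def lconv_def lr_closure_def juxtapose_def rotate1box_def\<close>)
  then show ?thesis using assms by (simp add: tr_closure lr_trace_def lconv_closed)
qed

lemma fourier_inv_fourier: "w \<in> Q \<Longrightarrow> fourier \<PP> (inv_fourier w) = w"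
  by (rule picture_eq[OF picture_fourier_inv, of "(\<lambda>_. 0)(3 := w)"])
    (simp_all add: fourier_def inv_fourier_def)

text \<open>
  Both sides glue all four ends of \<open>w\<close> to those of its reflection, so the left-right closure is a
  faithful positive form although \<open>lr_trace\<close> need not be a trace.
\<close>

lemma lr_trace_star_mul:
  assumes w: "w \<in> Q"
  shows "0 \<le> lr_trace (mQ (sQ w) w)" "lr_trace (mQ (sQ w) w) = 0 \<Longrightarrow> w = 0"
proof -
  let ?c = "(2, Unshaded)"
  let ?f = "inv_fourier w"
  have f: "?f \<in> box \<PP> ?c" by (rule inv_fourier_closed[OF w])
  have st: "star \<PP> ?c ?f = act1 \<PP> (reflect inv_fourier_tangle) (sQ w)"
    using good_star[OF good_inv_fourier good_reflect_inv_fourier, of "[w]"] w by (simp add: inv_fourier_def)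
  have "lr_closure (mQ (sQ w) w) = box_closure \<PP> ?c (mult \<PP> ?c (star \<PP> ?c ?f) ?f)"
    by (rule picture_eq[OF picture_lr_closure_mult, of "(\<lambda>_. 0)(3 := sQ w, 4 := w)"])
      (use w in \<open>simp_all add: box_closure_def mult_def lr_closure_def st[unfolded inv_fourier_def] inv_fourier_def\<close>)
  then have eq: "lr_trace (mQ (sQ w) w) = tr \<PP> ?c (mult \<PP> ?c (star \<PP> ?c ?f) ?f)"
    using f by (simp add: lr_trace_def tr_closure)
  have pos: "C.pos ?c (mult \<PP> ?c (star \<PP> ?c ?f) ?f)" by (rule C.pos_st_mul[OF f])
  show "0 \<le> lr_trace (mQ (sQ w) w)" unfolding eq by (rule C.pos_trace[OF pos])
  assume "lr_trace (mQ (sQ w) w) = 0"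
  then have "mult \<PP> ?c (star \<PP> ?c ?f) ?f = 0" unfolding eq by (rule C.pos_trace_eq_0[OF pos])
  then have "?f = 0" by (rule C.st_mul_self_eq_0[OF f])
  then show "w = 0" using fourier_inv_fourier[OF w] fourier_zero by simp
qed

lemma lr_trace_juxtapose_comm:
  assumes "w \<in> Q" "m \<in> M" "z \<in> N"
  shows "lr_trace (mQ w (juxtapose \<PP> m z)) = lr_trace (mQ (juxtapose \<PP> m z) w)"
proof -
  have "lr_closure (mQ w (juxtapose \<PP> m z)) = lr_closure (mQ (juxtapose \<PP> m z) w)"
    by (rule picture_eq[OF picture_slide, of "(\<lambda>_. 0)(3 := w, 4 := m, 5 := z)"])
      (use assms in \<open>simp_all add: mult_def lr_closure_def juxtapose_def\<close>)
  then show ?thesis by (simp add: lr_trace_def)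
qed

lemma lr_closure_juxtapose:
  "y \<in> N \<Longrightarrow> z \<in> N \<Longrightarrow> lr_closure (juxtapose \<PP> (bar y) z) =
    mult \<PP> (0, Unshaded) (clN y) (clN z)"
  by (rule picture_eq[OF picture_lr_closure_juxtapose, of "(\<lambda>_. 0)(3 := y, 4 := z)"])
    (simp_all add: mult_def lr_closure_def juxtapose_def rotate1box_def box_closure_def)

lemma juxtapose_mult:
  "m \<in> M \<Longrightarrow> y \<in> N \<Longrightarrow> m' \<in> M \<Longrightarrow> y' \<in> N \<Longrightarrow>
    mQ (juxtapose \<PP> m y) (juxtapose \<PP> m' y') = juxtapose \<PP> (mM m m') (mN y y')"
  by (rule picture_eq[OF picture_juxtapose_mult, of "(\<lambda>_. 0)(3 := m, 4 := y, 5 := m', 6 := y')"])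
    (simp_all add: mult_def juxtapose_def)

lemma juxtapose_star:
  assumes "m \<in> M" "y \<in> N"
  shows "sQ (juxtapose \<PP> m y) = juxtapose \<PP> (sM m) (sN y)"
proof -
  have "sQ (juxtapose \<PP> m y) = act2 \<PP> (reflect juxtapose_tangle) (sM m) (sN y)"
    using good_star[OF good_juxtapose good_reflect_juxtapose, of "[m, y]"] assms by (simp add: juxtapose_def)
  also have "\<dots> = juxtapose \<PP> (sM m) (sN y)"
    by (rule picture_eq[OF picture_juxtapose_star, of "(\<lambda>_. 0)(3 := sM m, 4 := sN y)"])
      (use assms in \<open>simp_all add: juxtapose_def\<close>)
  finally show ?thesis .
qed

lemma bar_mult: "y \<in> N \<Longrightarrow> z \<in> N \<Longrightarrow> bar (mN y z) = mM (bar z) (bar y)"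
  by (rule picture_eq[OF picture_rotate_mult, of "(\<lambda>_. 0)(3 := y, 4 := z)"])
    (simp_all add: mult_def rotate1box_def)

lemma bar_star:
  assumes "y \<in> N"
  shows "sM (bar y) = bar (sN y)"
proof -
  have "sM (bar y) = act1 \<PP> (reflect rotate_tangle) (sN y)"
    using good_star[OF good_rotate good_reflect_rotate, of "[y]"] assms by (simp add: rotate1box_def)
  also have "\<dots> = bar (sN y)"
    by (rule picture_eq[OF picture_rotate_star, of "(\<lambda>_. 0)(3 := sN y)"])
      (use assms in \<open>simp_all add: rotate1box_def\<close>)
  finally show ?thesis .
qed

lemma bar_inv_rotate: "q \<in> M \<Longrightarrow> bar (inv_rotate1box q) = q"
  by (rule picture_eq[OF picture_rotate_inv, of "(\<lambda>_. 0)(3 := q)"])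
    (simp_all add: rotate1box_def inv_rotate1box_def)

lemma inv_rotate_bar: "y \<in> N \<Longrightarrow> inv_rotate1box (bar y) = y"
  by (rule picture_eq[OF picture_inv_rotate, of "(\<lambda>_. 0)(3 := y)"])
    (simp_all add: rotate1box_def inv_rotate1box_def)

text \<open>A surjective anti-homomorphism preserves the unit: multiply \<open>oneN\<close> by the
  preimage of \<open>oneM\<close>.\<close>

lemma bar_one: "bar oneN = oneM"
proof -
  let ?u = "oneM" and ?v = oneN
  have "mM (bar (inv_rotate1box ?u)) (bar ?v) = bar (mN ?v (inv_rotate1box ?u))"
    by (rule bar_mult[symmetric]) (simp_all add: inv_rotate1box_closed)
  then show ?thesis by (simp add: bar_inv_rotate inv_rotate1box_closed bar_closed)
qed

lemma bar_zero: "bar 0 = 0"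
  using bar_add[of 0 0] by simp

lemma bar_diff: "y \<in> N \<Longrightarrow> z \<in> N \<Longrightarrow> bar (y - z) = bar y - bar z"
  using bar_add[of "y - z" z] by simp

lemma bar_inj: "y \<in> N \<Longrightarrow> z \<in> N \<Longrightarrow> bar y = bar z \<Longrightarrow> y = z"
  by (metis inv_rotate_bar)

lemma bar_projection_iff:
  assumes "y \<in> N"
  shows "projM (bar y) \<longleftrightarrow> projN y"
proof -
  have "mM (bar y) (bar y) = bar y \<longleftrightarrow> mN y y = y"
    using assms bar_inj[of "mN y y" y] by (auto simp: bar_mult[symmetric])
  moreover have "sM (bar y) = bar y \<longleftrightarrow> sN y = y"
    using assms bar_inj[of "sN y" y] by (auto simp: bar_star)
  ultimately show ?thesis unfolding C.proj_def using assms by (simp add: bar_closed)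
qed

lemma juxtapose_projection:
  assumes "projM m" "projN y"
  shows "projQ (juxtapose \<PP> m y)"
  unfolding C.proj_def[of "(2, Shaded)"]
  using assms by (simp add: juxtapose_closed juxtapose_mult juxtapose_star)

text \<open>Let \<open>g\<close> times its adjoint be the juxtaposition of \<open>bar y\<close> and
  z. The adjoint of \<open>g\<close> is itself a juxtaposition, so it may be slid to the other side,
  and the trace becomes \<open>lr_trace (mQ (sQ w) w)\<close>. Faithfulness gives
  \<open>w = 0\<close>, and v times the juxtaposition has \<open>w\<close> as a factor.\<close>

lemma trace_lconv_pos:
  assumes y: "posN y" and z: "posN z" and v: "posQ v"
  shows "0 \<le> trN (mN (lconv \<PP> y v) z)"
    and "trN (mN (lconv \<PP> y v) z) = 0 \<longleftrightarrow> mQ v (juxtapose \<PP> (bar y) z) = 0"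
proof -
  obtain a b c where abc: "a \<in> N" "b \<in> N" "c \<in> Q" "y = mN a (sN a)" "z = mN b (sN b)" "v = mQ c (sQ c)"
    using y z v unfolding C.pos_def by blast
  \<comment> \<open>The first leg uses \<open>sN a\<close> rather than \<open>a\<close> because
    \<open>bar\<close> reverses products.\<close>
  define g where "g = juxtapose \<PP> (bar (sN a)) b"
  have g: "g \<in> Q" "sQ g = juxtapose \<PP> (bar a) (sN b)"
    using abc by (simp_all add: g_def juxtapose_closed bar_closed juxtapose_star bar_star)
  have J: "juxtapose \<PP> (bar y) z = mQ g (sQ g)"
    unfolding g(2) using abc by (simp add: g_def juxtapose_mult bar_mult bar_closed)
  define w where "w = mQ (sQ c) g"
  have w: "w \<in> Q" "sQ w = mQ (sQ g) c" using abc g(1) by (simp_all add: w_def C.st_mul)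
  have "lr_trace (mQ v (juxtapose \<PP> (bar y) z)) = lr_trace (mQ (mQ v g) (sQ g))"
    unfolding J using abc(3,6) g(1) by (simp add: C.mul_assoc)
  also have "\<dots> = lr_trace (mQ (sQ g) (mQ v g))"
    unfolding g(2) using abc g(1) by (intro lr_trace_juxtapose_comm) (auto simp: bar_closed)
  also have "mQ (sQ g) (mQ v g) = mQ (sQ w) w"
    unfolding w(2) using abc(3,6) g(1) by (simp add: w_def C.mul_assoc)
  finally have eq: "trN (mN (lconv \<PP> y v) z) = lr_trace (mQ (sQ w) w)"
    using y z v by (simp add: trace_lconv)
  show "0 \<le> trN (mN (lconv \<PP> y v) z)"
    unfolding eq by (rule lr_trace_star_mul(1)[OF w(1)])
  have vJ: "mQ v (juxtapose \<PP> (bar y) z) = mQ (mQ c w) (sQ g)"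
    unfolding J w_def using abc(3,6) g(1) by (simp add: C.mul_assoc)
  show "trN (mN (lconv \<PP> y v) z) = 0 \<longleftrightarrow> mQ v (juxtapose \<PP> (bar y) z) = 0"
  proof
    assume "trN (mN (lconv \<PP> y v) z) = 0"
    then have "w = 0" unfolding eq by (rule lr_trace_star_mul(2)[OF w(1)])
    then show "mQ v (juxtapose \<PP> (bar y) z) = 0" using vJ abc(3) g(1) by simp
  next
    assume "mQ v (juxtapose \<PP> (bar y) z) = 0"
    then show "trN (mN (lconv \<PP> y v) z) = 0"
      using y z v by (simp add: trace_lconv lr_trace_def lr_closure_zero)
  qed
qed

lemma lconv_pos:
  assumes "posN y" "posQ v"
  shows "posN (lconv \<PP> y v)"
proof (rule C.posI)
  show "lconv \<PP> y v \<in> N" using assms by (simp add: lconv_closed)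
  show "0 \<le> trN (mN (lconv \<PP> y v) q)" if "projN q" for q
    by (rule trace_lconv_pos(1)[OF assms(1) C.proj_pos[OF that] assms(2)])
qed

text \<open>The Schur product theorem: cut the closed diagram of \<open>(v * w) q\<close> between each factor and its adjoint.\<close>

lemma conv_pos:
  assumes v: "posQ v" and w: "posQ w"
  shows "posQ (conv \<PP> v w)"
proof (rule C.posI)
  show "conv \<PP> v w \<in> Q" using v w by (simp add: conv_closed)
  fix q assume "projQ q"
  then have "posQ q" by (rule C.proj_pos)
  with v w obtain a b c where abc: "a \<in> Q" "b \<in> Q" "c \<in> Q"
    "v = mQ a (sQ a)" "w = mQ b (sQ b)" "q = mQ c (sQ c)"
    unfolding C.pos_def by blast
  let ?c = "(3, Shaded)"
  \<comment> \<open>The cut passes above \<open>a\<close> and \<open>b\<close> and below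
    \<open>sQ c\<close>; on its far side lie \<open>sQ a\<close>, \<open>sQ b\<close> and
    \<open>c\<close>.\<close>
  define g where "g = act \<PP> schur_tangle (\<lambda>k. [sQ a, sQ b, c] ! k)"
  have g: "g \<in> box \<PP> ?c" unfolding g_def using abc by (intro good_closed[OF good_schur]) simp
  have st: "star \<PP> ?c g = act \<PP> (reflect schur_tangle) (\<lambda>k. [a, b, sQ c] ! k)"
    using good_star[OF good_schur good_reflect_schur, of "[sQ a, sQ b, c]"] abc by (simp add: g_def)
  have "box_closure \<PP> (2, Shaded) (mQ (conv \<PP> v w) q) = box_closure \<PP> ?c (mult \<PP> ?c (star \<PP> ?c g) g)"
    by (rule picture_eq[OF picture_schur, of "(\<lambda>_. 0)(3 := a, 4 := sQ a, 5 := b, 6 := sQ b, 7 := c, 8 := sQ c)"])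
      (use abc in \<open>simp_all add: box_closure_def mult_def conv_def st[unfolded g_def] g_def\<close>)
  then have "trQ (mQ (conv \<PP> v w) q) = tr \<PP> ?c (mult \<PP> ?c (star \<PP> ?c g) g)"
    using abc g by (simp add: tr_closure conv_closed)
  then show "0 \<le> trQ (mQ (conv \<PP> v w) q)"
    using C.pos_trace[OF C.pos_st_mul[OF g]] by simp
qed

text \<open>The base case for convolution powers. As \<open>cap_cup\<close> need not be a multiple
  of a projection, positivity is tested by traces: paired with c times its adjoint, the diagram
  falls into two mirror halves.\<close>

lemma cap_cup_pos: "posQ (cap_cup \<PP>)"
proof (rule C.posI)
  show "cap_cup \<PP> \<in> Q" by (rule cap_cup_closed)
  fix q assume "projQ q"
  then have "posQ q" by (rule C.proj_pos)
  then obtain c where c: "c \<in> Q" "q = mQ c (sQ c)" unfolding C.pos_def by blast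
  let ?c = "(1, Shaded)"
  define g where "g = act1 \<PP> cap_tangle c"
  have g: "g \<in> box \<PP> ?c" unfolding g_def using c by (intro good_closed[OF good_cap]) simp
  have st: "star \<PP> ?c g = act1 \<PP> (reflect cap_tangle) (sQ c)"
    using good_star[OF good_cap good_reflect_cap, of "[c]"] c by (simp add: g_def)
  have "box_closure \<PP> (2, Shaded) (mQ (cap_cup \<PP>) q) = box_closure \<PP> ?c (mult \<PP> ?c g (star \<PP> ?c g))"
    by (rule picture_eq[OF picture_cap, of "(\<lambda>_. 0)(3 := c, 4 := sQ c)"])
      (use c in \<open>simp_all add: box_closure_def mult_def cap_cup_sem st[unfolded g_def] g_def\<close>)
  then have "trQ (mQ (cap_cup \<PP>) q) = tr \<PP> ?c (mult \<PP> ?c g (star \<PP> ?c g))"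
    using c g by (simp add: tr_closure cap_cup_closed)
  then show "0 \<le> trQ (mQ (cap_cup \<PP>) q)"
    using C.trace_nonneg[OF g] by simp
qed

lemma conv_power_pos: "posQ v \<Longrightarrow> posQ (conv_power \<PP> v k)"
  by (induction k) (auto intro: cap_cup_pos conv_pos)

lemma lconv_conv_power:
  assumes "y \<in> N" "v \<in> Q"
  shows "lconv \<PP> y (conv_power \<PP> v k) = (conv_with v ^^ k) y"
  using assms by (induction k) (simp_all add: lconv_cap_cup lconv_conv conv_power_closed)

section \<open>Convolution on the right\<close>

lemma trace_rconv:
  assumes "v \<in> Q" "y \<in> N" "m \<in> M"
  shows "trM (mM (rconv \<PP> v (bar y)) m) = trQ (mQ v (juxtapose \<PP> m y))"
proof -
  have "box_closure \<PP> (1, Shaded) (mM (rconv \<PP> v (bar y)) m) =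
      box_closure \<PP> (2, Shaded) (mQ v (juxtapose \<PP> m y))"
    by (rule picture_eq[OF picture_trace_rconv, of "(\<lambda>_. 0)(3 := v, 4 := y, 5 := m)"])
      (use assms in \<open>simp_all add: box_closure_def mult_def rconv_def juxtapose_def rotate1box_def\<close>)
  then show ?thesis using assms by (simp add: tr_closure rconv_closed juxtapose_closed bar_closed)
qed

text \<open>On this side the diagram closes to the ordinary trace \<open>trQ\<close>, so the pairing
  with m is the trace of a product of two positive 2-boxes.\<close>

lemma rconv_pos:
  assumes v: "posQ v" and p: "projN p"
  shows "C.pos (1, Shaded) (rconv \<PP> v (bar p))"
proof (rule C.posI)
  show "rconv \<PP> v (bar p) \<in> M" using v p by (simp add: rconv_closed bar_closed)
  fix m assume m: "projM m"
  have "0 \<le> trQ (mQ v (juxtapose \<PP> m p))"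
    by (intro C.pos_trace_mul_nonneg(1) v C.proj_pos juxtapose_projection m p)
  then show "0 \<le> trM (mM (rconv \<PP> v (bar p)) m)"
    using v p m by (simp add: trace_rconv)
qed

end

section \<open>The equivalent conditions\<close>

context cstar_planar_algebra
begin

context
  fixes v assumes v: "posQ v"
begin

definition support_join :: 'a where
  "support_join = C.psup (2, Shaded) (range (\<lambda>k. C.supp (2, Shaded) (conv_power \<PP> v k)))"

lemma range_supports: "q \<in> range (\<lambda>k. C.supp (2, Shaded) (conv_power \<PP> v k)) \<Longrightarrow> projQ q"
  using C.supp(1) conv_power_pos[OF v] by auto

lemma support_join_projection: "projQ support_join"
  unfolding support_join_def using range_supports by (rule C.psup(1))

text \<open>Vanishing against a projection passes from the supremum to its members, from a support
  to the convolution power itself, and from there to the trace pairing of 1-boxes.\<close>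

lemma support_join_juxtapose_eq_0:
  assumes p: "projN p" and q: "projN q"
  shows "mQ support_join (juxtapose \<PP> (bar p) q) = 0 \<longleftrightarrow>
    (\<forall>k. trN (mN ((conv_with v ^^ k) p) q) = 0)"
proof -
  have J: "projQ (juxtapose \<PP> (bar p) q)"
    using p q by (intro juxtapose_projection) (simp_all add: bar_projection_iff)
  have "mQ support_join (juxtapose \<PP> (bar p) q) = 0 \<longleftrightarrow>
      (\<forall>k. mQ (C.supp (2, Shaded) (conv_power \<PP> v k)) (juxtapose \<PP> (bar p) q) = 0)"
    unfolding support_join_def using C.psup_mul_eq_0[OF range_supports J] by simp
  also have "\<dots> \<longleftrightarrow> (\<forall>k. mQ (conv_power \<PP> v k) (juxtapose \<PP> (bar p) q) = 0)"
    using C.supp_mul_eq_0[OF conv_power_pos[OF v]] J by simp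
  also have "\<dots> \<longleftrightarrow> (\<forall>k. trN (mN (lconv \<PP> p (conv_power \<PP> v k)) q) = 0)"
    using trace_lconv_pos(2)[OF C.proj_pos[OF p] C.proj_pos[OF q] conv_power_pos[OF v]] by simp
  finally show ?thesis using p v by (simp add: lconv_conv_power)
qed

lemma trace_support_join_eq_0:
  assumes p: "projN p" and q: "projN q"
  shows "trN (mN (lconv \<PP> p support_join) q) = 0 \<longleftrightarrow>
    (\<forall>k. trN (mN ((conv_with v ^^ k) p) q) = 0)"
  using trace_lconv_pos(2)[OF C.proj_pos[OF p] C.proj_pos[OF q] C.proj_pos[OF support_join_projection]]
    support_join_juxtapose_eq_0[OF assms] by simp

lemma lconv_positive_map:
  "positive_map (scal \<PP>) N mN sN oneN trN (conv_with v)"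
  using v by unfold_locales (simp_all add: lconv_closed lconv_add_left lconv_scal_left lconv_pos)

interpretation N: positive_map "scal \<PP>" N mN sN oneN trN "conv_with v"
  by (rule lconv_positive_map)

text \<open>Minimal projections suffice: each nonzero projection dominates one, and the overlaps are
  monotone in both arguments.\<close>

lemma connecting_iff_minimal:
  "N.connecting_map \<longleftrightarrow> (\<forall>p q. C.minimal_proj (1, Unshaded) p \<longrightarrow> C.minimal_proj (1, Unshaded) q \<longrightarrow>
     mQ support_join (juxtapose \<PP> (bar p) q) \<noteq> 0)"
proof
  assume "N.connecting_map"
  then show "\<forall>p q. C.minimal_proj (1, Unshaded) p \<longrightarrow> C.minimal_proj (1, Unshaded) q \<longrightarrow> mQ support_join (juxtapose \<PP> (bar p) q) \<noteq> 0"
    using support_join_juxtapose_eq_0 unfolding N.connecting_map_def C.minimal_proj_def by blast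
next
  assume min: "\<forall>p q. C.minimal_proj (1, Unshaded) p \<longrightarrow> C.minimal_proj (1, Unshaded) q \<longrightarrow> mQ support_join (juxtapose \<PP> (bar p) q) \<noteq> 0"
  show "N.connecting_map"
    unfolding N.connecting_map_def
  proof (intro allI impI)
    fix p q assume p: "projN p" "p \<noteq> 0" and q: "projN q" "q \<noteq> 0"
    obtain p' where p': "C.minimal_proj (1, Unshaded) p'" "C.le (1, Unshaded) p' p" using C.ex_minimal_proj[OF p] by blast
    obtain q' where q': "C.minimal_proj (1, Unshaded) q'" "C.le (1, Unshaded) q' q" using C.ex_minimal_proj[OF q] by blast
    have pr: "projN p'" "projN q'" using p' q' by (auto simp: C.minimal_proj_def)
    then obtain k where k: "trN (mN ((conv_with v ^^ k) p') q') \<noteq> 0"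
      using min p' q' support_join_juxtapose_eq_0 by blast
    have "trN (mN ((conv_with v ^^ k) p') q')
        \<le> trN (mN ((conv_with v ^^ k) p) q)"
      by (intro N.trace_funpow_mono p' q' C.proj_pos pr p q)
    moreover have "0 \<le> trN (mN ((conv_with v ^^ k) p') q')"
      by (intro C.pos_trace_mul_nonneg(1) N.funpow_pos C.proj_pos pr)
    ultimately have "trN (mN ((conv_with v ^^ k) p) q) \<noteq> 0"
      using k by (metis order_antisym)
    then show "\<exists>k. trN (mN ((conv_with v ^^ k) p) q) \<noteq> 0" by blast
  qed
qed

lemma connecting_iff_range_projection:
  "N.connecting_map \<longleftrightarrow> (\<forall>p. projN p \<longrightarrow> p \<noteq> 0 \<longrightarrow>
     C.supp (1, Unshaded) (lconv \<PP> p support_join) = oneN)"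
proof -
  have "C.supp (1, Unshaded) (lconv \<PP> p support_join) = oneN \<longleftrightarrow>
      (\<forall>q. projN q \<longrightarrow> q \<noteq> 0 \<longrightarrow> (\<exists>k. trN (mN ((conv_with v ^^ k) p) q) \<noteq> 0))"
    if p: "projN p" for p
    using C.supp_eq_unit_iff[OF lconv_pos[OF C.proj_pos[OF p] C.proj_pos[OF support_join_projection]]]
      trace_support_join_eq_0[OF p]
    by (auto simp: C.faithful_on_projections_def)
  then show ?thesis unfolding N.connecting_map_def by blast
qed

text \<open>Both factors are positive 2-boxes, although their product need not be.\<close>

lemma trace_minimal_iff:
  assumes p: "projN p" and q: "projN q"
  shows "trQ (mQ support_join (juxtapose \<PP> (bar p) q)) = 0 \<longleftrightarrow>
    mQ support_join (juxtapose \<PP> (bar p) q) = 0"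
proof -
  have "projQ (juxtapose \<PP> (bar p) q)"
    using p q by (intro juxtapose_projection) (simp_all add: bar_projection_iff)
  then show ?thesis
    using C.pos_trace_mul_nonneg(2)[OF C.proj_pos[OF support_join_projection] C.proj_pos] by auto
qed

text \<open>Invariance of \<open>q = bar p\<close> under \<open>v * _\<close> is invariance of \<open>1 - p\<close> under \<open>_ * v\<close>.\<close>

lemma irreducible_iff_rconv:
  "N.irreducible_map \<longleftrightarrow> (\<forall>q. projM q \<longrightarrow>
     (\<exists>l::real. 0 < l \<and> C.le (1, Shaded) (rconv \<PP> v q) (scal \<PP> (of_real l) q)) \<longrightarrow>
     q = 0 \<or> q = oneM)"
proof -
  let ?u = oneN and ?w = "oneM"
  \<comment> \<open>On the shaded side stands \<open>trQ\<close> of v times a juxtaposition, on the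
    unshaded side the left-right closure of the same product. The numbers need not agree, but each
    vanishes iff the product does.\<close>
  have key: "(\<exists>l::real. 0 < l \<and> C.le (1, Shaded) (rconv \<PP> v (bar p)) (scal \<PP> (of_real l) (bar p))) \<longleftrightarrow>
      trN (mN (lconv \<PP> (?u - p) v) (?u - (?u - p))) = 0" if p: "projN p" for p
  proof -
    have c: "projN (?u - p)" by (rule C.proj_compl[OF p])
    have b: "projM (bar p)" using p by (simp add: bar_projection_iff)
    have J: "projQ (juxtapose \<PP> (bar (?u - p)) p)"
      using p c by (intro juxtapose_projection) (simp_all add: bar_projection_iff)
    have "(\<exists>l::real. 0 < l \<and> C.le (1, Shaded) (rconv \<PP> v (bar p)) (scal \<PP> (of_real l) (bar p))) \<longleftrightarrow>
        trM (mM (rconv \<PP> v (bar p)) (?w - bar p)) = 0"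
      by (rule C.dominated_by_proj_iff[OF rconv_pos[OF v p] b])
    also have "?w - bar p = bar (?u - p)" using p by (simp add: bar_diff bar_one)
    also have "trM (mM (rconv \<PP> v (bar p)) (bar (?u - p))) = 0 \<longleftrightarrow>
        trQ (mQ v (juxtapose \<PP> (bar (?u - p)) p)) = 0"
      using v p c by (simp add: trace_rconv bar_closed)
    also have "\<dots> \<longleftrightarrow> mQ v (juxtapose \<PP> (bar (?u - p)) p) = 0"
      using C.pos_trace_mul_nonneg(2)[OF v C.proj_pos[OF J]] by auto
    also have "\<dots> \<longleftrightarrow> trN (mN (lconv \<PP> (?u - p) v) p) = 0"
      by (rule trace_lconv_pos(2)[OF C.proj_pos[OF c] C.proj_pos[OF p] v, symmetric])
    finally show ?thesis by simp
  qed
  have bar0: "bar p = 0 \<longleftrightarrow> ?u - p = ?u" and bar1: "bar p = ?w \<longleftrightarrow> ?u - p = 0" if "projN p" for p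
    using bar_inj[of p 0] bar_inj[of p ?u] that by (auto simp: bar_zero bar_one)
  show ?thesis
  proof
    assume irr: "N.irreducible_map"
    show "\<forall>q. projM q \<longrightarrow>
        (\<exists>l::real. 0 < l \<and> C.le (1, Shaded) (rconv \<PP> v q) (scal \<PP> (of_real l) q)) \<longrightarrow> q = 0 \<or> q = ?w"
    proof (intro allI impI)
      fix q assume q: "projM q"
        and l: "\<exists>l::real. 0 < l \<and> C.le (1, Shaded) (rconv \<PP> v q) (scal \<PP> (of_real l) q)"
      define p where "p = inv_rotate1box q"
      have qp: "q = bar p" using q by (simp add: p_def bar_inv_rotate)
      have "p \<in> N" using q by (simp add: p_def inv_rotate1box_closed)
      then have p: "projN p" using q bar_projection_iff by (simp add: qp)
      have "?u - p = 0 \<or> ?u - p = ?u"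
        using irr key[OF p] l C.proj_compl[OF p] unfolding N.irreducible_map_def qp by blast
      then show "q = 0 \<or> q = ?w" using bar0[OF p] bar1[OF p] unfolding qp by blast
    qed
  next
    assume R: "\<forall>q. projM q \<longrightarrow>
        (\<exists>l::real. 0 < l \<and> C.le (1, Shaded) (rconv \<PP> v q) (scal \<PP> (of_real l) q)) \<longrightarrow> q = 0 \<or> q = ?w"
    show "N.irreducible_map"
      unfolding N.irreducible_map_def
    proof (intro allI impI)
      fix p assume p: "projN p" and inv: "trN (mN (lconv \<PP> p v) (?u - p)) = 0"
      have c: "projN (?u - p)" by (rule C.proj_compl[OF p])
      have "projM (bar (?u - p))" using c by (simp add: bar_projection_iff)
      moreover have "\<exists>l::real. 0 < l \<and> C.le (1, Shaded) (rconv \<PP> v (bar (?u - p))) (scal \<PP> (of_real l) (bar (?u - p)))"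
        using key[OF c] inv by simp
      ultimately have "bar (?u - p) = 0 \<or> bar (?u - p) = ?w" using R by blast
      then show "p = 0 \<or> p = ?u" using bar0[OF c] bar1[OF c] by auto
    qed
  qed
qed

text \<open>Proved together because they share one cycle: irreducibility makes the shifted iterates
  faithful, these give positive overlaps, overlaps connect, and connecting maps are
  irreducible.\<close>

lemma irreducible_iff_overlap:
  "N.irreducible_map \<longleftrightarrow> (\<forall>y z. posN y \<longrightarrow> posN z \<longrightarrow> y \<noteq> 0 \<longrightarrow> z \<noteq> 0 \<longrightarrow>
     inner1 \<PP> y z = 0 \<longrightarrow> (\<exists>k<dim N. 0 < inner1 \<PP> (lconv \<PP> y (conv_power \<PP> v k)) z))"
  (is "_ \<longleftrightarrow> ?S8")
  and irreducible_iff_strictly_positive: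
  "0 < \<gamma> \<Longrightarrow> N.irreducible_map \<longleftrightarrow> (\<forall>p. projN p \<longrightarrow> p \<noteq> 0 \<longrightarrow>
     strictly_positive \<PP> (1, Unshaded)
       (lconv \<PP> p (conv_power \<PP> (scal \<PP> (of_real \<gamma>) (cap_cup \<PP>) + v) (dim N - 1))))"
  (is "_ \<Longrightarrow> _ \<longleftrightarrow> ?S7 \<gamma>")
  and irreducible_iff_connecting: "N.irreducible_map \<longleftrightarrow> N.connecting_map"
proof -
  let ?u = oneN
  have inner: "inner1 \<PP> y z = trN (mN y z)" if "y \<in> N" "posN z" for y z
    using that by (simp add: inner1_def C.pos_self_adjoint C.trace_comm)
  have vQ: "v \<in> Q" using v by simp
  have S7_iff: "N.irreducible_map \<longleftrightarrow> ?S7 \<gamma>" and overlap: "N.irreducible_map \<Longrightarrow> posN y \<Longrightarrow> y \<noteq> 0 \<Longrightarrow> posN z \<Longrightarrow> z \<noteq> 0 \<Longrightarrow>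
      \<exists>k<dim N. 0 < trN (mN ((conv_with v ^^ k) y) z)"
    and connect: "N.irreducible_map \<Longrightarrow> N.connecting_map"
    if \<gamma>: "0 < \<gamma>" for \<gamma> y z
  proof -
    interpret P: shifted_positive_map "scal \<PP>" N mN sN ?u trN "conv_with v" \<gamma>
      by unfold_locales (rule \<gamma>)
    let ?e = "scal \<PP> (of_real \<gamma>) (cap_cup \<PP>) + v"
    have eQ: "?e \<in> Q" using vQ by (simp add: cap_cup_closed)
    \<comment> \<open>Convolution with \<open>cap_cup\<close> is the identity, so convolution with
      \<open>?e\<close> is the shifted map.\<close>
    have step: "lconv \<PP> y ?e = P.\<Psi> y" if "y \<in> N" for y
      using that vQ by (simp add: lconv_add_right lconv_scal_right lconv_cap_cup cap_cup_closed P.\<Psi>_def)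
    have "lconv \<PP> y (conv_power \<PP> ?e k) = (P.\<Psi> ^^ k) y" if "y \<in> N" for y k
      using that by (induction k)
        (simp_all add: lconv_cap_cup lconv_conv conv_power_closed eQ step)
    then have strict: "strictly_positive \<PP> (1, Unshaded) (lconv \<PP> p (conv_power \<PP> ?e k)) \<longleftrightarrow>
        C.faithful_on_projections (1, Unshaded) ((P.\<Psi> ^^ k) p)" if "projN p" for p k
      using that C.invertible_iff[OF P.shift.funpow_pos[OF C.proj_pos[OF that]], of k]
        P.shift.funpow_pos[OF C.proj_pos[OF that], of k]
      by (simp add: strictly_positive_def pos_eq[symmetric])
    have faithful: "C.faithful_on_projections (1, Unshaded) ((P.\<Psi> ^^ (dim N - 1)) p)"
      if "N.irreducible_map" "projN p" "p \<noteq> 0" for p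
      by (rule P.irreducible_imp_faithful[OF that])
    have overlap': "\<exists>k<dim N. 0 < trN (mN ((conv_with v ^^ k) y) z)"
      if "\<And>p. projN p \<Longrightarrow> p \<noteq> 0 \<Longrightarrow> C.faithful_on_projections (1, Unshaded) ((P.\<Psi> ^^ (dim N - 1)) p)"
        "posN y" "y \<noteq> 0" "posN z" "z \<noteq> 0" for y z
      by (rule P.faithful_imp_positive_overlap[OF that])
    have connect': "N.connecting_map"
      if f: "\<And>p. projN p \<Longrightarrow> p \<noteq> 0 \<Longrightarrow> C.faithful_on_projections (1, Unshaded) ((P.\<Psi> ^^ (dim N - 1)) p)"
      unfolding N.connecting_map_def
    proof (intro allI impI)
      fix p q assume "projN p" "p \<noteq> 0" "projN q" "q \<noteq> 0"
      then obtain k where "0 < trN (mN ((conv_with v ^^ k) p) q)"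
        using overlap'[OF f C.proj_pos _ C.proj_pos] by blast
      then show "\<exists>k. trN (mN ((conv_with v ^^ k) p) q) \<noteq> 0"
        by (metis order_less_irrefl)
    qed
    show "N.irreducible_map \<longleftrightarrow> ?S7 \<gamma>"
      using strict faithful connect' N.connecting_imp_irreducible by blast
    show "\<exists>k<dim N. 0 < trN (mN ((conv_with v ^^ k) y) z)"
      if "N.irreducible_map" "posN y" "y \<noteq> 0" "posN z" "z \<noteq> 0"
      using overlap' faithful that by blast
    show "N.connecting_map" if "N.irreducible_map" using connect' faithful that by blast
  qed
  show "0 < \<gamma> \<Longrightarrow> N.irreducible_map \<longleftrightarrow> ?S7 \<gamma>" by (rule S7_iff)
  show "N.irreducible_map \<longleftrightarrow> N.connecting_map"
    using connect[OF zero_less_one] N.connecting_imp_irreducible by blast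
  show "N.irreducible_map \<longleftrightarrow> ?S8"
  proof
    assume "N.irreducible_map"
    then show ?S8
      using overlap[OF zero_less_one] vQ by (auto simp: inner lconv_closed lconv_conv_power conv_power_closed)
  next
    assume S8: ?S8
    \<comment> \<open>\<open>?S8\<close> is applied to p and \<open>?u - p\<close>: they are
      orthogonal, and invariance of p makes every overlap vanish.\<close>
    show "N.irreducible_map"
      unfolding N.irreducible_map_def
    proof (intro allI impI, rule ccontr)
      fix p assume p: "projN p" "trN (mN (lconv \<PP> p v) (?u - p)) = 0"
        and ne: "\<not> (p = 0 \<or> p = ?u)"
      have c: "projN (?u - p)" by (rule C.proj_compl[OF p(1)])
      have "mN p (?u - p) = 0" using p(1) by (simp add: C.mul_diff_right)
      then have "inner1 \<PP> p (?u - p) = 0" using p(1) C.proj_pos[OF c] by (simp add: inner)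
      then obtain k where "0 < inner1 \<PP> (lconv \<PP> p (conv_power \<PP> v k)) (?u - p)"
        using S8 C.proj_pos[OF p(1)] C.proj_pos[OF c] ne by fastforce
      then have "0 < trN (mN ((conv_with v ^^ k) p) (?u - p))"
        using p(1) C.proj_pos[OF c] vQ by (simp add: inner lconv_conv_power)
      then show False using N.invariant_projection[OF p] by simp
    qed
  qed
qed

lemma irreducible_iff_irreducible_on_1boxes:
  assumes "v = fourier \<PP> x"
  shows "N.irreducible_map \<longleftrightarrow> irreducible_on_1boxes \<PP> x"
  unfolding N.irreducible_map_def irreducible_on_1boxes_def assms[symmetric] proj_eq[symmetric] le_eq[symmetric]
  using C.dominated_by_proj_iff[OF N.map_pos[OF C.proj_pos]] by blast

end

text \<open>The closure of a nonzero projection has nonzero trace, so on a line it is a nonzero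
  multiple of the unit, and so is the product of two closures.\<close>

lemma trace_closures_nonzero:
  assumes dim1: "dim (box \<PP> (0, Unshaded)) = 1"
    and p: "projN p" "p \<noteq> 0" and q: "projN q" "q \<noteq> 0"
  shows "tr \<PP> (0, Unshaded) (mult \<PP> (0, Unshaded) (clN p)
    (clN q)) \<noteq> 0"
proof -
  let ?c = "(0, Unshaded)"
  obtain B where B: "B \<subseteq> box \<PP> ?c" "independent B" "box \<PP> ?c \<subseteq> span B" "card B = 1"
    using basis_exists[of "box \<PP> ?c"] dim1 by auto
  obtain b where b: "B = {b}" using B(4) by (rule card_1_singletonE)
  have mem: "\<exists>r. x = scal \<PP> r b" if "x \<in> box \<PP> ?c" for x
    using that B(3) by (auto simp: b span_singleton)
  obtain t where t: "one \<PP> ?c = scal \<PP> t b" using mem C.unit_closed by blast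
  have cl: "\<exists>r. r \<noteq> 0 \<and> clN p = scal \<PP> r (one \<PP> ?c)"
    if p: "projN p" "p \<noteq> 0" for p
  proof -
    have "clN p \<in> box \<PP> ?c"
      unfolding box_closure_def using p by (intro good_closed[OF good_closure]) simp
    then obtain r where r: "clN p = scal \<PP> r b" using mem by blast
    have tp: "trN p \<noteq> 0" using C.pos_trace_eq_0[OF C.proj_pos[OF p(1)]] p(2) by blast
    have eq: "trN p = tr \<PP> ?c (clN p)"
      using p(1) by (simp add: tr_closure)
    \<comment> \<open>If the unit were 0, every 0-box would be 0, including the closure of
      p.\<close>
    have "t \<noteq> 0"
    proof
      assume "t = 0"
      then have "one \<PP> ?c = 0" using t by simp
      then have "clN p = 0"
        using C.unit_left[OF \<open>clN p \<in> box \<PP> ?c\<close>]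
          C.mul_zero_left[OF \<open>clN p \<in> box \<PP> ?c\<close>] by simp
      then show False using tp eq by simp
    qed
    moreover have "r \<noteq> 0" using tp eq r by auto
    ultimately show ?thesis using r t by (intro exI[of _ "r / t"]) simp
  qed
  obtain r s where rs: "r \<noteq> 0" "s \<noteq> 0" "clN p = scal \<PP> r (one \<PP> ?c)"
    "clN q = scal \<PP> s (one \<PP> ?c)"
    using cl[OF p] cl[OF q] by blast
  have "tr \<PP> ?c (one \<PP> ?c) \<noteq> 0"
  proof
    assume "tr \<PP> ?c (one \<PP> ?c) = 0"
    then have "tr \<PP> ?c (clN p) = 0" by (simp add: rs(3) C.trace_scl)
    then have "trN p = 0" using p(1) by (simp add: tr_closure)
    then show False using C.pos_trace_eq_0[OF C.proj_pos[OF p(1)]] p(2) by blast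
  qed
  then show ?thesis
    unfolding rs(3,4) using rs(1,2)
    by (simp add: C.mul_scl_left C.mul_scl_right C.trace_scl)
qed

end

text \<open>The Jones projection enters as \<gamma> times \<open>cap_cup\<close> with any positive
  \<gamma>: convolution with it is multiplication by \<gamma>, whatever the normalization.\<close>

theorem theorem3p5:
  fixes \<PP> :: "('a::ab_group_add, 'b) cstar_planar_alg_scheme" and x e1 :: 'a and \<gamma> :: real
  assumes "cstar_planar_algebra \<PP>"
    and "x \<in> box \<PP> (2, Unshaded)"
    and "F_positive \<PP> x"
    and "0 < \<gamma>" and "e1 = scal \<PP> (of_real \<gamma>) (cap_cup \<PP>)"
  shows
    "let xh = fourier \<PP> x;
         B = projection_sup \<PP> (2, Shaded)
               (range (\<lambda>k. range_projection \<PP> (2, Shaded) (conv_power \<PP> xh k)));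
         d = vector_space.dim (scal \<PP>) (box \<PP> (1, Unshaded));
         cl = box_closure \<PP> (1, Unshaded);
         minimal = minimal_projection \<PP> (1, Unshaded);
         S1 = (B = one \<PP> (2, Shaded) \<and>
               vector_space.dim (scal \<PP>) (box \<PP> (0, Unshaded)) = 1);
         S2 = (B = one \<PP> (2, Shaded) \<and>
               (\<forall>p1 p2. minimal p1 \<longrightarrow> minimal p2 \<longrightarrow>
                  tr \<PP> (0, Unshaded) (mult \<PP> (0, Unshaded) (cl p1) (cl p2)) \<noteq> 0));
         S3 = (\<forall>p1 p2. minimal p1 \<longrightarrow> minimal p2 \<longrightarrow>
                  mult \<PP> (2, Shaded) B (juxtapose \<PP> (rotate1box \<PP> p1) p2) \<noteq> 0);
         S4 = (\<forall>p1 p2. minimal p1 \<longrightarrow> minimal p2 \<longrightarrow>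
                  tr \<PP> (2, Shaded)
                    (mult \<PP> (2, Shaded) B (juxtapose \<PP> (rotate1box \<PP> p1) p2)) \<noteq> 0);
         S5 = (\<forall>p. projection \<PP> (1, Unshaded) p \<longrightarrow> p \<noteq> 0 \<longrightarrow>
                  range_projection \<PP> (1, Unshaded) (lconv \<PP> p B) = one \<PP> (1, Unshaded));
         S6 = irreducible_on_1boxes \<PP> x;
         S7 = (\<forall>p. projection \<PP> (1, Unshaded) p \<longrightarrow> p \<noteq> 0 \<longrightarrow>
                  strictly_positive \<PP> (1, Unshaded)
                    (lconv \<PP> p (conv_power \<PP> (e1 + xh) (d - 1))));
         S8 = (\<forall>y1 y2. positive \<PP> (1, Unshaded) y1 \<longrightarrow> positive \<PP> (1, Unshaded) y2 \<longrightarrow>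
                  y1 \<noteq> 0 \<longrightarrow> y2 \<noteq> 0 \<longrightarrow> inner1 \<PP> y1 y2 = 0 \<longrightarrow>
                  (\<exists>k0<d. 0 < inner1 \<PP> (lconv \<PP> y1 (conv_power \<PP> xh k0)) y2));
         S9 = (\<forall>q. projection \<PP> (1, Shaded) q \<longrightarrow>
                  (\<exists>l::real. 0 < l \<and>
                     leq \<PP> (1, Shaded) (rconv \<PP> xh q) (scal \<PP> (of_real l) q)) \<longrightarrow>
                  q = 0 \<or> q = one \<PP> (1, Shaded))
     in (S1 \<longrightarrow> S2) \<and> (S2 \<longrightarrow> S3) \<and>
        (S3 \<longleftrightarrow> S4) \<and> (S4 \<longleftrightarrow> S5) \<and> (S5 \<longleftrightarrow> S6) \<and> (S6 \<longleftrightarrow> S7) \<and> (S7 \<longleftrightarrow> S8) \<and> (S8 \<longleftrightarrow> S9)"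
proof -
  interpret cstar_planar_algebra \<PP> by (rule assms(1))
  define v where "v = fourier \<PP> x"
  define B where "B = support_join v"
  have v: "posQ v" using assms(3) by (simp add: F_positive_def v_def pos_eq)
  interpret N: positive_map "scal \<PP>" N mN sN oneN trN "conv_with v"
    by (rule lconv_positive_map[OF v])
  have B: "projection_sup \<PP> (2, Shaded)
      (range (\<lambda>k. range_projection \<PP> (2, Shaded) (conv_power \<PP> v k))) = B"
    unfolding B_def support_join_def[OF v] supp_eq psup_eq ..
  have min: "minimal_projection \<PP> (1, Unshaded) p \<Longrightarrow> projN p \<and> p \<noteq> 0" for p
    unfolding minimal_eq[symmetric] C.minimal_proj_def by blast
  let ?S2 = "\<forall>p1 p2. minimal_projection \<PP> (1, Unshaded) p1 \<longrightarrow> minimal_projection \<PP> (1, Unshaded) p2 \<longrightarrow>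
      tr \<PP> (0, Unshaded) (mult \<PP> (0, Unshaded) (clN p1)
        (clN p2)) \<noteq> 0"
  have S12: "?S2" if "dim (box \<PP> (0, Unshaded)) = 1"
    using trace_closures_nonzero[OF that] min by blast
  \<comment> \<open>From here on each statement is matched with \<open>N.irreducible_map\<close>, so
    that the chain of equivalences holds by rewriting.\<close>
  have S3: "(\<forall>p1 p2. minimal_projection \<PP> (1, Unshaded) p1 \<longrightarrow> minimal_projection \<PP> (1, Unshaded) p2 \<longrightarrow>
      mQ B (juxtapose \<PP> (bar p1) p2) \<noteq> 0) \<longleftrightarrow> N.irreducible_map"
    unfolding irreducible_iff_connecting[OF v] connecting_iff_minimal[OF v] minimal_eq B_def ..
  have S4: "(\<forall>p1 p2. minimal_projection \<PP> (1, Unshaded) p1 \<longrightarrow> minimal_projection \<PP> (1, Unshaded) p2 \<longrightarrow>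
      trQ (mQ B (juxtapose \<PP> (bar p1) p2)) \<noteq> 0) \<longleftrightarrow> N.irreducible_map"
    unfolding S3[symmetric] B_def using trace_minimal_iff[OF v] min by blast
  have S5: "(\<forall>p. projection \<PP> (1, Unshaded) p \<longrightarrow> p \<noteq> 0 \<longrightarrow>
      range_projection \<PP> (1, Unshaded) (lconv \<PP> p B) = oneN) \<longleftrightarrow> N.irreducible_map"
    unfolding irreducible_iff_connecting[OF v] connecting_iff_range_projection[OF v] proj_eq supp_eq B_def ..
  \<comment> \<open>With B the unit, a vanishing product means that the juxtaposition itself is 0.
    Its left-right closure, the product of the two closures, is then 0 as well.\<close>
  have S23: "N.irreducible_map" if B1: "B = one \<PP> (2, Shaded)" and tr: "?S2"
    unfolding S3[symmetric]
  proof (intro impI allI notI)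
    fix p q assume pq: "minimal_projection \<PP> (1, Unshaded) p" "minimal_projection \<PP> (1, Unshaded) q"
      and 0: "mQ B (juxtapose \<PP> (bar p) q) = 0"
    have N: "p \<in> N" "q \<in> N" using min[OF pq(1)] min[OF pq(2)] C.proj_closed by blast+
    then have "juxtapose \<PP> (bar p) q = 0" using 0 by (simp add: B1 juxtapose_closed bar_closed)
    then have "mult \<PP> (0, Unshaded) (clN p) (clN q) = 0"
      using lr_closure_juxtapose[OF N] by (simp only: lr_closure_zero)
    then show False using tr pq C.trace_zero by metis
  qed
  have S7: "(\<forall>p. projection \<PP> (1, Unshaded) p \<longrightarrow> p \<noteq> 0 \<longrightarrow>
      strictly_positive \<PP> (1, Unshaded) (lconv \<PP> p (conv_power \<PP> (e1 + v) (dim N - 1)))) \<longleftrightarrow> N.irreducible_map"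
    unfolding irreducible_iff_strictly_positive[OF v assms(4)] proj_eq assms(5) ..
  have S8: "(\<forall>y1 y2. positive \<PP> (1, Unshaded) y1 \<longrightarrow> positive \<PP> (1, Unshaded) y2 \<longrightarrow>
      y1 \<noteq> 0 \<longrightarrow> y2 \<noteq> 0 \<longrightarrow> inner1 \<PP> y1 y2 = 0 \<longrightarrow>
      (\<exists>k0<dim N. 0 < inner1 \<PP> (lconv \<PP> y1 (conv_power \<PP> v k0)) y2)) \<longleftrightarrow> N.irreducible_map"
    unfolding irreducible_iff_overlap[OF v] pos_eq ..
  have S9: "(\<forall>q. projection \<PP> (1, Shaded) q \<longrightarrow>
      (\<exists>l::real. 0 < l \<and> leq \<PP> (1, Shaded) (rconv \<PP> v q) (scal \<PP> (of_real l) q)) \<longrightarrow>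
      q = 0 \<or> q = oneM) \<longleftrightarrow> N.irreducible_map"
    unfolding irreducible_iff_rconv[OF v] proj_eq le_eq ..
  note S6 = irreducible_iff_irreducible_on_1boxes[OF v v_def, symmetric]
  show ?thesis
    unfolding Let_def v_def[symmetric] B S3 S4 S5 S6 S7 S8 S9
    using S12 S23 by blast
qed

end
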